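(* Let $\mathbf M$ be a finite algebra. Suppose given: (i) an alter ego $\mathbb M_0=\langle M;H_0,R_0,\mathcal T\rangle$ of $\mathbf M$ such that (a) $\mathbb M_0$ dualises $\mathbf M$ at the finite level, (b) $\mathbb M_0$ is operationally rich at each relation in $R_0\cup\{\mathrm{dom}(h)\mid h\in H_0\}$, and (c) $\mathbb M_0$ is a reduct of $\mathbb M_\alpha$; (ii) an alter ego $\mathbb M_1$ that fully dualises $\mathbf M$ at the finite level; (iii) a finite basis $\Sigma_1$ for the universal Horn theory of $\mathbb M_1$. Construct $\mathbb M_2$ as follows. Start with $\mathbb M_2:=\mathbb M_0$. For each $\psi\in\Sigma_1$ whose conclusion is not in the language of $\mathbb M_0$: (1) convert $\psi$ into a finite set of pure uH-sentences $\varphi_1,\dots,\varphi_n$ (whose conjunction is logically equivalent to $\psi$); (2) for each $i$ such that the conclusion of $\varphi_i$ is not in the language of $\mathbb M_0$, let $r_i:=\mathrm{pr}_{\mathbb M_0}(\varphi_i)$ if the premise of $\varphi_i$ is in the language of $\mathbb M_0$, and let $r_i:=\mathrm{pr}_{\mathbb M_0}(\varphi_i^\natural)$ otherwise; (3) for each relation $r_i$ so obtained, add all the compatible partial operations on $\mathbf M$ with domain $r_i$ to the signature of $\mathbb M_2$. Then the resulting alter ego $\mathbb M_2$ is structurally equivalent to $\mathbb M_\alpha$, the smallest alter ego (in the structural reduct quasi-order) that fully dualises $\mathbf M$ at the finite level.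
   Context: All algebras are non-empty (so "subalgebra" means non-empty subalgebra). $\mathbf M=\langle M;\Sigma\rangle$ is a finite algebra and $\mathcal A:=\mathsf{ISP}(\mathbf M)$ is the class of isomorphic copies of subalgebras of arbitrary (possibly zero) powers of $\mathbf M$. Compatibility: an $n$-ary relation $r\subseteq M^n$ ($n\ge 0$) is compatible with $\mathbf M$ if it is the underlying set of a subalgebra $\mathbf r$ of $\mathbf M^n$; an $n$-ary partial operation $h$ on $M$ is compatible with $\mathbf M$ if $\mathrm{graph}(h)=\{(\vec a,h(\vec a))\mid \vec a\in\mathrm{dom}(h)\}$ is a compatible relation. An alter ego of $\mathbf M$ is $\mathbb M=\langle M;H,R,\mathcal T\rangle$ with $H$ a set of compatible partial operations (total and nullary operations allowed), $R$ a set of compatible relations and $\mathcal T$ the discrete topology. Elements of $H$ and $R$ are used as their own symbols; all symbols in $H$ are logically treated as partial operations. Logic: a term takes a value at a tuple iff all its subterms are defined there. An atomic formula is $s=t$ (true iff both sides are defined and equal) or $\rho(t_1,\dots,t_n)$ with $\rho\in R$ (true iff all $t_i$ are defined and the tuple is in $\rho$). A conjunct-atomic formula is a finite (possibly empty) conjunction of atomic formulas. A uH-sentence is $\forall\vec v\,[(\bigwedge_{i=1}^\nu\alpha_i(\vec v))\to\gamma(\vec v)]$, $\nu\ge0$, with premises $\alpha_i$ atomic and conclusion $\gamma$ atomic or $\bot$. A basis for the universal Horn theory of $\mathbb M$ is a set of uH-sentences true in $\mathbb M$ that implies all uH-sentences true in $\mathbb M$. A uH-sentence is pure if each $\alpha_i$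 has the form $r(v_{i_1},\dots,v_{i_n})$ or $h(v_{i_1},\dots,v_{i_n})=v_{i_0}$, and $\gamma$ has the form $r(v_{i_1},\dots,v_{i_n})$, or $h(v_{i_1},\dots,v_{i_n})=h(v_{i_1},\dots,v_{i_n})$, or $u=v$, or $\bot$, where all arguments are variables. A formula is in the language of $\mathbb M_0$ if every relation or partial-operation symbol in it belongs to $R_0\cup H_0$. For a sentence $\sigma=\forall\vec v\,[\psi(\vec v)\to\gamma(\vec v)]$, $\mathrm{pr}_{\mathbb X}(\sigma)$ is the relation on $X$ defined in $\mathbb X$ by the premise $\psi$. $\mathrm{Clo}_{\mathrm{ep}}(\mathbb M)$ is the smallest set of non-empty partial operations on $M$ containing $H$ and all projections $M^n\to M$ ($n\ge1$) and closed under composition when the composite has non-empty domain (i.e. the non-empty partial operations given by terms). $\mathrm{Rel}_{\mathrm{ca}}(\mathbb M)$ is the set of non-empty relations on $M$ defined in $\mathbb M$ by conjunct-atomic formulas. A compatible relation $r$ is hom-minimal if every homomorphism $\mathbf r\to\mathbf M$ is a projection. $\mathbb M$ is operationally rich at $r$ if every compatible partial operation on $\mathbf M$ with domain $r$ has an extension in $\mathrm{Clo}_{\mathrm{ep}}(\mathbb M)$. $\mathbb M_1$ is a structural reduct of $\mathbb M_2$ if each partial operation in $H_1$ has an extension in $\mathrm{Clo}_{\mathrm{ep}}(\mathbb M_2)$ and each relation in $R_1\cup\{\mathrm{dom}(h)\mid h\in H_1\}$ belongs to $\mathrm{Rel}_{\mathrm{ca}}(\mathbb M_2)$; they are structurally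 equivalent if each is a structural reduct of the other. $\mathbb M_\alpha=\langle M;H_\alpha,R_\alpha,\mathcal T\rangle$, where $R_\alpha$ is the set of (non-empty) relations defined by conjunct-atomic formulas in the structure on $M$ whose signature consists of all hom-minimal relations on $\mathbf M$, and $H_\alpha$ is the set of all compatible partial operations with domain in $R_\alpha$. "$\mathbb M_0$ is a reduct of $\mathbb M_\alpha$" means $H_0\subseteq H_\alpha$ and $R_0\subseteq R_\alpha$. The sentence $\varphi^\natural$: since $\mathbb M_0$ dualises $\mathbf M$ at the finite level, every hom-minimal relation on $\mathbf M$ belongs to $\mathrm{Rel}_{\mathrm{ca}}(\mathbb M_0)$ (a known fact). For each $n$-ary compatible relation $r$ fix an enumeration $f_1,\dots,f_m$ of $\hom_{\mathcal A}(\mathbf r,\mathbf M)$ and put $\widehat r=\{(\vec a,f_1(\vec a),\dots,f_m(\vec a))\mid\vec a\in r\}$, which is hom-minimal; fix a conjunct-atomic formula $\widehat\beta_r(\vec v,\vec w)$ in the language of $\mathbb M_0$ defining $\widehat r$ in $\mathbb M_0$, and let $\beta_r(\vec v):=\exists\vec w\,\widehat\beta_r(\vec v,\vec w)$. For a pure uH-sentence $\varphi$ whose symbols are compatible relations and partial operations, $\varphi^\natural$ is obtained by replacing each $r(v_{i_1},\dots,v_{i_n})$ by $\beta_r(v_{i_1},\dots,v_{i_n})$, each $h(v_{i_1},\dots,v_{i_n})=v_{i_0}$ by $\beta_{\mathrm{graph}(h)}(v_{i_1},\dots,v_{i_n},v_{i_0})$, and a conclusion $h(v_{i_1},\dots,v_{i_n})=h(v_{i_1},\dots,v_{i_n})$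 by $\beta_{\mathrm{dom}(h)}(v_{i_1},\dots,v_{i_n})$, and then moving the existential quantifiers in the premise out to the front as universal quantifiers (new variables for each premise conjunct). Duality: for an alter ego $\mathbb M$, $\mathcal Z$ is the category of Boolean structures of signature $(H,R)$: (possibly empty) compact Hausdorff totally disconnected spaces with continuous partial operations on closed domains and closed relations; morphisms are continuous maps preserving relations and the domains and graphs of partial operations. An induced substructure of $\mathbb Y$ is a subset closed under the partial operations (where defined), with subspace topology and restricted relations, domains and graphs. $\mathcal X:=\mathsf{IS_cP}^{+}(\mathbb M)$ consists of isomorphic copies of topologically closed induced substructures of powers $\mathbb M^S$, $S\neq\emptyset$ (the empty structure is included iff $H$ has no nullary operations). $D(\mathbf A)$ is the induced substructure of $\mathbb M^A$ on $\hom_{\mathcal A}(\mathbf A,\mathbf M)$, and $E(\mathbb Z)$ is the subalgebra of $\mathbf M^Z$ on $\hom_{\mathcal Z}(\mathbb Z,\mathbb M)$; $\eta_{\mathbf A}\colon\mathbf A\to ED(\mathbf A)$ and $\varepsilon_{\mathbb X}\colon\mathbb X\to DE(\mathbb X)$ are the evaluation maps. $\mathbb M$ dualises $\mathbf M$ at the finite level if $\eta_{\mathbf A}$ is an isomorphism for each finite $\mathbf A\in\mathcal A$; it fully dualises $\mathbf M$ at the finite level if, in addition, $\varepsilon_{\mathbb X}$ is an isomorphism for each finite $\mathbb X\in\mathcal X$. *)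

theory Defs
  imports "HOL-Analysis.Function_Topology"
begin

section \<open>Algebras\<close>

record ('a, 'f) algebra =
  carrier :: "'a set"
  fsyms :: "'f set"
  arity :: "'f \<Rightarrow> nat"
  opn :: "'f \<Rightarrow> 'a list \<Rightarrow> 'a"

definition tuples :: "'a set \<Rightarrow> nat \<Rightarrow> 'a list set" where
  "tuples X n = {xs. set xs \<subseteq> X \<and> length xs = n}"

definition is_algebra :: "('a, 'f) algebra \<Rightarrow> bool" where
  "is_algebra A \<longleftrightarrow> carrier A \<noteq> {} \<and>
     (\<forall>f\<in>fsyms A. \<forall>xs\<in>tuples (carrier A) (arity A f). opn A f xs \<in> carrier A)"

definition similar :: "('a, 'f) algebra \<Rightarrow> ('b, 'f) algebra \<Rightarrow> bool" where
  "similar A B \<longleftrightarrow> fsyms A = fsyms B \<and> (\<forall>f\<in>fsyms A. arity A f = arity B f)"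

definition subuniverse :: "('a, 'f) algebra \<Rightarrow> 'a set \<Rightarrow> bool" where
  "subuniverse A S \<longleftrightarrow> S \<noteq> {} \<and> S \<subseteq> carrier A \<and>
     (\<forall>f\<in>fsyms A. \<forall>xs\<in>tuples S (arity A f). opn A f xs \<in> S)"

definition alg_hom :: "('a, 'f) algebra \<Rightarrow> ('b, 'f) algebra \<Rightarrow> ('a \<Rightarrow> 'b) set" where
  "alg_hom A B = {h \<in> carrier A \<rightarrow>\<^sub>E carrier B.
     \<forall>f\<in>fsyms A. \<forall>xs\<in>tuples (carrier A) (arity A f). h (opn A f xs) = opn B f (map h xs)}"

definition alg_iso :: "('a \<Rightarrow> 'b) \<Rightarrow> ('a, 'f) algebra \<Rightarrow> ('b, 'f) algebra \<Rightarrow> bool" where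
  "alg_iso h A B \<longleftrightarrow> h \<in> alg_hom A B \<and> bij_betw h (carrier A) (carrier B)"

definition alg_power :: "('a, 'f) algebra \<Rightarrow> 'i set \<Rightarrow> ('i \<Rightarrow> 'a, 'f) algebra" where
  "alg_power A I = \<lparr>carrier = I \<rightarrow>\<^sub>E carrier A, fsyms = fsyms A, arity = arity A,
     opn = (\<lambda>f xs. \<lambda>i\<in>I. opn A f (map (\<lambda>x. x i) xs))\<rparr>"

text \<open>The power \<open>A\<^sup>n\<close> with elements represented as lists of length \<open>n\<close>.\<close>

definition tuple_power :: "('a, 'f) algebra \<Rightarrow> nat \<Rightarrow> ('a list, 'f) algebra" where
  "tuple_power A n = \<lparr>carrier = tuples (carrier A) n, fsyms = fsyms A, arity = arity A,
     opn = (\<lambda>f xs. map (\<lambda>i. opn A f (map (\<lambda>x. x ! i) xs)) [0..<n])\<rparr>"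

text \<open>An algebra \<open>A\<close> that embeds into some power of \<open>M\<close> also embeds into a power whose exponent
  is a set of maps from \<open>A\<close> to \<open>M\<close> (index by the coordinate maps of the embedding), so
  restricting the type of the exponent loses nothing.\<close>

definition ISP :: "('a, 'f) algebra \<Rightarrow> ('b, 'f) algebra \<Rightarrow> bool" where
  "ISP M A \<longleftrightarrow> is_algebra A \<and> similar A M \<and>
     (\<exists>(I :: ('b \<Rightarrow> 'a) set) B e. subuniverse (alg_power M I) B \<and>
        alg_iso e A ((alg_power M I)\<lparr>carrier := B\<rparr>))"


section \<open>Compatible relations and partial operations, alter egos\<close>

text \<open>Relations are sets of lists and partial operations are partial maps on lists.  Compatible
  relations and the domains of compatible partial operations are nonempty, hence determine
  their arity.\<close>

type_synonym 'a frel = "'a list set"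
type_synonym 'a pop = "'a list \<Rightarrow> 'a option"

definition rel_arity :: "'a frel \<Rightarrow> nat" where
  "rel_arity r = length (SOME xs. xs \<in> r)"

abbreviation op_arity :: "'a pop \<Rightarrow> nat" where
  "op_arity h \<equiv> rel_arity (dom h)"

definition op_graph :: "'a pop \<Rightarrow> 'a frel" where
  "op_graph h = {xs @ [y] |xs y. h xs = Some y}"

definition compat_rel :: "('a, 'f) algebra \<Rightarrow> 'a frel \<Rightarrow> bool" where
  "compat_rel M r \<longleftrightarrow> (\<exists>n. subuniverse (tuple_power M n) r)"

definition compat_op :: "('a, 'f) algebra \<Rightarrow> 'a pop \<Rightarrow> bool" where
  "compat_op M h \<longleftrightarrow> compat_rel M (op_graph h)"

definition rel_alg :: "('a, 'f) algebra \<Rightarrow> 'a frel \<Rightarrow> ('a list, 'f) algebra" where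
  "rel_alg M r = (tuple_power M (rel_arity r))\<lparr>carrier := r\<rparr>"

definition hom_minimal :: "('a, 'f) algebra \<Rightarrow> 'a frel \<Rightarrow> bool" where
  "hom_minimal M r \<longleftrightarrow> compat_rel M r \<and>
     (\<forall>f\<in>alg_hom (rel_alg M r) M. \<exists>i<rel_arity r. \<forall>xs\<in>r. f xs = xs ! i)"

text \<open>The underlying set and the discrete topology of an alter ego are those of the algebra
  \<open>M\<close> it belongs to and are not repeated in the record.\<close>

record 'a alter_ego =
  ops :: "'a pop set"
  rels :: "'a frel set"

definition is_alter_ego :: "('a, 'f) algebra \<Rightarrow> 'a alter_ego \<Rightarrow> bool" where
  "is_alter_ego M S \<longleftrightarrow> (\<forall>h\<in>ops S. compat_op M h) \<and> (\<forall>r\<in>rels S. compat_rel M r)"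


section \<open>Structures of the signature of an alter ego\<close>

text \<open>The operations and relations of an alter ego serve as their own symbols.\<close>

record ('x, 'a) struct =
  univ :: "'x set"
  opI :: "'a pop \<Rightarrow> 'x pop"
  relI :: "'a frel \<Rightarrow> 'x frel"

definition is_struct :: "'a alter_ego \<Rightarrow> ('x, 'a, 'z) struct_scheme \<Rightarrow> bool" where
  "is_struct S X \<longleftrightarrow>
     (\<forall>h\<in>ops S. dom (opI X h) \<subseteq> tuples (univ X) (op_arity h) \<and> ran (opI X h) \<subseteq> univ X) \<and>
     (\<forall>r\<in>rels S. relI X r \<subseteq> tuples (univ X) (rel_arity r))"

record ('x, 'a) tstruct = "('x, 'a) struct" +
  topo :: "'x topology"

definition is_tstruct :: "'a alter_ego \<Rightarrow> ('x, 'a) tstruct \<Rightarrow> bool" where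
  "is_tstruct S X \<longleftrightarrow> is_struct S X \<and> topspace (topo X) = univ X"

definition self_struct :: "('a, 'f) algebra \<Rightarrow> ('a, 'a) tstruct" where
  "self_struct M = \<lparr>univ = carrier M, opI = (\<lambda>h. h), relI = (\<lambda>r. r),
     topo = discrete_topology (carrier M)\<rparr>"

text \<open>Only used for a nonempty exponent \<open>I\<close>.\<close>

definition power_struct :: "('a, 'f) algebra \<Rightarrow> 'i set \<Rightarrow> ('i \<Rightarrow> 'a, 'a) tstruct" where
  "power_struct M I = \<lparr>univ = I \<rightarrow>\<^sub>E carrier M,
     opI = (\<lambda>h xs. if xs \<in> lists (I \<rightarrow>\<^sub>E carrier M) \<and> (\<forall>i\<in>I. map (\<lambda>x. x i) xs \<in> dom h)
                    then Some (\<lambda>i\<in>I. the (h (map (\<lambda>x. x i) xs))) else None),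
     relI = (\<lambda>r. {xs \<in> lists (I \<rightarrow>\<^sub>E carrier M). \<forall>i\<in>I. map (\<lambda>x. x i) xs \<in> r}),
     topo = product_topology (\<lambda>_. discrete_topology (carrier M)) I\<rparr>"

definition op_closed :: "'a alter_ego \<Rightarrow> ('x, 'a) tstruct \<Rightarrow> 'x set \<Rightarrow> bool" where
  "op_closed S X Y \<longleftrightarrow> Y \<subseteq> univ X \<and>
     (\<forall>h\<in>ops S. \<forall>xs\<in>lists Y. \<forall>y. opI X h xs = Some y \<longrightarrow> y \<in> Y)"

definition induced :: "('x, 'a) tstruct \<Rightarrow> 'x set \<Rightarrow> ('x, 'a) tstruct" where
  "induced X Y = \<lparr>univ = Y, opI = (\<lambda>h. opI X h |` lists Y), relI = (\<lambda>r. relI X r \<inter> lists Y),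
     topo = subtopology (topo X) Y\<rparr>"

definition str_hom ::
  "'a alter_ego \<Rightarrow> ('x, 'a) tstruct \<Rightarrow> ('y, 'a) tstruct \<Rightarrow> ('x \<Rightarrow> 'y) set" where
  "str_hom S X Y = {f \<in> univ X \<rightarrow>\<^sub>E univ Y. continuous_map (topo X) (topo Y) f \<and>
     (\<forall>r\<in>rels S. \<forall>xs\<in>relI X r. map f xs \<in> relI Y r) \<and>
     (\<forall>h\<in>ops S. \<forall>xs y. opI X h xs = Some y \<longrightarrow> opI Y h (map f xs) = Some (f y))}"

definition str_iso ::
  "'a alter_ego \<Rightarrow> ('x \<Rightarrow> 'y) \<Rightarrow> ('x, 'a) tstruct \<Rightarrow> ('y, 'a) tstruct \<Rightarrow> bool" where
  "str_iso S f X Y \<longleftrightarrow> f \<in> str_hom S X Y \<and> bij_betw f (univ X) (univ Y) \<and>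
     restrict (inv_into (univ X) f) (univ Y) \<in> str_hom S Y X"

text \<open>The exponent is again, without loss of generality, a set of maps from \<open>X\<close> to \<open>M\<close>.  The
  empty set is closed under the operations exactly when there is no nullary operation, and
  members are automatically Boolean structures.\<close>

definition IScP_plus :: "('a, 'f) algebra \<Rightarrow> 'a alter_ego \<Rightarrow> ('x, 'a) tstruct \<Rightarrow> bool" where
  "IScP_plus M S X \<longleftrightarrow> is_tstruct S X \<and>
     (\<exists>(I :: ('x \<Rightarrow> 'a) set) Y f. I \<noteq> {} \<and> op_closed S (power_struct M I) Y \<and>
        closedin (topo (power_struct M I)) Y \<and> str_iso S f X (induced (power_struct M I) Y))"


section \<open>Duality at the finite level\<close>

definition dual_D :: "('a, 'f) algebra \<Rightarrow> ('b, 'f) algebra \<Rightarrow> ('b \<Rightarrow> 'a, 'a) tstruct" where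
  "dual_D M A = induced (power_struct M (carrier A)) (alg_hom A M)"

definition dual_E ::
  "('a, 'f) algebra \<Rightarrow> 'a alter_ego \<Rightarrow> ('x, 'a) tstruct \<Rightarrow> ('x \<Rightarrow> 'a, 'f) algebra" where
  "dual_E M S Z = (alg_power M (univ Z))\<lparr>carrier := str_hom S Z (self_struct M)\<rparr>"

definition eta :: "('a, 'f) algebra \<Rightarrow> ('b, 'f) algebra \<Rightarrow> 'b \<Rightarrow> ('b \<Rightarrow> 'a) \<Rightarrow> 'a" where
  "eta M A = (\<lambda>a\<in>carrier A. \<lambda>x\<in>alg_hom A M. x a)"

definition epsilon ::
  "('a, 'f) algebra \<Rightarrow> 'a alter_ego \<Rightarrow> ('x, 'a) tstruct \<Rightarrow> 'x \<Rightarrow> ('x \<Rightarrow> 'a) \<Rightarrow> 'a" where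
  "epsilon M S X = (\<lambda>x\<in>univ X. \<lambda>u\<in>str_hom S X (self_struct M). u x)"

text \<open>Every finite algebra or structure has an isomorphic copy on a set of natural numbers.\<close>

definition dualises_fin :: "('a, 'f) algebra \<Rightarrow> 'a alter_ego \<Rightarrow> bool" where
  "dualises_fin M S \<longleftrightarrow> (\<forall>A :: (nat, 'f) algebra. finite (carrier A) \<and> ISP M A \<longrightarrow>
     alg_iso (eta M A) A (dual_E M S (dual_D M A)))"

definition fully_dualises_fin :: "('a, 'f) algebra \<Rightarrow> 'a alter_ego \<Rightarrow> bool" where
  "fully_dualises_fin M S \<longleftrightarrow> dualises_fin M S \<and>
     (\<forall>X :: (nat, 'a) tstruct. finite (univ X) \<and> IScP_plus M S X \<longrightarrow>
        str_iso S (epsilon M S X) X (dual_D M (dual_E M S X)))"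


section \<open>Formulas\<close>

datatype (term_ops: 'h) trm = Var nat | App 'h "'h trm list"

datatype (atom_ops: 'h, atom_rels: 'r) atomic = Eq "'h trm" "'h trm" | Rel 'r "'h trm list"

type_synonym 'a atm = "('a pop, 'a frel) atomic"

primrec term_val :: "('x, 'a, 'z) struct_scheme \<Rightarrow> 'x list \<Rightarrow> 'a pop trm \<Rightarrow> 'x option" where
  "term_val X xs (Var i) = Some (xs ! i)"
| "term_val X xs (App h ts) = Option.bind (those (map (term_val X xs) ts)) (opI X h)"

primrec holds :: "('x, 'a, 'z) struct_scheme \<Rightarrow> 'x list \<Rightarrow> 'a atm \<Rightarrow> bool" where
  "holds X xs (Eq s t) \<longleftrightarrow> (\<exists>y. term_val X xs s = Some y \<and> term_val X xs t = Some y)"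
| "holds X xs (Rel r ts) \<longleftrightarrow> (\<exists>ys. those (map (term_val X xs) ts) = Some ys \<and> ys \<in> relI X r)"

primrec wf_term :: "nat \<Rightarrow> 'a pop trm \<Rightarrow> bool" where
  "wf_term n (Var i) \<longleftrightarrow> i < n"
| "wf_term n (App h ts) \<longleftrightarrow> length ts = op_arity h \<and> list_all (wf_term n) ts"

primrec wf_atom :: "nat \<Rightarrow> 'a atm \<Rightarrow> bool" where
  "wf_atom n (Eq s t) \<longleftrightarrow> wf_term n s \<and> wf_term n t"
| "wf_atom n (Rel r ts) \<longleftrightarrow> length ts = rel_arity r \<and> list_all (wf_term n) ts"

definition in_lang :: "'a alter_ego \<Rightarrow> 'a atm \<Rightarrow> bool" where
  "in_lang S \<alpha> \<longleftrightarrow> atom_ops \<alpha> \<subseteq> ops S \<and> atom_rels \<alpha> \<subseteq> rels S"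

text \<open>A conjunct-atomic formula in the variables \<open>v\<^sub>0, \<dots>, v\<^bsub>n-1\<^esub>\<close> is a list of atomic formulas.\<close>

definition ca_formula :: "'a alter_ego \<Rightarrow> nat \<Rightarrow> 'a atm list \<Rightarrow> bool" where
  "ca_formula S n \<alpha>s \<longleftrightarrow> (\<forall>\<alpha>\<in>set \<alpha>s. wf_atom n \<alpha> \<and> in_lang S \<alpha>)"

definition defined_rel :: "('x, 'a, 'z) struct_scheme \<Rightarrow> nat \<Rightarrow> 'a atm list \<Rightarrow> 'x frel" where
  "defined_rel X n \<alpha>s = {xs \<in> tuples (univ X) n. \<forall>\<alpha>\<in>set \<alpha>s. holds X xs \<alpha>}"

text \<open>\<open>Sentence n \<alpha>s \<gamma>\<close> is \<open>\<forall>v\<^sub>0 \<dots> v\<^bsub>n-1\<^esub>. \<And>\<alpha>s \<longrightarrow> \<gamma>\<close>.  For uH-sentences \<open>\<gamma>\<close> is an atomic formula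
  or, for \<open>None\<close>, falsity.\<close>

datatype ('a, 'c) sentence = Sentence (nvars: nat) (prem: "'a atm list") (concl: 'c)

type_synonym 'a uH = "('a, 'a atm option) sentence"

definition uH_sentence :: "'a alter_ego \<Rightarrow> 'a uH \<Rightarrow> bool" where
  "uH_sentence S \<phi> \<longleftrightarrow> ca_formula S (nvars \<phi>) (prem \<phi>) \<and>
     (\<forall>\<gamma>. concl \<phi> = Some \<gamma> \<longrightarrow> wf_atom (nvars \<phi>) \<gamma> \<and> in_lang S \<gamma>)"

definition pr :: "('x, 'a, 'z) struct_scheme \<Rightarrow> ('a, 'c) sentence \<Rightarrow> 'x frel" where
  "pr X \<phi> = defined_rel X (nvars \<phi>) (prem \<phi>)"

definition models :: "('x, 'a, 'z) struct_scheme \<Rightarrow> 'a uH \<Rightarrow> bool" where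
  "models X \<phi> \<longleftrightarrow> (\<forall>xs\<in>pr X \<phi>. case concl \<phi> of None \<Rightarrow> False | Some \<gamma> \<Rightarrow> holds X xs \<gamma>)"

text \<open>Structures may be empty.  For a finite \<open>M\<close> the signature of an alter ego is countable and
  uH-sentences are inherited by generated substructures, so structures on sets of natural
  numbers decide consequence and equivalence.\<close>

definition uH_implies :: "'a alter_ego \<Rightarrow> 'a uH set \<Rightarrow> 'a uH \<Rightarrow> bool" where
  "uH_implies S \<Sigma> \<sigma> \<longleftrightarrow>
     (\<forall>X :: (nat, 'a) struct. is_struct S X \<and> (\<forall>\<phi>\<in>\<Sigma>. models X \<phi>) \<longrightarrow> models X \<sigma>)"

definition uH_equivalent :: "'a alter_ego \<Rightarrow> 'a uH \<Rightarrow> 'a uH set \<Rightarrow> bool" where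
  "uH_equivalent S \<psi> \<Phi> \<longleftrightarrow>
     (\<forall>X :: (nat, 'a) struct. is_struct S X \<longrightarrow> (models X \<psi> \<longleftrightarrow> (\<forall>\<phi>\<in>\<Phi>. models X \<phi>)))"

definition uH_basis :: "('a, 'f) algebra \<Rightarrow> 'a alter_ego \<Rightarrow> 'a uH set \<Rightarrow> bool" where
  "uH_basis M S \<Sigma> \<longleftrightarrow> (\<forall>\<phi>\<in>\<Sigma>. uH_sentence S \<phi> \<and> models (self_struct M) \<phi>) \<and>
     (\<forall>\<sigma>. uH_sentence S \<sigma> \<and> models (self_struct M) \<sigma> \<longrightarrow> uH_implies S \<Sigma> \<sigma>)"

definition pure_prem :: "'a atm \<Rightarrow> bool" where
  "pure_prem \<alpha> \<longleftrightarrow> (\<exists>r is. \<alpha> = Rel r (map Var is)) \<or>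
     (\<exists>h is j. \<alpha> = Eq (App h (map Var is)) (Var j))"

definition pure_concl :: "'a atm option \<Rightarrow> bool" where
  "pure_concl \<gamma> \<longleftrightarrow> (\<exists>r is. \<gamma> = Some (Rel r (map Var is))) \<or>
     (\<exists>h is. \<gamma> = Some (Eq (App h (map Var is)) (App h (map Var is)))) \<or>
     (\<exists>i j. \<gamma> = Some (Eq (Var i) (Var j))) \<or> \<gamma> = None"

definition pure :: "'a uH \<Rightarrow> bool" where
  "pure \<phi> \<longleftrightarrow> (\<forall>\<alpha>\<in>set (prem \<phi>). pure_prem \<alpha>) \<and> pure_concl (concl \<phi>)"

definition prem_in_lang :: "'a alter_ego \<Rightarrow> 'a uH \<Rightarrow> bool" where
  "prem_in_lang S \<phi> \<longleftrightarrow> (\<forall>\<alpha>\<in>set (prem \<phi>). in_lang S \<alpha>)"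

definition concl_in_lang :: "'a alter_ego \<Rightarrow> 'a uH \<Rightarrow> bool" where
  "concl_in_lang S \<phi> \<longleftrightarrow> (\<forall>\<gamma>. concl \<phi> = Some \<gamma> \<longrightarrow> in_lang S \<gamma>)"


section \<open>Clones, structural reducts and the alter ego \<open>M_alpha\<close>\<close>

definition projection :: "('a, 'f) algebra \<Rightarrow> nat \<Rightarrow> nat \<Rightarrow> 'a pop" where
  "projection M n i = (\<lambda>xs. if xs \<in> tuples (carrier M) n then Some (xs ! i) else None)"

definition compose :: "('a, 'f) algebra \<Rightarrow> nat \<Rightarrow> 'a pop \<Rightarrow> 'a pop list \<Rightarrow> 'a pop" where
  "compose M k g hs = (\<lambda>xs. if xs \<in> tuples (carrier M) k
     then Option.bind (those (map (\<lambda>h. h xs) hs)) g else None)"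

text \<open>The arity \<open>k\<close> of a composite is given explicitly because of nullary \<open>g\<close>, which are composed
  with an empty list.\<close>

inductive_set Clo_ep :: "('a, 'f) algebra \<Rightarrow> 'a alter_ego \<Rightarrow> 'a pop set"
  for M :: "('a, 'f) algebra" and S :: "'a alter_ego" where
  base: "h \<in> ops S \<Longrightarrow> h \<in> Clo_ep M S"
| proj: "i < n \<Longrightarrow> projection M n i \<in> Clo_ep M S"
| comp: "\<lbrakk>g \<in> Clo_ep M S; length hs = op_arity g;
    \<forall>h\<in>set hs. h \<in> Clo_ep M S \<and> op_arity h = k; compose M k g hs \<noteq> Map.empty\<rbrakk>
    \<Longrightarrow> compose M k g hs \<in> Clo_ep M S"

definition Rel_ca :: "('a, 'f) algebra \<Rightarrow> 'a alter_ego \<Rightarrow> 'a frel set" where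
  "Rel_ca M S = {r. r \<noteq> {} \<and>
     (\<exists>n \<alpha>s. ca_formula S n \<alpha>s \<and> r = defined_rel (self_struct M) n \<alpha>s)}"

definition has_extension :: "('a, 'f) algebra \<Rightarrow> 'a alter_ego \<Rightarrow> 'a pop \<Rightarrow> bool" where
  "has_extension M S h \<longleftrightarrow> (\<exists>g\<in>Clo_ep M S. h \<subseteq>\<^sub>m g)"

definition operationally_rich :: "('a, 'f) algebra \<Rightarrow> 'a alter_ego \<Rightarrow> 'a frel \<Rightarrow> bool" where
  "operationally_rich M S r \<longleftrightarrow> (\<forall>h. compat_op M h \<and> dom h = r \<longrightarrow> has_extension M S h)"

definition structural_reduct ::
  "('a, 'f) algebra \<Rightarrow> 'a alter_ego \<Rightarrow> 'a alter_ego \<Rightarrow> bool" where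
  "structural_reduct M S1 S2 \<longleftrightarrow> (\<forall>h\<in>ops S1. has_extension M S2 h) \<and>
     rels S1 \<union> dom ` ops S1 \<subseteq> Rel_ca M S2"

definition structurally_equivalent ::
  "('a, 'f) algebra \<Rightarrow> 'a alter_ego \<Rightarrow> 'a alter_ego \<Rightarrow> bool" where
  "structurally_equivalent M S1 S2 \<longleftrightarrow> structural_reduct M S1 S2 \<and> structural_reduct M S2 S1"

definition R_alpha :: "('a, 'f) algebra \<Rightarrow> 'a frel set" where
  "R_alpha M = Rel_ca M \<lparr>ops = {}, rels = {r. hom_minimal M r}\<rparr>"

definition M_alpha :: "('a, 'f) algebra \<Rightarrow> 'a alter_ego" where
  "M_alpha M = \<lparr>ops = {h. compat_op M h \<and> dom h \<in> R_alpha M}, rels = R_alpha M\<rparr>"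

definition reduct :: "'a alter_ego \<Rightarrow> 'a alter_ego \<Rightarrow> bool" where
  "reduct S1 S2 \<longleftrightarrow> ops S1 \<subseteq> ops S2 \<and> rels S1 \<subseteq> rels S2"


section \<open>The sentence \<open>natural \<phi>\<close>\<close>

text \<open>\<open>en r\<close> is an enumeration of the homomorphisms from \<open>r\<close> to \<open>M\<close>, and \<open>\<beta> r\<close> is a
  conjunct-atomic formula defining the resulting relation \<open>rel_hat\<close>; its first variables
  stand for the coordinates of \<open>r\<close> and the remaining \<open>length (en r)\<close> ones are those quantified
  existentially in \<open>\<exists>w. \<beta> r (v, w)\<close>.\<close>

definition rel_hat :: "('a list \<Rightarrow> 'a) list \<Rightarrow> 'a frel \<Rightarrow> 'a frel" where
  "rel_hat fs r = {xs @ map (\<lambda>f. f xs) fs |xs. xs \<in> r}"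

definition hat_choice :: "('a, 'f) algebra \<Rightarrow> 'a alter_ego \<Rightarrow>
    ('a frel \<Rightarrow> ('a list \<Rightarrow> 'a) list) \<Rightarrow> ('a frel \<Rightarrow> 'a atm list) \<Rightarrow> bool" where
  "hat_choice M S en \<beta> \<longleftrightarrow> (\<forall>r. compat_rel M r \<longrightarrow>
     distinct (en r) \<and> set (en r) = alg_hom (rel_alg M r) M \<and>
     ca_formula S (rel_arity r + length (en r)) (\<beta> r) \<and>
     defined_rel (self_struct M) (rel_arity r + length (en r)) (\<beta> r) = rel_hat (en r) r)"

primrec subst_term :: "(nat \<Rightarrow> 'h trm) \<Rightarrow> 'h trm \<Rightarrow> 'h trm" where
  "subst_term \<theta> (Var i) = \<theta> i"
| "subst_term \<theta> (App h ts) = App h (map (subst_term \<theta>) ts)"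

primrec subst_atom :: "(nat \<Rightarrow> 'h trm) \<Rightarrow> ('h, 'r) atomic \<Rightarrow> ('h, 'r) atomic" where
  "subst_atom \<theta> (Eq s t) = Eq (subst_term \<theta> s) (subst_term \<theta> t)"
| "subst_atom \<theta> (Rel r ts) = Rel r (map (subst_term \<theta>) ts)"

text \<open>The formula \<open>\<beta> r\<close> with \<open>ts\<close> for the first variables and \<open>v\<^sub>k, v\<^bsub>k+1\<^esub>, \<dots>\<close> for the others.\<close>

definition beta_inst :: "('a frel \<Rightarrow> ('a list \<Rightarrow> 'a) list) \<Rightarrow> ('a frel \<Rightarrow> 'a atm list) \<Rightarrow>
    nat \<Rightarrow> 'a frel \<Rightarrow> 'a pop trm list \<Rightarrow> 'a atm list" where
  "beta_inst en \<beta> k r ts =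
     map (subst_atom (\<lambda>i. (ts @ map Var [k..<k + length (en r)]) ! i)) (\<beta> r)"

text \<open>The result consists of the next unused variable and the new premise.  The last equation is
  irrelevant for pure sentences.\<close>

fun natural_prem :: "('a frel \<Rightarrow> ('a list \<Rightarrow> 'a) list) \<Rightarrow> ('a frel \<Rightarrow> 'a atm list) \<Rightarrow>
    nat \<Rightarrow> 'a atm list \<Rightarrow> nat \<times> 'a atm list" where
  "natural_prem en \<beta> k [] = (k, [])"
| "natural_prem en \<beta> k (Rel r ts # \<alpha>s) =
     (let (k', \<alpha>s') = natural_prem en \<beta> (k + length (en r)) \<alpha>s
      in (k', beta_inst en \<beta> k r ts @ \<alpha>s'))"
| "natural_prem en \<beta> k (Eq (App h ts) t # \<alpha>s) =
     (let (k', \<alpha>s') = natural_prem en \<beta> (k + length (en (op_graph h))) \<alpha>s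
      in (k', beta_inst en \<beta> k (op_graph h) (ts @ [t]) @ \<alpha>s'))"
| "natural_prem en \<beta> k (Eq (Var i) t # \<alpha>s) =
     (let (k', \<alpha>s') = natural_prem en \<beta> k \<alpha>s in (k', Eq (Var i) t # \<alpha>s'))"

text \<open>A conclusion \<open>Some (m, \<gamma>s)\<close> stands for the conjunction of \<open>\<gamma>s\<close> with \<open>v\<^sub>k, \<dots>, v\<^bsub>k+m-1\<^esub>\<close>
  existentially quantified, where \<open>k\<close> is the number of universally quantified variables.\<close>

fun natural_concl :: "('a frel \<Rightarrow> ('a list \<Rightarrow> 'a) list) \<Rightarrow> ('a frel \<Rightarrow> 'a atm list) \<Rightarrow>
    nat \<Rightarrow> 'a atm option \<Rightarrow> (nat \<times> 'a atm list) option" where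
  "natural_concl en \<beta> k None = None"
| "natural_concl en \<beta> k (Some (Rel r ts)) = Some (length (en r), beta_inst en \<beta> k r ts)"
| "natural_concl en \<beta> k (Some (Eq (App h ts) t)) =
     Some (length (en (dom h)), beta_inst en \<beta> k (dom h) ts)"
| "natural_concl en \<beta> k (Some (Eq (Var i) t)) = Some (0, [Eq (Var i) t])"

definition natural :: "('a frel \<Rightarrow> ('a list \<Rightarrow> 'a) list) \<Rightarrow> ('a frel \<Rightarrow> 'a atm list) \<Rightarrow>
    'a uH \<Rightarrow> ('a, (nat \<times> 'a atm list) option) sentence" where
  "natural en \<beta> \<phi> = (let (k, \<alpha>s) = natural_prem en \<beta> (nvars \<phi>) (prem \<phi>)
     in Sentence k \<alpha>s (natural_concl en \<beta> k (concl \<phi>)))"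


section \<open>The construction of the alter ego \<open>M_two\<close>\<close>

definition pure_conversion ::
  "'a alter_ego \<Rightarrow> 'a alter_ego \<Rightarrow> 'a uH set \<Rightarrow> ('a uH \<Rightarrow> 'a uH set) \<Rightarrow> bool" where
  "pure_conversion S0 S1 \<Sigma> conv \<longleftrightarrow> (\<forall>\<psi>\<in>\<Sigma>. \<not> concl_in_lang S0 \<psi> \<longrightarrow>
     finite (conv \<psi>) \<and> (\<forall>\<phi>\<in>conv \<psi>. uH_sentence S1 \<phi> \<and> pure \<phi>) \<and>
     uH_equivalent S1 \<psi> (conv \<psi>))"

definition new_domain :: "('a, 'f) algebra \<Rightarrow> 'a alter_ego \<Rightarrow>
    ('a frel \<Rightarrow> ('a list \<Rightarrow> 'a) list) \<Rightarrow> ('a frel \<Rightarrow> 'a atm list) \<Rightarrow> 'a uH \<Rightarrow> 'a frel" where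
  "new_domain M S0 en \<beta> \<phi> = (if prem_in_lang S0 \<phi> then pr (self_struct M) \<phi>
     else pr (self_struct M) (natural en \<beta> \<phi>))"

text \<open>If a domain is empty then no operation is added, since compatible partial operations have
  nonempty domains.\<close>

definition M_two :: "('a, 'f) algebra \<Rightarrow> 'a alter_ego \<Rightarrow>
    ('a frel \<Rightarrow> ('a list \<Rightarrow> 'a) list) \<Rightarrow> ('a frel \<Rightarrow> 'a atm list) \<Rightarrow>
    ('a uH \<Rightarrow> 'a uH set) \<Rightarrow> 'a uH set \<Rightarrow> 'a alter_ego" where
  "M_two M S0 en \<beta> conv \<Sigma> = \<lparr>ops = ops S0 \<union>
       {h. compat_op M h \<and> (\<exists>\<psi>\<in>\<Sigma>. \<not> concl_in_lang S0 \<psi> \<and>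
          (\<exists>\<phi>\<in>conv \<psi>. \<not> concl_in_lang S0 \<phi> \<and> dom h = new_domain M S0 en \<beta> \<phi>))},
     rels = rels S0\<rparr>"

end

(* Operations and relations of M_two are built from a dualising alter ego, so the point is operational
   richness: every compatible h with domain r in R_alpha must extend to an operation in the clone of
   M_two. Let X be the set of functions in M^r obtained by restricting this clone to r. Relations s of
   M_1 are interpreted on X by "xs lies pointwise in s, and f o xs belongs to X for every homomorphism
   f from s to M"; this is what beta_s defines. Richness of M_0 and the operations added to M_two say
   precisely that X satisfies the sentences in the basis, so it satisfies the universal Horn theory of
   M_1 and, being finite, embeds into a power of M_1. Full duality for M_1 then shows that the
   homomorphism u -> h(u(p_1), ..., u(p_n)) on the dual of X (p_i the projections) is evaluation at an
   element of X, and this element is an extension of h restricted to r.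

   M_alpha fully dualises because, on a structure closed under all operations with domain s,
   preserving these operations amounts to preserving the hom-minimal relation rel_hat s. It is the
   smallest such alter ego because a fully dualising S defines all hom-minimal relations and, by the
   argument above with M_1 and M_two both replaced by S, is operationally rich at every relation it
   defines. *)

theory Submission
  imports Defs "HOL-Analysis.T1_Spaces"
begin

section \<open>Formulas and structure maps\<close>

text \<open>The obstacle is that \<open>M1\<close> and \<open>M0\<close> have different signatures.
  The clone functions on \<open>r\<close> need not be closed under the operations of
  \<open>M1\<close>, so they do not form a substructure of a power from the start;
  \<open>sharp_struct\<close> is an abstract structure, and only the truth of the basis in it yields
  enough morphisms into \<open>M\<close> to reflect relations and domains. The interpretation by
  homomorphisms makes the two halves of the construction fit. A premise true of clone functions
  supplies, through these homomorphisms, clone functions for the additional variables of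
  \<open>natural\<close>, so that the extended tuple lies pointwise in the new domain. A
  homomorphism from the relation in the conclusion, pulled back to that domain, is an operation
  added to \<open>M2\<close>.

  A second gap: a morphism \<open>u\<close> on this structure need not be an evaluation, and
  \<open>h\<close> can be applied to the values of \<open>u\<close> at the projections only if they
  form a tuple of \<open>r\<close>. As \<open>r\<close> need not be a relation of \<open>M1\<close>,
  this uses that \<open>r\<close> is cut out by hom-minimal relations and that dualisation by
  \<open>M1\<close> forces \<open>u\<close> to respect these.\<close>

lemma those_eq_Some_iff: "those xs = Some ys \<longleftrightarrow> xs = map Some ys"
  by (induction xs arbitrary: ys) (auto split: option.splits simp: Cons_eq_map_conv)

lemma bind_those_eq_Some_iff:
  "Option.bind (those xs) g = Some y \<longleftrightarrow> (\<exists>ys. xs = map Some ys \<and> g ys = Some y)"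
  by (auto simp: bind_eq_Some_conv those_eq_Some_iff)

lemma map_eq_map_SomeD:
  assumes "map g ts = map Some ys"
  shows "length ys = length ts" and "i < length ts \<Longrightarrow> g (ts ! i) = Some (ys ! i)"
proof -
  show l: "length ys = length ts"
    using arg_cong[OF assms, of length] by simp
  show "g (ts ! i) = Some (ys ! i)" if "i < length ts"
    using arg_cong[OF assms, of "\<lambda>l. l ! i"] that l by simp
qed

lemma eq_map_SomeI:
  assumes "length ys = length ts" and "\<And>i. i < length ts \<Longrightarrow> g (ts ! i) = Some (ys ! i)"
  shows "map g ts = map Some ys"
  using assms by (auto intro: nth_equalityI)

text \<open>The length guards matter for powers with empty exponent, where lists of every length
  satisfy every relation vacuously. Such powers arise in \<open>preserves_opn\<close> from nullary
  basic operations of \<open>M\<close>. Topology and underlying sets are left out so that the notion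
  also applies to structures without a topology.\<close>

definition preserves ::
  "'a alter_ego \<Rightarrow> ('x, 'a, 'z) struct_scheme \<Rightarrow> ('y, 'a, 'w) struct_scheme \<Rightarrow> ('x \<Rightarrow> 'y) \<Rightarrow> bool"
where
  "preserves S X Y f \<longleftrightarrow>
     (\<forall>r\<in>rels S. \<forall>xs\<in>relI X r. length xs = rel_arity r \<longrightarrow> map f xs \<in> relI Y r) \<and>
     (\<forall>h\<in>ops S. \<forall>xs y. length xs = op_arity h \<longrightarrow> opI X h xs = Some y \<longrightarrow>
        opI Y h (map f xs) = Some (f y))"

lemma preserves_term_val:
  assumes "preserves S X Y f" "wf_term (length xs) t" "term_ops t \<subseteq> ops S"
    "term_val X xs t = Some y"
  shows "term_val Y (map f xs) t = Some (f y)"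
  using assms(2-)
proof (induction t arbitrary: y)
  case (Var i)
  then show ?case by auto
next
  case (App h ts)
  from App.prems(3) obtain ys where ys: "map (term_val X xs) ts = map Some ys" "opI X h ys = Some y"
    by (auto simp: bind_those_eq_Some_iff)
  note D = map_eq_map_SomeD[OF ys(1)]
  have "map (term_val Y (map f xs)) ts = map Some (map f ys)"
  proof (rule eq_map_SomeI)
    show "length (map f ys) = length ts" using D(1) by simp
    fix i assume i: "i < length ts"
    have "wf_term (length xs) (ts ! i)" "term_ops (ts ! i) \<subseteq> ops S"
      using App.prems nth_mem[OF i] by (auto simp: list_all_iff)
    then show "term_val Y (map f xs) (ts ! i) = Some (map f ys ! i)"
      using App.IH[OF nth_mem[OF i]] D i by simp
  qed
  moreover have "opI Y h (map f ys) = Some (f y)"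
    using assms(1) App.prems ys D unfolding preserves_def by auto
  ultimately show ?case
    unfolding term_val.simps bind_those_eq_Some_iff by blast
qed

lemma preserves_holds:
  assumes p: "preserves S X Y f" and "wf_atom (length xs) \<alpha>" "in_lang S \<alpha>" "holds X xs \<alpha>"
  shows "holds Y (map f xs) \<alpha>"
proof (cases \<alpha>)
  case (Eq s t)
  then show ?thesis
    using assms(2-) preserves_term_val[OF p] unfolding in_lang_def by fastforce
next
  case (Rel r ts)
  then obtain ys where ys: "map (term_val X xs) ts = map Some ys" "ys \<in> relI X r"
    using assms by (auto simp: those_eq_Some_iff)
  note D = map_eq_map_SomeD[OF ys(1)]
  have "map (term_val Y (map f xs)) ts = map Some (map f ys)"
  proof (rule eq_map_SomeI)
    show "length (map f ys) = length ts" using D(1) by simp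
    fix i assume i: "i < length ts"
    have "wf_term (length xs) (ts ! i)" "term_ops (ts ! i) \<subseteq> ops S"
      using assms(2,3) Rel nth_mem[OF i] by (auto simp: list_all_iff in_lang_def)
    then show "term_val Y (map f xs) (ts ! i) = Some (map f ys ! i)"
      using preserves_term_val[OF p] D i by simp
  qed
  moreover have "map f ys \<in> relI Y r"
    using p assms(2,3) Rel ys D unfolding preserves_def in_lang_def by auto
  ultimately show ?thesis
    unfolding Rel holds.simps those_eq_Some_iff by blast
qed

text \<open>The premise travels forward along \<open>b\<close>, the conclusion comes back along
  \<open>c\<close>, and since \<open>c\<close> undoes \<open>b\<close> the tuple is the original
  one. Used in both directions for copies on the natural numbers.\<close>

lemma models_if_retract:
  assumes b: "preserves S X Y b" and c: "preserves S Y X c"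
    and bX: "b ` univ X \<subseteq> univ Y" and cb: "\<And>x. x \<in> univ X \<Longrightarrow> c (b x) = x"
    and \<phi>: "uH_sentence S \<phi>" and m: "models Y \<phi>"
  shows "models X \<phi>"
  unfolding models_def
proof
  fix xs assume xs: "xs \<in> pr X \<phi>"
  have len: "length xs = nvars \<phi>" and sub: "set xs \<subseteq> univ X"
    and h: "\<And>\<alpha>. \<alpha> \<in> set (prem \<phi>) \<Longrightarrow> holds X xs \<alpha>"
    using xs by (auto simp: pr_def defined_rel_def tuples_def)
  have wf: "\<And>\<alpha>. \<alpha> \<in> set (prem \<phi>) \<Longrightarrow> wf_atom (length xs) \<alpha> \<and> in_lang S \<alpha>"
    using \<phi> len by (auto simp: uH_sentence_def ca_formula_def)
  have "map b xs \<in> pr Y \<phi>"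
    using preserves_holds[OF b] wf h len sub bX
    by (auto simp: pr_def defined_rel_def tuples_def image_subset_iff subset_iff)
  then have Y: "case concl \<phi> of None \<Rightarrow> False | Some \<gamma> \<Rightarrow> holds Y (map b xs) \<gamma>"
    using m by (auto simp: models_def)
  have id: "map c (map b xs) = xs"
    using sub cb by (auto simp: map_idI subset_iff)
  show "case concl \<phi> of None \<Rightarrow> False | Some \<gamma> \<Rightarrow> holds X xs \<gamma>"
  proof (cases "concl \<phi>")
    case None
    then show ?thesis using Y by simp
  next
    case (Some \<gamma>)
    then have "wf_atom (length (map b xs)) \<gamma>" "in_lang S \<gamma>"
      using \<phi> len by (auto simp: uH_sentence_def)
    then show ?thesis
      using preserves_holds[OF c, of "map b xs" \<gamma>] Y Some id by simp
  qed
qed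

text \<open>Only one direction is demanded: what is true in every coordinate must be true in
  \<open>X\<close>. The converse is obtained separately, from evaluations being morphisms. This half
  alone covers the full powers as well as the structures of clone functions.\<close>

definition full_on ::
  "('a, 'f) algebra \<Rightarrow> 'a alter_ego \<Rightarrow> 'i set \<Rightarrow> ('i \<Rightarrow> 'a, 'a, 'z) struct_scheme \<Rightarrow> bool" where
  "full_on M S I X \<longleftrightarrow> univ X \<subseteq> I \<rightarrow>\<^sub>E carrier M \<and>
     (\<forall>h\<in>ops S. \<forall>xs\<in>tuples (univ X) (op_arity h). (\<forall>i\<in>I. map (\<lambda>x. x i) xs \<in> dom h) \<longrightarrow>
        opI X h xs = Some (\<lambda>i\<in>I. the (h (map (\<lambda>x. x i) xs))) \<and>
        (\<lambda>i\<in>I. the (h (map (\<lambda>x. x i) xs))) \<in> univ X) \<and>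
     (\<forall>r\<in>rels S. \<forall>xs\<in>tuples (univ X) (rel_arity r). (\<forall>i\<in>I. map (\<lambda>x. x i) xs \<in> r) \<longrightarrow>
        xs \<in> relI X r)"

lemma self_struct_simps [simp]:
  "univ (self_struct M) = carrier M" "opI (self_struct M) h = h" "relI (self_struct M) r = r"
  "topo (self_struct M) = discrete_topology (carrier M)"
  by (auto simp: self_struct_def)

text \<open>If a compound term is defined in each coordinate, so are its subterms; induction
  produces their values in \<open>X\<close>, and \<open>full_on\<close> applies to the outermost
  operation.\<close>

lemma full_on_term_val:
  assumes "full_on M S I X" "set xs \<subseteq> univ X" "wf_term (length xs) t" "term_ops t \<subseteq> ops S"
    "\<And>i. i \<in> I \<Longrightarrow> term_val (self_struct M) (map (\<lambda>x. x i) xs) t \<noteq> None"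
  shows "\<exists>y\<in>univ X. term_val X xs t = Some y \<and>
     (\<forall>i\<in>I. term_val (self_struct M) (map (\<lambda>x. x i) xs) t = Some (y i))"
  using assms(3-)
proof (induction t)
  case (Var j)
  then show ?case using assms(2) by (auto dest!: nth_mem)
next
  case (App h ts)
  have "\<exists>y\<in>univ X. term_val X xs t = Some y \<and>
     (\<forall>i\<in>I. term_val (self_struct M) (map (\<lambda>x. x i) xs) t = Some (y i))" if t: "t \<in> set ts" for t
  proof (rule App.IH[OF t])
    show "wf_term (length xs) t" "term_ops t \<subseteq> ops S"
      using App.prems t by (auto simp: list_all_iff)
    fix i assume "i \<in> I"
    then obtain y where "term_val (self_struct M) (map (\<lambda>x. x i) xs) (App h ts) = Some y"
      using App.prems(3) by blast
    then show "term_val (self_struct M) (map (\<lambda>x. x i) xs) t \<noteq> None"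
      using t unfolding term_val.simps bind_those_eq_Some_iff
      by (metis in_set_conv_nth map_eq_map_SomeD(2) option.distinct(1))
  qed
  then obtain Y where Y: "\<And>t. t \<in> set ts \<Longrightarrow> Y t \<in> univ X \<and> term_val X xs t = Some (Y t) \<and>
     (\<forall>i\<in>I. term_val (self_struct M) (map (\<lambda>x. x i) xs) t = Some (Y t i))"
    by metis
  define ys where "ys = map Y ts"
  have ys: "map (term_val X xs) ts = map Some ys"
    "\<And>i. i \<in> I \<Longrightarrow> map (term_val (self_struct M) (map (\<lambda>x. x i) xs)) ts = map Some (map (\<lambda>x. x i) ys)"
    using Y by (auto simp: ys_def)
  have hv: "term_val (self_struct M) (map (\<lambda>x. x i) xs) (App h ts) = h (map (\<lambda>x. x i) ys)"
    if "i \<in> I" for i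
    unfolding term_val.simps ys(2)[OF that] those_eq_Some_iff[THEN iffD2, OF refl] by simp
  have dom: "\<forall>i\<in>I. map (\<lambda>x. x i) ys \<in> dom h"
    using App.prems(3) hv by (metis domIff)
  have ysT: "ys \<in> tuples (univ X) (op_arity h)"
    using App.prems Y by (auto simp: tuples_def ys_def)
  have h: "h \<in> ops S" using App.prems by simp
  have 1: "opI X h ys = Some (\<lambda>i\<in>I. the (h (map (\<lambda>x. x i) ys)))"
    "(\<lambda>i\<in>I. the (h (map (\<lambda>x. x i) ys))) \<in> univ X"
    using assms(1) h ysT dom unfolding full_on_def by blast+
  have "term_val X xs (App h ts) = Some (\<lambda>i\<in>I. the (h (map (\<lambda>x. x i) ys)))"
    unfolding term_val.simps bind_those_eq_Some_iff using ys(1) 1 by blast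
  then show ?case
    using 1(2) hv dom by (intro bexI[of _ "\<lambda>i\<in>I. the (h (map (\<lambda>x. x i) ys))"]) auto
qed

lemma full_on_holds:
  assumes f: "full_on M S I X" and xs: "set xs \<subseteq> univ X"
    and "wf_atom (length xs) \<alpha>" "in_lang S \<alpha>"
    and h: "\<And>i. i \<in> I \<Longrightarrow> holds (self_struct M) (map (\<lambda>x. x i) xs) \<alpha>"
  shows "holds X xs \<alpha>"
proof (cases \<alpha>)
  case (Eq s t)
  note * = full_on_term_val[OF f xs]
  obtain y where y: "y \<in> univ X" "term_val X xs s = Some y"
     "\<forall>i\<in>I. term_val (self_struct M) (map (\<lambda>x. x i) xs) s = Some (y i)"
    using *[of s] assms(3,4) h unfolding Eq by (force simp: in_lang_def)
  obtain z where z: "z \<in> univ X" "term_val X xs t = Some z"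
     "\<forall>i\<in>I. term_val (self_struct M) (map (\<lambda>x. x i) xs) t = Some (z i)"
    using *[of t] assms(3,4) h unfolding Eq by (force simp: in_lang_def)
  have "y i = z i" if "i \<in> I" for i
    using h[OF that] y(3) z(3) that Eq by simp
  moreover have "y \<in> I \<rightarrow>\<^sub>E carrier M" "z \<in> I \<rightarrow>\<^sub>E carrier M"
    using y(1) z(1) f by (auto simp: full_on_def)
  ultimately have "y = z" by (metis PiE_ext)
  then show ?thesis using y z Eq by auto
next
  case (Rel r ts)
  have "\<exists>y\<in>univ X. term_val X xs t = Some y \<and>
     (\<forall>i\<in>I. term_val (self_struct M) (map (\<lambda>x. x i) xs) t = Some (y i))" if t: "t \<in> set ts" for t
  proof (rule full_on_term_val[OF f xs])
    show "wf_term (length xs) t" "term_ops t \<subseteq> ops S"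
      using assms(3,4) t by (auto simp: list_all_iff in_lang_def Rel)
    fix i assume "i \<in> I"
    then obtain ys where "map (term_val (self_struct M) (map (\<lambda>x. x i) xs)) ts = map Some ys"
      using h Rel by (auto simp: those_eq_Some_iff)
    then show "term_val (self_struct M) (map (\<lambda>x. x i) xs) t \<noteq> None"
      using t by (metis in_set_conv_nth map_eq_map_SomeD(2) option.distinct(1))
  qed
  then obtain Y where Y: "\<And>t. t \<in> set ts \<Longrightarrow> Y t \<in> univ X \<and> term_val X xs t = Some (Y t) \<and>
     (\<forall>i\<in>I. term_val (self_struct M) (map (\<lambda>x. x i) xs) t = Some (Y t i))"
    by metis
  define ys where "ys = map Y ts"
  have ys: "map (term_val X xs) ts = map Some ys"
    "\<And>i. i \<in> I \<Longrightarrow> map (term_val (self_struct M) (map (\<lambda>x. x i) xs)) ts = map Some (map (\<lambda>x. x i) ys)"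
    using Y by (auto simp: ys_def)
  have "map (\<lambda>x. x i) ys \<in> r" if i: "i \<in> I" for i
  proof -
    obtain zs where "map (term_val (self_struct M) (map (\<lambda>x. x i) xs)) ts = map Some zs" "zs \<in> r"
      using h[OF i] Rel by (auto simp: those_eq_Some_iff)
    then show ?thesis using ys(2)[OF i] by (metis list.inj_map_strong option.inject)
  qed
  moreover have "ys \<in> tuples (univ X) (rel_arity r)"
    using assms(3) Rel Y by (auto simp: tuples_def ys_def)
  ultimately have "ys \<in> relI X r"
    using f assms(4) Rel by (auto simp: full_on_def in_lang_def)
  then show ?thesis using ys(1) Rel by (auto simp: those_eq_Some_iff)
qed

section \<open>Renaming variables and lengthening assignments\<close>

lemma term_val_subst_Var:
  "wf_term (length js) t \<Longrightarrow>
     term_val X zs (subst_term (\<lambda>i. map Var js ! i) t) = term_val X (map (\<lambda>j. zs ! j) js) t"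
proof (induction t)
  case (App h ts)
  then have "map (term_val X zs \<circ> subst_term (\<lambda>i. map Var js ! i)) ts
    = map (term_val X (map (\<lambda>j. zs ! j) js)) ts"
    by (auto simp: list_all_iff)
  then show ?case by (simp only: subst_term.simps term_val.simps map_map)
qed auto

text \<open>Defining formulas are reused below at selected coordinates of a longer tuple.
  Well-formedness keeps every variable inside the list \<open>js\<close>.\<close>

lemma holds_subst_Var:
  "wf_atom (length js) \<alpha> \<Longrightarrow>
     holds X zs (subst_atom (\<lambda>i. map Var js ! i) \<alpha>) = holds X (map (\<lambda>j. zs ! j) js) \<alpha>"
proof (cases \<alpha>)
  case (Rel r ts)
  assume "wf_atom (length js) \<alpha>"
  then have "map (term_val X zs \<circ> subst_term (\<lambda>i. map Var js ! i)) ts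
    = map (term_val X (map (\<lambda>j. zs ! j) js)) ts"
    using Rel by (auto simp: list_all_iff term_val_subst_Var)
  then show ?thesis using Rel by (simp only: subst_atom.simps holds.simps map_map)
qed (auto simp: term_val_subst_Var)

lemma wf_term_subst_Var:
  "wf_term (length js) t \<Longrightarrow> \<forall>j\<in>set js. j < n \<Longrightarrow> wf_term n (subst_term (\<lambda>i. map Var js ! i) t)"
  by (induction t) (auto simp: list_all_iff)

lemma wf_atom_subst_Var:
  "wf_atom (length js) \<alpha> \<Longrightarrow> \<forall>j\<in>set js. j < n \<Longrightarrow> wf_atom n (subst_atom (\<lambda>i. map Var js ! i) \<alpha>)"
  by (cases \<alpha>) (auto simp: list_all_iff wf_term_subst_Var)

lemma term_ops_subst_Var:
  "wf_term (length js) t \<Longrightarrow> term_ops (subst_term (\<lambda>i. map Var js ! i) t) = term_ops t"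
  by (induction t) (auto simp: list_all_iff)

lemma in_lang_subst_Var:
  "wf_atom (length js) \<alpha> \<Longrightarrow> in_lang S (subst_atom (\<lambda>i. map Var js ! i) \<alpha>) = in_lang S \<alpha>"
  by (cases \<alpha>) (auto simp: in_lang_def list_all_iff term_ops_subst_Var)

lemma term_val_append: "wf_term (length xs) t \<Longrightarrow> term_val X (xs @ ys) t = term_val X xs t"
proof (induction t)
  case (App h ts)
  then have "map (term_val X (xs @ ys)) ts = map (term_val X xs) ts"
    by (auto simp: list_all_iff)
  then show ?case by (simp cong: map_cong)
qed (auto simp: nth_append)

lemma holds_append: "wf_atom (length xs) \<alpha> \<Longrightarrow> holds X (xs @ ys) \<alpha> = holds X xs \<alpha>"
proof (cases \<alpha>)
  case (Rel r ts)
  assume "wf_atom (length xs) \<alpha>"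
  then have "map (term_val X (xs @ ys)) ts = map (term_val X xs) ts"
    using Rel by (auto simp: list_all_iff term_val_append)
  then show ?thesis using Rel by (simp cong: map_cong)
qed (auto simp: term_val_append)

lemma wf_term_mono: "wf_term n t \<Longrightarrow> n \<le> m \<Longrightarrow> wf_term m t"
  by (induction t) (auto simp: list_all_iff)

lemma wf_atom_mono: "wf_atom n \<alpha> \<Longrightarrow> n \<le> m \<Longrightarrow> wf_atom m \<alpha>"
  by (cases \<alpha>) (auto simp: list_all_iff intro: wf_term_mono)

lemma map_term_val_Var: "map (term_val X xs) (map Var is) = map Some (map (\<lambda>i. xs ! i) is)"
  by simp

text \<open>Pure atoms reduce to a single membership or a single application. An equation of a term
  with itself says that the term is defined, which is how domains are expressed by atoms.\<close>

lemma holds_pure_simps: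
  "holds X xs (Rel r (map Var is)) \<longleftrightarrow> map (\<lambda>i. xs ! i) is \<in> relI X r"
  "holds X xs (Eq (App h (map Var is)) (Var j)) \<longleftrightarrow> opI X h (map (\<lambda>i. xs ! i) is) = Some (xs ! j)"
  "holds X xs (Eq (App h (map Var is)) (App h (map Var is))) \<longleftrightarrow>
     map (\<lambda>i. xs ! i) is \<in> dom (opI X h)"
  "holds X xs (Eq (Var i) (Var j)) \<longleftrightarrow> xs ! i = xs ! j"
proof -
  have *: "those (map (term_val X xs) (map Var is)) = Some (map (\<lambda>i. xs ! i) is)"
    by (simp only: map_term_val_Var those_eq_Some_iff)
  show "holds X xs (Rel r (map Var is)) \<longleftrightarrow> map (\<lambda>i. xs ! i) is \<in> relI X r"
    "holds X xs (Eq (App h (map Var is)) (Var j)) \<longleftrightarrow> opI X h (map (\<lambda>i. xs ! i) is) = Some (xs ! j)"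
    "holds X xs (Eq (App h (map Var is)) (App h (map Var is))) \<longleftrightarrow>
     map (\<lambda>i. xs ! i) is \<in> dom (opI X h)"
    "holds X xs (Eq (Var i) (Var j)) \<longleftrightarrow> xs ! i = xs ! j"
    by (auto simp only: holds.simps term_val.simps * Option.bind.simps dom_def mem_Collect_eq)
qed

section \<open>Compatible relations and definable relations\<close>

abbreviation rel_homs :: "('a, 'f) algebra \<Rightarrow> 'a frel \<Rightarrow> ('a list \<Rightarrow> 'a) set" where
  "rel_homs M r \<equiv> alg_hom (rel_alg M r) M"

abbreviation morphs ::
  "('a, 'f) algebra \<Rightarrow> 'a alter_ego \<Rightarrow> ('x, 'a) tstruct \<Rightarrow> ('x \<Rightarrow> 'a) set" where
  "morphs M S X \<equiv> str_hom S X (self_struct M)"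

abbreviation rowwise ::
  "('a, 'f) algebra \<Rightarrow> 'f \<Rightarrow> nat \<Rightarrow> 'a list list \<Rightarrow> 'a list" where
  "rowwise M F n zss \<equiv> map (\<lambda>i. opn M F (map (\<lambda>x. x ! i) zss)) [0..<n]"

lemma tuple_power_simps [simp]:
  "carrier (tuple_power M n) = tuples (carrier M) n" "fsyms (tuple_power M n) = fsyms M"
  "arity (tuple_power M n) = arity M"
  "opn (tuple_power M n) F zss = rowwise M F n zss"
  by (auto simp: tuple_power_def)

lemma rel_alg_simps [simp]:
  "carrier (rel_alg M r) = r" "fsyms (rel_alg M r) = fsyms M" "arity (rel_alg M r) = arity M"
  "opn (rel_alg M r) F zss = rowwise M F (rel_arity r) zss"
  by (auto simp: rel_alg_def)

lemma finite_tuples: "finite X \<Longrightarrow> finite (tuples X n)"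
  unfolding tuples_def by (rule finite_lists_length_eq)

lemma tuples_imp_lists: "xs \<in> tuples X n \<Longrightarrow> xs \<in> lists X"
  by (auto simp: tuples_def)

lemma rel_arity_eqI: "xs \<in> r \<Longrightarrow> r \<subseteq> tuples X n \<Longrightarrow> rel_arity r = n"
  unfolding rel_arity_def tuples_def
  by (metis (mono_tags, lifting) mem_Collect_eq someI subsetD)

lemma compat_relD:
  assumes "compat_rel M r"
  shows "r \<noteq> {}" "r \<subseteq> tuples (carrier M) (rel_arity r)"
    "\<And>F zss. F \<in> fsyms M \<Longrightarrow> zss \<in> tuples r (arity M F) \<Longrightarrow>
       rowwise M F (rel_arity r) zss \<in> r"
proof -
  obtain n where n: "subuniverse (tuple_power M n) r"
    using assms by (auto simp: compat_rel_def)
  then have "rel_arity r = n"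
    by (auto simp: subuniverse_def intro: rel_arity_eqI)
  then show "r \<noteq> {}" "r \<subseteq> tuples (carrier M) (rel_arity r)"
    "\<And>F zss. F \<in> fsyms M \<Longrightarrow> zss \<in> tuples r (arity M F) \<Longrightarrow>
       rowwise M F (rel_arity r) zss \<in> r"
    using n by (auto simp: subuniverse_def)
qed

lemma compat_relI:
  assumes "r \<noteq> {}" "r \<subseteq> tuples (carrier M) n"
    "\<And>F zss. F \<in> fsyms M \<Longrightarrow> zss \<in> tuples r (arity M F) \<Longrightarrow>
       rowwise M F n zss \<in> r"
  shows "compat_rel M r"
  using assms unfolding compat_rel_def subuniverse_def by auto

lemma compat_rel_length: "compat_rel M r \<Longrightarrow> xs \<in> r \<Longrightarrow> length xs = rel_arity r"
  using compat_relD(2) by (fastforce simp: tuples_def)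

lemma compat_rel_nth: "compat_rel M r \<Longrightarrow> xs \<in> r \<Longrightarrow> i < rel_arity r \<Longrightarrow> xs ! i \<in> carrier M"
  using compat_relD(2)[of M r] by (fastforce simp: tuples_def)

lemma rel_hom_iff:
  "f \<in> rel_homs M r \<longleftrightarrow> f \<in> r \<rightarrow>\<^sub>E carrier M \<and>
    (\<forall>F\<in>fsyms M. \<forall>zss\<in>tuples r (arity M F).
       f (rowwise M F (rel_arity r) zss) = opn M F (map f zss))"
  by (auto simp: alg_hom_def)

text \<open>Dropping the last coordinate is an isomorphism from the graph onto the domain, and the
  last coordinate becomes a homomorphism into \<open>M\<close>. This form connects compatible
  operations with the homomorphisms enumerated in \<open>rel_hat\<close>.\<close>

lemma compat_op_iff:
  "compat_op M h \<longleftrightarrow>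
     compat_rel M (dom h) \<and> (\<lambda>xs\<in>dom h. the (h xs)) \<in> rel_homs M (dom h)"
proof
  assume "compat_op M h"
  then have c: "compat_rel M (op_graph h)" by (simp add: compat_op_def)
  note D = compat_relD[OF c]
  \<comment> \<open>The subtraction is not truncated: the graph is nonempty and each of its members
    ends in a value.\<close>
  define n where "n = rel_arity (op_graph h) - 1"
  have gr: "xs @ [y] \<in> op_graph h \<longleftrightarrow> h xs = Some y" for xs y
    by (auto simp: op_graph_def)
  obtain xs0 y0 where "xs0 @ [y0] \<in> op_graph h"
    using D(1) by (auto simp: op_graph_def)
  then have Suc: "rel_arity (op_graph h) = Suc n"
    using D(2) unfolding n_def by (fastforce simp: tuples_def)
  have dom: "dom h \<subseteq> tuples (carrier M) n" and ran: "ran h \<subseteq> carrier M"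
    using D(2) unfolding Suc by (fastforce simp: tuples_def op_graph_def ran_def)+
  have ar: "rel_arity (dom h) = n"
    using dom gr \<open>xs0 @ [y0] \<in> op_graph h\<close> by (auto intro: rel_arity_eqI)
  have step: "h (rowwise M F n zss) = Some (opn M F (map (\<lambda>xs. the (h xs)) zss))"
    if F: "F \<in> fsyms M" and z: "zss \<in> tuples (dom h) (arity M F)" for F zss
  proof -
    \<comment> \<open>The tuples are lifted to the graph; closure of the graph then gives the value
      of \<open>h\<close> as the last coordinate.\<close>
    define gss where "gss = map (\<lambda>z. z @ [the (h z)]) zss"
    have "gss \<in> tuples (op_graph h) (arity M F)"
      using z by (auto simp: gss_def tuples_def gr subset_iff)
    then have "rowwise M F (Suc n) gss \<in> op_graph h"
      using D(3)[OF F] Suc by simp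
    also have "rowwise M F (Suc n) gss =
      rowwise M F n zss @ [opn M F (map (\<lambda>xs. the (h xs)) zss)]"
    proof -
      have l: "length z = n" if "z \<in> set zss" for z
        using that z dom by (auto simp: tuples_def subset_iff)
      have "map (\<lambda>x. x ! i) gss = map (\<lambda>x. x ! i) zss" if "i < n" for i
        using l that by (auto simp: gss_def nth_append)
      moreover have "map (\<lambda>x. x ! n) gss = map (\<lambda>xs. the (h xs)) zss"
        using l by (auto simp: gss_def nth_append)
      ultimately show ?thesis by auto
    qed
    finally show ?thesis by (simp add: gr)
  qed
  have "compat_rel M (dom h)"
    using dom step gr \<open>xs0 @ [y0] \<in> op_graph h\<close> by (intro compat_relI[where n=n]) (auto)
  moreover have "(\<lambda>xs\<in>dom h. the (h xs)) \<in> rel_homs M (dom h)"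
    unfolding rel_hom_iff ar
  proof (intro conjI ballI)
    show "(\<lambda>xs\<in>dom h. the (h xs)) \<in> dom h \<rightarrow>\<^sub>E carrier M"
      using ran by (auto simp: ran_def)
    fix F zss assume F: "F \<in> fsyms M" "zss \<in> tuples (dom h) (arity M F)"
    have "map (\<lambda>xs. the (h xs)) zss = map (\<lambda>xs\<in>dom h. the (h xs)) zss"
      using F(2) by (auto simp: tuples_def)
    then show "(\<lambda>xs\<in>dom h. the (h xs)) (rowwise M F n zss) =
       opn M F (map (\<lambda>xs\<in>dom h. the (h xs)) zss)"
      using step[OF F] by (auto simp: restrict_def dom_def simp del: map_eq_conv)
  qed
  ultimately show "compat_rel M (dom h) \<and> (\<lambda>xs\<in>dom h. the (h xs)) \<in> rel_homs M (dom h)"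
    by blast
next
  assume *: "compat_rel M (dom h) \<and> (\<lambda>xs\<in>dom h. the (h xs)) \<in> rel_homs M (dom h)"
  then have c: "compat_rel M (dom h)" by blast
  note D = compat_relD[OF c]
  define n where "n = rel_arity (dom h)"
  have f: "(\<lambda>xs\<in>dom h. the (h xs)) \<in> dom h \<rightarrow>\<^sub>E carrier M"
    and hom: "\<And>F zss. F \<in> fsyms M \<Longrightarrow> zss \<in> tuples (dom h) (arity M F) \<Longrightarrow>
      (\<lambda>xs\<in>dom h. the (h xs)) (rowwise M F n zss)
      = opn M F (map (\<lambda>xs\<in>dom h. the (h xs)) zss)"
    using * by (simp_all only: rel_hom_iff n_def)
  have gr: "xs @ [y] \<in> op_graph h \<longleftrightarrow> h xs = Some y" for xs y
    by (auto simp: op_graph_def)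
  have "compat_rel M (op_graph h)"
  proof (rule compat_relI)
    show "op_graph h \<noteq> {}" using D(1) gr by fastforce
    show "op_graph h \<subseteq> tuples (carrier M) (Suc n)"
    proof
      fix g assume "g \<in> op_graph h"
      then obtain xs y where g: "g = xs @ [y]" "h xs = Some y" by (auto simp: op_graph_def)
      then have "xs \<in> tuples (carrier M) n" using D(2) n_def by auto
      moreover have "y \<in> carrier M" using f g(2) by (force simp: Pi_iff PiE_iff dom_def)
      ultimately show "g \<in> tuples (carrier M) (Suc n)" using g by (auto simp: tuples_def)
    qed
    fix F gss assume F: "F \<in> fsyms M" and "gss \<in> tuples (op_graph h) (arity M F)"
    then have gss: "\<forall>g\<in>set gss. \<exists>xs y. g = xs @ [y] \<and> h xs = Some y" "length gss = arity M F"
      by (auto simp: tuples_def op_graph_def)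
    define zss where "zss = map butlast gss"
    have z: "zss \<in> tuples (dom h) (arity M F)"
      using gss by (fastforce simp: tuples_def zss_def)
    have l: "length g = Suc n" if "g \<in> set gss" for g
      using gss(1) that D(2) n_def by (fastforce simp: tuples_def)
    have 1: "map (\<lambda>x. x ! i) gss = map (\<lambda>x. x ! i) zss" if "i < n" for i
    proof -
      have "butlast g ! i = g ! i" if "g \<in> set gss" for g
        using l[OF that] \<open>i < n\<close> by (intro nth_butlast) simp
      then show ?thesis unfolding zss_def map_map by (intro map_cong) simp_all
    qed
    have 2: "map (\<lambda>x. x ! n) gss = map (\<lambda>xs\<in>dom h. the (h xs)) zss"
    proof -
      have "g ! n = (\<lambda>xs\<in>dom h. the (h xs)) (butlast g)" if g': "g \<in> set gss" for g
      proof -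
        obtain xs y where g: "g = xs @ [y]" "h xs = Some y"
          using bspec[OF gss(1) g'] by blast
        then have "length xs = n" using l[OF g'] g(1) by simp
        then show ?thesis using g by (simp add: domI nth_append)
      qed
      then show ?thesis unfolding zss_def map_map by (intro map_cong) simp_all
    qed
    have "rowwise M F n zss \<in> dom h"
      using D(3)[OF F z] n_def by simp
    then have "h (rowwise M F n zss)
       = Some (opn M F (map (\<lambda>xs\<in>dom h. the (h xs)) zss))"
      using hom[OF F z] by (auto simp del: map_eq_conv)
    then have "rowwise M F n zss
       @ [opn M F (map (\<lambda>xs\<in>dom h. the (h xs)) zss)] \<in> op_graph h"
      by (simp add: gr)
    also have "rowwise M F n zss
       @ [opn M F (map (\<lambda>xs\<in>dom h. the (h xs)) zss)]
      = rowwise M F (Suc n) gss"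
      using 1 2 by simp
    finally show "rowwise M F (Suc n) gss \<in> op_graph h" .
  qed
  then show "compat_op M h" by (simp add: compat_op_def)
qed

lemma compat_op_ran: "compat_op M h \<Longrightarrow> h xs = Some y \<Longrightarrow> y \<in> carrier M"
  unfolding compat_op_iff rel_hom_iff by (force simp: PiE_iff dom_def)

lemma compat_op_opn:
  assumes "compat_op M h" "F \<in> fsyms M" "zss \<in> tuples (dom h) (arity M F)"
  shows "h (rowwise M F (op_arity h) zss)
    = Some (opn M F (map (\<lambda>zs. the (h zs)) zss))"
proof -
  have c: "compat_rel M (dom h)" and hom: "(\<lambda>xs\<in>dom h. the (h xs)) \<in> rel_homs M (dom h)"
    using assms(1) by (auto simp: compat_op_iff)
  have d: "rowwise M F (op_arity h) zss \<in> dom h"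
    by (rule compat_relD(3)[OF c assms(2,3)])
  have "(\<lambda>xs\<in>dom h. the (h xs)) (rowwise M F (op_arity h) zss)
     = opn M F (map (\<lambda>xs\<in>dom h. the (h xs)) zss)"
    using hom assms(2,3) unfolding rel_hom_iff by blast
  moreover have "map (\<lambda>xs\<in>dom h. the (h xs)) zss = map (\<lambda>zs. the (h zs)) zss"
    using assms(3) by (auto simp: tuples_def)
  ultimately show ?thesis using d by (auto simp: restrict_def simp del: map_eq_conv)
qed

definition op_of :: "'a frel \<Rightarrow> ('a list \<Rightarrow> 'a) \<Rightarrow> 'a pop" where
  "op_of r f = (\<lambda>xs. if xs \<in> r then Some (f xs) else None)"

lemma dom_op_of [simp]: "dom (op_of r f) = r"
  by (auto simp: op_of_def split: if_splits)

lemma compat_op_op_of: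
  assumes "compat_rel M r" "f \<in> rel_homs M r"
  shows "compat_op M (op_of r f)"
proof -
  have "(\<lambda>xs\<in>r. the (op_of r f xs)) = f"
    using assms(2) by (auto simp: rel_hom_iff op_of_def PiE_iff restrict_def extensional_def)
  then show ?thesis using assms by (simp add: compat_op_iff)
qed

lemma rel_hom_in_carrier: "f \<in> rel_homs M r \<Longrightarrow> xs \<in> r \<Longrightarrow> f xs \<in> carrier M"
  by (auto simp: rel_hom_iff)

text \<open>Selecting coordinates is a homomorphism from \<open>r\<close> to \<open>s\<close>, and
  composition with it carries homomorphisms on \<open>s\<close> to homomorphisms on
  \<open>r\<close>. This is how a relation of \<open>M1\<close> in a conclusion gives rise to
  operations whose domain was added.\<close>

lemma rel_hom_pullback:
  assumes r: "compat_rel M r" and f: "f \<in> rel_homs M s"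
    and len: "length is = rel_arity s" and lt: "\<forall>i\<in>set is. i < rel_arity r"
    and sub: "\<And>zs. zs \<in> r \<Longrightarrow> map (\<lambda>i. zs ! i) is \<in> s"
  shows "(\<lambda>zs\<in>r. f (map (\<lambda>i. zs ! i) is)) \<in> rel_homs M r"
  unfolding rel_hom_iff
proof (intro conjI ballI)
  show "(\<lambda>zs\<in>r. f (map (\<lambda>i. zs ! i) is)) \<in> r \<rightarrow>\<^sub>E carrier M"
    using f sub by (auto simp: rel_hom_iff)
  fix F zss assume F: "F \<in> fsyms M" and z: "zss \<in> tuples r (arity M F)"
  define T where "T = rowwise M F (rel_arity r) zss"
  have T: "T \<in> r" unfolding T_def by (rule compat_relD(3)[OF r F z])
  define wss where "wss = map (\<lambda>zs. map (\<lambda>i. zs ! i) is) zss"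
  have w: "wss \<in> tuples s (arity M F)"
    using z sub by (auto simp: wss_def tuples_def)
  have "map (\<lambda>i. T ! i) is = map (\<lambda>j. opn M F (map (\<lambda>x. x ! j) wss)) [0..<rel_arity s]"
    using len lt by (intro nth_equalityI) (auto simp: T_def wss_def comp_def)
  then have "f (map (\<lambda>i. T ! i) is) = opn M F (map f wss)"
    using f F w by (simp add: rel_hom_iff)
  moreover have "map f wss = map (\<lambda>zs\<in>r. f (map (\<lambda>i. zs ! i) is)) zss"
    using z by (auto simp: wss_def tuples_def)
  ultimately show "(\<lambda>zs\<in>r. f (map (\<lambda>i. zs ! i) is)) T
      = opn M F (map (\<lambda>zs\<in>r. f (map (\<lambda>i. zs ! i) is)) zss)"
    using T by simp
qed

section \<open>Powers and finite conjunctions\<close>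

lemma power_struct_simps [simp]:
  "univ (power_struct M I) = I \<rightarrow>\<^sub>E carrier M"
  "opI (power_struct M I) = (\<lambda>h xs. if xs \<in> lists (I \<rightarrow>\<^sub>E carrier M) \<and> (\<forall>i\<in>I. map (\<lambda>x. x i) xs \<in> dom h)
                    then Some (\<lambda>i\<in>I. the (h (map (\<lambda>x. x i) xs))) else None)"
  "relI (power_struct M I) = (\<lambda>r. {xs \<in> lists (I \<rightarrow>\<^sub>E carrier M). \<forall>i\<in>I. map (\<lambda>x. x i) xs \<in> r})"
  "topo (power_struct M I) = product_topology (\<lambda>_. discrete_topology (carrier M)) I"
  by (simp_all add: power_struct_def)

lemma full_on_power_struct:
  assumes "is_alter_ego M S"
  shows "full_on M S I (power_struct M I)"
proof -
  have "(\<lambda>i\<in>I. the (h (map (\<lambda>x. x i) xs))) \<in> I \<rightarrow>\<^sub>E carrier M"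
    if "h \<in> ops S" "\<forall>i\<in>I. map (\<lambda>x. x i) xs \<in> dom h" for h xs
    using that assms compat_op_ran[of M h] unfolding is_alter_ego_def by fastforce
  then show ?thesis
    unfolding full_on_def power_struct_simps
    by (simp add: tuples_imp_lists del: restrict_PiE_iff in_lists_conv_set)
qed

text \<open>Compatibility read the other way round: a basic operation of arity \<open>k\<close> is a
  morphism from the \<open>k\<close>-th power of the structure. If \<open>k = 0\<close> the exponent
  is empty, and only the length guards of \<open>preserves\<close> exclude lists of the wrong
  length.\<close>

lemma preserves_opn:
  assumes S: "is_alter_ego M S" and F: "F \<in> fsyms M"
  shows "preserves S (power_struct M {..<arity M F}) (self_struct M)
           (\<lambda>x. opn M F (map x [0..<arity M F]))"
  unfolding preserves_def
proof (intro conjI ballI allI impI)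
  let ?k = "arity M F"
  fix r xs assume r: "r \<in> rels S" and xs: "xs \<in> relI (power_struct M {..<?k}) r"
    and len: "length xs = rel_arity r"
  define zss where "zss = map (\<lambda>i. map (\<lambda>x. x i) xs) [0..<?k]"
  have "zss \<in> tuples r ?k" using xs by (auto simp: zss_def tuples_def)
  moreover have "compat_rel M r" using S r by (auto simp: is_alter_ego_def)
  ultimately have "map (\<lambda>j. opn M F (map (\<lambda>x. x ! j) zss)) [0..<rel_arity r] \<in> r"
    using compat_relD(3)[OF _ F] by simp
  also have "map (\<lambda>j. opn M F (map (\<lambda>x. x ! j) zss)) [0..<rel_arity r]
     = map (\<lambda>x. opn M F (map x [0..<?k])) xs"
    using len by (intro nth_equalityI) (auto simp: zss_def comp_def)
  finally show "map (\<lambda>x. opn M F (map x [0..<?k])) xs \<in> relI (self_struct M) r" by simp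
next
  let ?k = "arity M F"
  fix h xs y assume h: "h \<in> ops S" and len: "length xs = op_arity h"
    and y: "opI (power_struct M {..<?k}) h xs = Some y"
  define zss where "zss = map (\<lambda>i. map (\<lambda>x. x i) xs) [0..<?k]"
  have d: "\<forall>i<?k. map (\<lambda>x. x i) xs \<in> dom h"
    and y: "y = (\<lambda>i\<in>{..<?k}. the (h (map (\<lambda>x. x i) xs)))"
    using y by (auto split: if_splits)
  then have "zss \<in> tuples (dom h) ?k" by (auto simp: zss_def tuples_def)
  moreover have "compat_op M h" using S h by (auto simp: is_alter_ego_def)
  ultimately have "h (map (\<lambda>j. opn M F (map (\<lambda>x. x ! j) zss)) [0..<op_arity h])
     = Some (opn M F (map (\<lambda>zs. the (h zs)) zss))"
    using compat_op_opn[OF _ F] by simp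
  moreover have "map (\<lambda>j. opn M F (map (\<lambda>x. x ! j) zss)) [0..<op_arity h]
     = map (\<lambda>x. opn M F (map x [0..<?k])) xs"
    using len by (intro nth_equalityI) (auto simp: zss_def comp_def)
  moreover have "map (\<lambda>zs. the (h zs)) zss = map y [0..<?k]"
    by (auto simp: y zss_def)
  ultimately show "opI (self_struct M) h (map (\<lambda>x. opn M F (map x [0..<?k])) xs)
     = Some (opn M F (map y [0..<?k]))"
    by simp
qed

text \<open>Each of the finitely many excluded elements \<open>a\<close> needs just one reason
  \<open>c a\<close> for its exclusion. This replaces infinite conjunctions, such as all atomic
  formulas true throughout a relation, by finite ones.\<close>

lemma finite_subset_same_filter:
  assumes "finite A"
  shows "\<exists>\<Delta>'\<subseteq>\<Delta>. finite \<Delta>' \<and> {a \<in> A. \<forall>d\<in>\<Delta>'. P a d} = {a \<in> A. \<forall>d\<in>\<Delta>. P a d}"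
proof -
  define c where "c a = (SOME d. d \<in> \<Delta> \<and> \<not> P a d)" for a
  have c: "c a \<in> \<Delta> \<and> \<not> P a (c a)" if "\<exists>d\<in>\<Delta>. \<not> P a d" for a
    unfolding c_def by (rule someI_ex[of "\<lambda>d. d \<in> \<Delta> \<and> \<not> P a d"]) (use that in blast)
  let ?D = "c ` {a \<in> A. \<exists>d\<in>\<Delta>. \<not> P a d}"
  have "?D \<subseteq> \<Delta>" "finite ?D" using c assms by auto
  moreover have "{a \<in> A. \<forall>d\<in>?D. P a d} = {a \<in> A. \<forall>d\<in>\<Delta>. P a d}" using c by auto
  ultimately show ?thesis by blast
qed

text \<open>The semantic form of a conjunct-atomic formula without operation symbols:
  \<open>\<Delta>\<close> lists relations together with the coordinates to which they apply, may be
  infinite, and expresses equality by \<open>diag\<close>.\<close>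

definition conj_rel :: "('a, 'f) algebra \<Rightarrow> nat \<Rightarrow> ('a frel \<times> nat list) set \<Rightarrow> 'a frel" where
  "conj_rel M n \<Delta> = {zs \<in> tuples (carrier M) n. \<forall>(s, is)\<in>\<Delta>. map (\<lambda>i. zs ! i) is \<in> s}"

definition diag :: "('a, 'f) algebra \<Rightarrow> 'a frel" where
  "diag M = {[x, x] |x. x \<in> carrier M}"

locale fin_alg =
  fixes M :: "('a, 'f) algebra"
  assumes alg: "is_algebra M" and fin: "finite (carrier M)"
begin

lemma carrier_ne: "carrier M \<noteq> {}"
  using alg by (simp add: is_algebra_def)

lemma opn_carrier: "F \<in> fsyms M \<Longrightarrow> xs \<in> tuples (carrier M) (arity M F) \<Longrightarrow> opn M F xs \<in> carrier M"
  using alg by (simp add: is_algebra_def)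

lemma defined_rel_arity:
  assumes "zs \<in> defined_rel (self_struct M) n \<alpha>s"
  shows "rel_arity (defined_rel (self_struct M) n \<alpha>s) = n"
  using assms by (auto intro!: rel_arity_eqI[where X="carrier M"] simp: defined_rel_def)

lemma Rel_caE:
  assumes "r \<in> Rel_ca M S"
  obtains \<alpha>s where "ca_formula S (rel_arity r) \<alpha>s"
    "r = defined_rel (self_struct M) (rel_arity r) \<alpha>s" "r \<noteq> {}"
proof -
  obtain n \<alpha>s where *: "ca_formula S n \<alpha>s" "r = defined_rel (self_struct M) n \<alpha>s" "r \<noteq> {}"
    using assms by (auto simp: Rel_ca_def)
  then have "rel_arity r = n" using defined_rel_arity by blast
  then show ?thesis using * that by blast
qed

text \<open>Write the arguments of \<open>F\<close> as the rows of a matrix. Its columns, as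
  elements of a power of \<open>M\<close>, satisfy the defining formula because every row does, and
  applying \<open>F\<close> to the columns is a morphism, which preserves the formula.\<close>

lemma Rel_ca_compat:
  assumes S: "is_alter_ego M S" and "r \<in> Rel_ca M S"
  shows "compat_rel M r"
proof -
  obtain n \<alpha>s where ca: "ca_formula S n \<alpha>s" and r: "r = defined_rel (self_struct M) n \<alpha>s" and ne: "r \<noteq> {}"
    using assms(2) by (auto simp: Rel_ca_def)
  show ?thesis
  proof (rule compat_relI[OF ne])
    show rt: "r \<subseteq> tuples (carrier M) n" by (auto simp: r defined_rel_def)
    fix F zss assume F: "F \<in> fsyms M" and z: "zss \<in> tuples r (arity M F)"
    define xs where "xs = map (\<lambda>j. \<lambda>i\<in>{..<arity M F}. zss ! i ! j) [0..<n]"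
    have zr: "zss ! i \<in> r" if "i < arity M F" for i
      using z that by (auto simp: tuples_def)
    have rows: "map (\<lambda>x. x i) xs = zss ! i" if "i < arity M F" for i
      using zr[OF that] that rt by (intro nth_equalityI) (auto simp: xs_def tuples_def)
    have nthc: "zss ! i ! j \<in> carrier M" if "i < arity M F" "j < n" for i j
      using zr[OF that(1)] that(2) rt by (fastforce simp: tuples_def)
    have xs: "set xs \<subseteq> univ (power_struct M {..<arity M F})" "length xs = n"
    proof -
      have "(\<lambda>i\<in>{..<arity M F}. zss ! i ! j) \<in> {..<arity M F} \<rightarrow>\<^sub>E carrier M" if "j < n" for j
        using nthc that by (intro restrict_PiE_iff[THEN iffD2]) auto
      then have "(\<lambda>i\<in>{..<arity M F}. zss ! i ! j) \<in> {..<arity M F} \<rightarrow>\<^sub>E carrier M"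
        if "j \<in> set [0..<n]" for j
        using that by (simp only: set_upt atLeastLessThan_iff)
      then show "set xs \<subseteq> univ (power_struct M {..<arity M F})"
        unfolding xs_def set_map power_struct_simps by blast
      show "length xs = n" by (simp add: xs_def)
    qed
    define T where "T = map (\<lambda>x. opn M F (map x [0..<arity M F])) xs"
    have "holds (self_struct M) T \<alpha>" if "\<alpha> \<in> set \<alpha>s" for \<alpha>
    proof -
      have wf: "wf_atom (length xs) \<alpha>" "in_lang S \<alpha>"
        using ca that xs by (auto simp: ca_formula_def)
      have "holds (power_struct M {..<arity M F}) xs \<alpha>"
        using wf zr rows that
        by (intro full_on_holds[OF full_on_power_struct[OF S] xs(1)]) (auto simp: r defined_rel_def)
      then show ?thesis
        unfolding T_def using preserves_holds[OF preserves_opn[OF S F]] wf by blast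
    qed
    moreover have "T = rowwise M F n zss"
    proof -
      have "map (\<lambda>i. zss ! i ! j) [0..<arity M F] = map (\<lambda>x. x ! j) zss" for j
        using z by (intro nth_equalityI) (auto simp: tuples_def)
      moreover have "map (\<lambda>i\<in>{..<arity M F}. zss ! i ! j) [0..<arity M F]
          = map (\<lambda>i. zss ! i ! j) [0..<arity M F]" for j
        by auto
      ultimately show ?thesis by (simp add: T_def xs_def comp_def del: map_eq_conv)
    qed
    moreover have "T \<in> tuples (carrier M) n"
    proof -
      have "map x [0..<arity M F] \<in> tuples (carrier M) (arity M F)" if "x \<in> set xs" for x
      proof -
        have "x \<in> {..<arity M F} \<rightarrow>\<^sub>E carrier M"
          using xs(1) that unfolding power_struct_simps by blast
        then have "x i \<in> carrier M" if "i < arity M F" for i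
          using that PiE_mem by fastforce
        then show ?thesis by (simp add: tuples_def image_subset_iff)
      qed
      then show ?thesis unfolding T_def using xs(2) opn_carrier[OF F] by (simp add: tuples_def image_subset_iff)
    qed
    ultimately show "rowwise M F n zss \<in> r"
      by (auto simp: r defined_rel_def)
  qed
qed

text \<open>There are only finitely many tuples, so finitely many members of \<open>\<Delta>\<close>
  already cut out the relation; substituting the selected variables into formulas for the relations
  \<open>s\<close> gives a defining formula.\<close>

lemma conj_rel_Rel_ca:
  assumes ne: "conj_rel M n \<Delta> \<noteq> {}"
    and \<Delta>: "\<And>s is. (s, is) \<in> \<Delta> \<Longrightarrow> s \<in> Rel_ca M S \<and> length is = rel_arity s \<and> (\<forall>i\<in>set is. i < n)"
  shows "conj_rel M n \<Delta> \<in> Rel_ca M S"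
proof -
  obtain \<Delta>' where \<Delta>': "\<Delta>' \<subseteq> \<Delta>" "finite \<Delta>'" "conj_rel M n \<Delta>' = conj_rel M n \<Delta>"
    using finite_subset_same_filter[OF finite_tuples[OF fin, of n], of \<Delta>
        "\<lambda>zs (s, is). map (\<lambda>i. zs ! i) is \<in> s"]
    unfolding conj_rel_def by metis
  have "\<forall>s\<in>Rel_ca M S. \<exists>\<alpha>s. ca_formula S (rel_arity s) \<alpha>s \<and> s = defined_rel (self_struct M) (rel_arity s) \<alpha>s"
    by (metis Rel_caE)
  then obtain a where a: "\<And>s. s \<in> Rel_ca M S \<Longrightarrow> ca_formula S (rel_arity s) (a s)
     \<and> s = defined_rel (self_struct M) (rel_arity s) (a s)"
    by metis
  obtain ds where ds: "set ds = \<Delta>'" using finite_list[OF \<Delta>'(2)] by blast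
  define \<alpha>s where "\<alpha>s = concat (map (\<lambda>(s, is). map (subst_atom (\<lambda>i. map Var is ! i)) (a s)) ds)"
  have "ca_formula S n \<alpha>s"
    unfolding ca_formula_def
  proof
    fix \<alpha> assume "\<alpha> \<in> set \<alpha>s"
    then obtain s "is" \<gamma> where s: "(s, is) \<in> \<Delta>'" "\<gamma> \<in> set (a s)"
      and \<alpha>: "\<alpha> = subst_atom (\<lambda>i. map Var is ! i) \<gamma>"
      using ds by (auto simp: \<alpha>s_def)
    then have "wf_atom (length is) \<gamma>" "in_lang S \<gamma>"
      using a[of s] \<Delta>[of s "is"] \<Delta>'(1) unfolding ca_formula_def by auto
    then show "wf_atom n \<alpha> \<and> in_lang S \<alpha>"
      using \<Delta>[of s "is"] \<Delta>'(1) s by (auto simp: \<alpha> wf_atom_subst_Var in_lang_subst_Var)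
  qed
  moreover have "conj_rel M n \<Delta>' = defined_rel (self_struct M) n \<alpha>s"
  proof -
    have key: "map (\<lambda>i. zs ! i) is \<in> s \<longleftrightarrow>
        (\<forall>\<gamma>\<in>set (a s). holds (self_struct M) zs (subst_atom (\<lambda>i. map Var is ! i) \<gamma>))"
      if s: "(s, is) \<in> \<Delta>'" and zs: "zs \<in> tuples (carrier M) n" for s "is" zs
    proof -
      have *: "length is = rel_arity s" "\<forall>i\<in>set is. i < n" "s \<in> Rel_ca M S"
        using \<Delta>[of s "is"] s \<Delta>'(1) by auto
      have "map (\<lambda>i. zs ! i) is \<in> tuples (carrier M) (rel_arity s)"
        using * zs by (auto simp: tuples_def)
      then have "map (\<lambda>i. zs ! i) is \<in> s \<longleftrightarrow>
         (\<forall>\<gamma>\<in>set (a s). holds (self_struct M) (map (\<lambda>i. zs ! i) is) \<gamma>)"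
        by (subst conjunct2[OF a[OF *(3)]]) (auto simp: defined_rel_def)
      moreover have "wf_atom (length is) \<gamma>" if "\<gamma> \<in> set (a s)" for \<gamma>
        using a[OF *(3)] that * by (auto simp: ca_formula_def)
      ultimately show ?thesis by (simp add: holds_subst_Var)
    qed
    show ?thesis
    proof (intro set_eqI iffI)
      fix zs assume *: "zs \<in> conj_rel M n \<Delta>'"
      then have zs: "zs \<in> tuples (carrier M) n" by (simp add: conj_rel_def)
      have "holds (self_struct M) zs (subst_atom (\<lambda>i. map Var is ! i) \<gamma>)"
        if "(s, is) \<in> \<Delta>'" "\<gamma> \<in> set (a s)" for s "is" \<gamma>
        using key[OF that(1) zs] that * by (auto simp: conj_rel_def)
      then show "zs \<in> defined_rel (self_struct M) n \<alpha>s"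
        using ds zs by (auto simp: \<alpha>s_def defined_rel_def)
    next
      fix zs assume *: "zs \<in> defined_rel (self_struct M) n \<alpha>s"
      then have zs: "zs \<in> tuples (carrier M) n" by (simp add: defined_rel_def)
      have "holds (self_struct M) zs (subst_atom (\<lambda>i. map Var is ! i) \<gamma>)"
        if "(s, is) \<in> \<Delta>'" "\<gamma> \<in> set (a s)" for s "is" \<gamma>
      proof -
        have "subst_atom (\<lambda>i. map Var is ! i) \<gamma> \<in> set \<alpha>s"
          using that ds by (force simp: \<alpha>s_def)
        then show ?thesis using * by (simp add: defined_rel_def)
      qed
      then show "zs \<in> conj_rel M n \<Delta>'"
        using key zs by (auto simp: conj_rel_def)
    qed
  qed
  ultimately show ?thesis
    using ne \<Delta>'(3) unfolding Rel_ca_def by blast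
qed

lemma rels_subset_Rel_ca:
  assumes "r \<in> rels S" "compat_rel M r"
  shows "r \<in> Rel_ca M S"
proof -
  note D = compat_relD[OF assms(2)]
  let ?n = "rel_arity r"
  have "map (\<lambda>i. zs ! i) [0..<?n] = zs" if "zs \<in> tuples (carrier M) ?n" for zs
    using that map_nth[of zs] by (simp add: tuples_def)
  then have "r = defined_rel (self_struct M) ?n [Rel r (map Var [0..<?n])]"
    using D(2) unfolding defined_rel_def list.set ball_simps holds_pure_simps
    by (auto simp: self_struct_simps)
  moreover have "ca_formula S ?n [Rel r (map Var [0..<?n])]"
    using assms(1) by (auto simp: ca_formula_def list_all_iff in_lang_def)
  ultimately show ?thesis using D(1) unfolding Rel_ca_def by blast
qed

lemma rel_arity_diag: "rel_arity (diag M) = 2"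
proof -
  obtain x where "x \<in> carrier M" using carrier_ne by blast
  then show ?thesis
    by (intro rel_arity_eqI[of "[x, x]" _ "carrier M"]) (auto simp: diag_def tuples_def)
qed

lemma diag_Rel_ca: "diag M \<in> Rel_ca M S"
proof -
  have "diag M = defined_rel (self_struct M) 2 [Eq (Var 0) (Var 1)]"
    by (auto simp: diag_def defined_rel_def tuples_def length_Suc_conv numeral_2_eq_2)
  moreover have "ca_formula S 2 [Eq (Var 0) (Var 1)]"
    by (auto simp: ca_formula_def in_lang_def)
  moreover have "diag M \<noteq> {}" using carrier_ne by (auto simp: diag_def)
  ultimately show ?thesis unfolding Rel_ca_def by blast
qed

text \<open>Without operation symbols every term is a variable, so each atom applies a relation or
  \<open>diag\<close> to selected coordinates.\<close>

lemma R_alphaE: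
  assumes "r \<in> R_alpha M"
  obtains \<Delta> where "r = conj_rel M (rel_arity r) \<Delta>"
    "\<And>s is. (s, is) \<in> \<Delta> \<Longrightarrow> (hom_minimal M s \<or> s = diag M) \<and> length is = rel_arity s
        \<and> (\<forall>i\<in>set is. i < rel_arity r)"
proof -
  let ?S = "\<lparr>ops = {}, rels = {r. hom_minimal M r}\<rparr>"
  obtain \<alpha>s where ca: "ca_formula ?S (rel_arity r) \<alpha>s"
    and r: "r = defined_rel (self_struct M) (rel_arity r) \<alpha>s"
    using Rel_caE assms unfolding R_alpha_def by blast
  define v where "v = (\<lambda>t :: 'a pop trm. case t of Var i \<Rightarrow> i | App _ _ \<Rightarrow> 0)"
  define c where "c = (\<lambda>\<alpha> :: 'a atm. case \<alpha> of Eq s t \<Rightarrow> (diag M, [v s, v t]) | Rel r ts \<Rightarrow> (r, map v ts))"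
  have t: "t = Var (v t)" if "term_ops t \<subseteq> ops ?S" for t
    using that by (cases t) (auto simp: v_def)
  have *: "holds (self_struct M) zs \<alpha> \<longleftrightarrow> (case c \<alpha> of (s, is) \<Rightarrow> map (\<lambda>i. zs ! i) is \<in> s)"
    "case c \<alpha> of (s, is) \<Rightarrow> (hom_minimal M s \<or> s = diag M) \<and> length is = rel_arity s
        \<and> (\<forall>i\<in>set is. i < rel_arity r)"
    if \<alpha>: "\<alpha> \<in> set \<alpha>s" and zs: "zs \<in> tuples (carrier M) (rel_arity r)" for \<alpha> zs
  proof -
    have wf: "wf_atom (rel_arity r) \<alpha>" "in_lang ?S \<alpha>" using ca \<alpha> by (auto simp: ca_formula_def)
    have both: "(holds (self_struct M) zs \<alpha> \<longleftrightarrow> (case c \<alpha> of (s, is) \<Rightarrow> map (\<lambda>i. zs ! i) is \<in> s)) \<and>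
      (case c \<alpha> of (s, is) \<Rightarrow> (hom_minimal M s \<or> s = diag M) \<and> length is = rel_arity s
        \<and> (\<forall>i\<in>set is. i < rel_arity r))"
    proof (cases \<alpha>)
      case (Eq s t)
      then have st: "s = Var (v s)" "t = Var (v t)"
        using wf(2) t by (simp_all add: in_lang_def)
      then have lt: "v s < rel_arity r" "v t < rel_arity r"
        using wf(1) Eq by (metis wf_atom.simps(1) wf_term.simps(1))+
      have "holds (self_struct M) zs \<alpha> \<longleftrightarrow> zs ! v s = zs ! v t"
        unfolding Eq by (subst st(1), subst st(2)) (rule holds_pure_simps(4))
      then show ?thesis
        using lt zs by (auto simp: Eq c_def diag_def tuples_def rel_arity_diag[unfolded diag_def])
    next
      case (Rel s ts)
      then have "\<And>t. t \<in> set ts \<Longrightarrow> Var (v t) = t"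
        using wf(2) t by (fastforce simp: in_lang_def)
      then have ts: "ts = map Var (map v ts)"
        by (simp add: map_idI)
      have "holds (self_struct M) zs \<alpha> \<longleftrightarrow> map (\<lambda>i. zs ! i) (map v ts) \<in> s"
        unfolding Rel by (subst ts) (auto simp only: holds_pure_simps self_struct_simps)
      moreover have "v t < rel_arity r" if t': "t \<in> set ts" for t
      proof -
        have "t = Var (v t)" "wf_term (rel_arity r) t"
          using t[of t] wf Rel t' by (auto simp: list_all_iff in_lang_def)
        then show ?thesis by (metis wf_term.simps(1))
      qed
      ultimately show ?thesis
        using wf Rel by (auto simp: c_def in_lang_def)
    qed
    show "holds (self_struct M) zs \<alpha> \<longleftrightarrow> (case c \<alpha> of (s, is) \<Rightarrow> map (\<lambda>i. zs ! i) is \<in> s)"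
    "case c \<alpha> of (s, is) \<Rightarrow> (hom_minimal M s \<or> s = diag M) \<and> length is = rel_arity s
        \<and> (\<forall>i\<in>set is. i < rel_arity r)"
      using both by simp_all
  qed
  have "r = conj_rel M (rel_arity r) (c ` set \<alpha>s)"
    unfolding conj_rel_def
    by (subst r) (simp add: defined_rel_def *(1) cong: conj_cong)
  moreover have "r \<noteq> {}" using assms by (auto simp: R_alpha_def Rel_ca_def)
  then obtain zs where zs: "zs \<in> tuples (carrier M) (rel_arity r)"
    using r by (auto simp: defined_rel_def)
  have "(hom_minimal M s \<or> s = diag M) \<and> length is = rel_arity s
        \<and> (\<forall>i\<in>set is. i < rel_arity r)" if si: "(s, is) \<in> c ` set \<alpha>s" for s "is"
  proof -
    obtain \<alpha> where \<alpha>: "c \<alpha> = (s, is)" "\<alpha> \<in> set \<alpha>s" using si by force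
    show ?thesis using *(2)[OF \<alpha>(2) zs] unfolding \<alpha>(1) by simp
  qed
  ultimately show ?thesis by (rule that)
qed

lemma hom_minimal_R_alpha: "hom_minimal M s \<Longrightarrow> s \<in> R_alpha M"
  unfolding R_alpha_def by (rule rels_subset_Rel_ca) (auto simp: hom_minimal_def)

lemma R_alpha_subset_Rel_ca:
  assumes "\<And>s. hom_minimal M s \<Longrightarrow> s \<in> Rel_ca M S"
  shows "R_alpha M \<subseteq> Rel_ca M S"
proof
  fix r assume r: "r \<in> R_alpha M"
  obtain \<Delta> where \<Delta>: "r = conj_rel M (rel_arity r) \<Delta>"
    "\<And>s is. (s, is) \<in> \<Delta> \<Longrightarrow> (hom_minimal M s \<or> s = diag M) \<and> length is = rel_arity s
        \<and> (\<forall>i\<in>set is. i < rel_arity r)"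
    using R_alphaE[OF r] by blast
  have "r \<noteq> {}" using r by (simp add: R_alpha_def Rel_ca_def)
  then have "conj_rel M (rel_arity r) \<Delta> \<in> Rel_ca M S"
    using \<Delta> assms diag_Rel_ca by (intro conj_rel_Rel_ca) blast+
  then show "r \<in> Rel_ca M S" using \<Delta>(1) by simp
qed

lemma conj_rel_R_alpha:
  assumes "conj_rel M n \<Delta> \<noteq> {}"
    and "\<And>s is. (s, is) \<in> \<Delta> \<Longrightarrow> s \<in> R_alpha M \<and> length is = rel_arity s \<and> (\<forall>i\<in>set is. i < n)"
  shows "conj_rel M n \<Delta> \<in> R_alpha M"
  using conj_rel_Rel_ca assms unfolding R_alpha_def by blast

lemma R_alpha_compat: "r \<in> R_alpha M \<Longrightarrow> compat_rel M r"
  unfolding R_alpha_def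
  by (rule Rel_ca_compat[rotated], assumption) (auto simp: is_alter_ego_def hom_minimal_def)

lemma is_alter_ego_M_alpha: "is_alter_ego M (M_alpha M)"
  using R_alpha_compat by (auto simp: is_alter_ego_def M_alpha_def)

end

section \<open>Finite structures separated by their morphisms\<close>

lemma induced_simps [simp]:
  "univ (induced X Y) = Y" "opI (induced X Y) h = opI X h |` lists Y"
  "relI (induced X Y) r = relI X r \<inter> lists Y" "topo (induced X Y) = subtopology (topo X) Y"
  by (simp_all add: induced_def)

lemma dual_E_simps [simp]:
  "carrier (dual_E M S Z) = morphs M S Z" "fsyms (dual_E M S Z) = fsyms M"
  "arity (dual_E M S Z) = arity M"
  "opn (dual_E M S Z) F us = (\<lambda>z\<in>univ Z. opn M F (map (\<lambda>u. u z) us))"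
  by (simp_all add: dual_E_def alg_power_def)

text \<open>Finite subsets of a Hausdorff space are closed and carry the discrete topology, which
  makes continuity automatic on finite structures.\<close>

lemma subtopology_product_discrete:
  assumes "finite Y" "Y \<subseteq> I \<rightarrow>\<^sub>E C"
  shows "subtopology (product_topology (\<lambda>_. discrete_topology C) I) Y = discrete_topology Y"
    "closedin (product_topology (\<lambda>_. discrete_topology C) I) Y"
proof -
  have h: "Hausdorff_space (product_topology (\<lambda>_. discrete_topology C) I)"
    by (simp add: Hausdorff_space_product_topology)
  have sub: "Y \<subseteq> topspace (product_topology (\<lambda>_. discrete_topology C) I)"
    using assms(2) by simp
  show "subtopology (product_topology (\<lambda>_. discrete_topology C) I) Y = discrete_topology Y"
    by (rule subtopology_eq_discrete_topology_finite[OF Hausdorff_imp_t1_space[OF h] sub assms(1)])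
  show "closedin (product_topology (\<lambda>_. discrete_topology C) I) Y"
    using Hausdorff_imp_t1_space[OF h] sub assms(1)
    by (simp add: t1_space_closedin_finite)
qed

text \<open>An intrinsic description of the finite members of \<open>IScP_plus\<close>: the
  morphisms into \<open>M\<close> serve as the coordinates of an embedding. The existence of a
  morphism corresponds to the nonempty exponent.\<close>

definition separated :: "('a, 'f) algebra \<Rightarrow> 'a alter_ego \<Rightarrow> ('x, 'a) tstruct \<Rightarrow> bool" where
  "separated M S X \<longleftrightarrow> is_struct S X \<and> topo X = discrete_topology (univ X) \<and>
     morphs M S X \<noteq> {} \<and>
     (\<forall>x\<in>univ X. \<forall>y\<in>univ X. (\<forall>u\<in>morphs M S X. u x = u y) \<longrightarrow> x = y) \<and>
     (\<forall>r\<in>rels S. \<forall>xs\<in>tuples (univ X) (rel_arity r).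
        (\<forall>u\<in>morphs M S X. map u xs \<in> r) \<longrightarrow> xs \<in> relI X r) \<and>
     (\<forall>h\<in>ops S. \<forall>xs\<in>tuples (univ X) (op_arity h).
        (\<forall>u\<in>morphs M S X. map u xs \<in> dom h) \<longrightarrow> xs \<in> dom (opI X h))"

lemma separatedD:
  assumes "separated M S X"
  shows "x \<in> univ X \<Longrightarrow> y \<in> univ X \<Longrightarrow>
      (\<And>u. u \<in> morphs M S X \<Longrightarrow> u x = u y) \<Longrightarrow> x = y"
    and "r \<in> rels S \<Longrightarrow> xs \<in> tuples (univ X) (rel_arity r) \<Longrightarrow>
      (\<And>u. u \<in> morphs M S X \<Longrightarrow> map u xs \<in> r) \<Longrightarrow> xs \<in> relI X r"
    and "h \<in> ops S \<Longrightarrow> xs \<in> tuples (univ X) (op_arity h) \<Longrightarrow>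
      (\<And>u. u \<in> morphs M S X \<Longrightarrow> map u xs \<in> dom h) \<Longrightarrow> xs \<in> dom (opI X h)"
  using assms unfolding separated_def by simp_all

lemma str_hom_self_iff:
  assumes "topo X = discrete_topology (univ X)"
  shows "u \<in> morphs M S X \<longleftrightarrow> u \<in> univ X \<rightarrow>\<^sub>E carrier M \<and>
     (\<forall>r\<in>rels S. \<forall>xs\<in>relI X r. map u xs \<in> r) \<and>
     (\<forall>h\<in>ops S. \<forall>xs y. opI X h xs = Some y \<longrightarrow> h (map u xs) = Some (u y))"
  unfolding str_hom_def using assms by auto

lemma str_hom_in_carrier:
  "u \<in> morphs M S X \<Longrightarrow> x \<in> univ X \<Longrightarrow> u x \<in> carrier M"
  unfolding str_hom_def using PiE_mem by fastforce

lemma str_hom_preserves: "f \<in> str_hom S X Y \<Longrightarrow> preserves S X Y f"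
  by (auto simp: str_hom_def preserves_def)

lemma is_structD:
  assumes "is_struct S X"
  shows "r \<in> rels S \<Longrightarrow> xs \<in> relI X r \<Longrightarrow> xs \<in> tuples (univ X) (rel_arity r)"
    "h \<in> ops S \<Longrightarrow> opI X h xs = Some y \<Longrightarrow> xs \<in> tuples (univ X) (op_arity h)"
    "h \<in> ops S \<Longrightarrow> opI X h xs = Some y \<Longrightarrow> y \<in> univ X"
  using assms unfolding is_struct_def ran_def by blast+

lemma is_alter_egoD:
  assumes "is_alter_ego M S"
  shows "r \<in> rels S \<Longrightarrow> compat_rel M r" "h \<in> ops S \<Longrightarrow> compat_op M h"
    "h \<in> ops S \<Longrightarrow> compat_rel M (dom h)"
  using assms by (auto simp: is_alter_ego_def compat_op_iff)

text \<open>Compatibility of \<open>S\<close> with the basic operations of \<open>M\<close>, applied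
  row by row; it makes \<open>dual_E M S X\<close> closed under these operations.\<close>

lemma str_hom_opn_closed:
  assumes "is_algebra M" and S: "is_alter_ego M S" and X: "is_struct S X"
    and d: "topo X = discrete_topology (univ X)"
    and F: "F \<in> fsyms M" and us: "us \<in> tuples (morphs M S X) (arity M F)"
  shows "(\<lambda>x\<in>univ X. opn M F (map (\<lambda>u. u x) us)) \<in> morphs M S X"
  unfolding str_hom_self_iff[OF d]
proof (intro conjI ballI allI impI)
  have u: "u \<in> morphs M S X" if "u \<in> set us" for u
    using us that by (auto simp: tuples_def)
  have len: "length us = arity M F" using us by (simp add: tuples_def)
  let ?w = "\<lambda>x\<in>univ X. opn M F (map (\<lambda>u. u x) us)"
  have "opn M F (map (\<lambda>u. u x) us) \<in> carrier M" if "x \<in> univ X" for x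
  proof -
    have "map (\<lambda>u. u x) us \<in> tuples (carrier M) (arity M F)"
      using u str_hom_in_carrier that len by (fastforce simp: tuples_def)
    then show ?thesis using \<open>is_algebra M\<close> F by (simp add: is_algebra_def)
  qed
  then show "?w \<in> univ X \<rightarrow>\<^sub>E carrier M" by simp
  have rows: "map (\<lambda>j. opn M F (map (\<lambda>z. z ! j) (map (\<lambda>u. map u xs) us))) [0..<length xs] = map ?w xs"
    if "set xs \<subseteq> univ X" for xs
    using that by (intro nth_equalityI) (auto simp: comp_def dest: nth_mem)
  {
    fix r xs assume r: "r \<in> rels S" and xs: "xs \<in> relI X r"
    have xt: "xs \<in> tuples (univ X) (rel_arity r)" by (rule is_structD(1)[OF X r xs])
    have "map (\<lambda>u. map u xs) us \<in> tuples r (arity M F)"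
      using u xs r len unfolding str_hom_self_iff[OF d] by (auto simp: tuples_def)
    from compat_relD(3)[OF is_alter_egoD(1)[OF S r] F this]
    show "map ?w xs \<in> r" using rows[of xs] xt by (simp add: tuples_def)
  }
  fix h xs y assume h: "h \<in> ops S" and xs: "opI X h xs = Some y"
  have xt: "xs \<in> tuples (univ X) (op_arity h)" and y: "y \<in> univ X"
    using is_structD(2,3)[OF X h xs] by simp_all
  have hu: "h (map u xs) = Some (u y)" if "u \<in> set us" for u
    using u[OF that] xs h unfolding str_hom_self_iff[OF d] by blast
  have "map (\<lambda>u. map u xs) us \<in> tuples (dom h) (arity M F)"
    using hu len by (auto simp: tuples_def)
  from compat_op_opn[OF is_alter_egoD(2)[OF S h] F this]
  have "h (map ?w xs) = Some (opn M F (map (\<lambda>zs. the (h zs)) (map (\<lambda>u. map u xs) us)))"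
    using rows[of xs] xt by (simp add: tuples_def)
  also have "map (\<lambda>zs. the (h zs)) (map (\<lambda>u. map u xs) us) = map (\<lambda>u. u y) us"
    using hu by simp
  finally show "h (map ?w xs) = Some (?w y)" using y by (simp only: restrict_apply')
qed

context fin_alg
begin

lemma eval_in_power:
  "x \<in> univ X \<Longrightarrow> epsilon M S X x \<in> morphs M S X \<rightarrow>\<^sub>E carrier M"
  using str_hom_in_carrier by (fastforce simp: epsilon_def)

lemma epsilon_rows:
  assumes "set xs \<subseteq> univ X" "u \<in> morphs M S X"
  shows "map (\<lambda>z. z u) (map (epsilon M S X) xs) = map u xs"
  using assms by (auto simp: epsilon_def)

lemma epsilon_lists:
  assumes "set xs \<subseteq> univ X"
  shows "map (epsilon M S X) xs \<in> lists (morphs M S X \<rightarrow>\<^sub>E carrier M)"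
  unfolding lists_eq_set mem_Collect_eq set_map
  using assms by (intro image_subsetI eval_in_power) blast

text \<open>Separation of points makes \<open>epsilon\<close> injective, and reflection of relations
  and domains makes its inverse a morphism. The image is finite, hence closed and discrete.\<close>

lemma separated_epsilon:
  assumes S: "is_alter_ego M S" and X: "separated M S X" and finX: "finite (univ X)"
  defines "P \<equiv> power_struct M (morphs M S X)"
    and "Y \<equiv> epsilon M S X ` univ X"
  shows "str_iso S (epsilon M S X) X (induced P Y)" "op_closed S P Y" "closedin (topo P) Y"
proof -
  let ?H = "morphs M S X" and ?e = "epsilon M S X"
  have X1: "is_struct S X" and d: "topo X = discrete_topology (univ X)"
    using X by (auto simp: separated_def)
  have YP: "Y \<subseteq> ?H \<rightarrow>\<^sub>E carrier M"
    unfolding Y_def by (intro image_subsetI eval_in_power)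
  note top = subtopology_product_discrete[OF _ YP]
  have finY: "finite Y" using finX by (simp add: Y_def)
  show "closedin (topo P) Y" unfolding P_def power_struct_simps by (rule top(2)[OF finY])
  have inj: "inj_on ?e (univ X)"
  proof (rule inj_onI)
    fix x y assume xy: "x \<in> univ X" "y \<in> univ X" "?e x = ?e y"
    have "u x = u y" if "u \<in> ?H" for u
      using fun_cong[OF xy(3), of u] xy(1,2) that by (simp add: epsilon_def)
    then show "x = y" using X xy unfolding separated_def by blast
  qed
  have rel: "map ?e xs \<in> relI P r \<longleftrightarrow> xs \<in> relI X r" if r: "r \<in> rels S" and xs: "set xs \<subseteq> univ X" for r xs
  proof
    assume "xs \<in> relI X r"
    then have "map u xs \<in> r" if "u \<in> ?H" for u
      using that r unfolding str_hom_self_iff[OF d] by blast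
    then show "map ?e xs \<in> relI P r"
      using epsilon_rows[OF xs] epsilon_lists[OF xs] unfolding P_def power_struct_simps
      by (simp del: map_map in_lists_conv_set)
  next
    assume *: "map ?e xs \<in> relI P r"
    then have m: "\<forall>u\<in>?H. map u xs \<in> r"
      using epsilon_rows[OF xs] unfolding P_def power_struct_simps by (auto simp del: map_map)
    \<comment> \<open>The length of \<open>xs\<close> can only be read off some coordinate; over an
      empty exponent every list would lie in \<open>relI P r\<close>.\<close>
    moreover obtain u where "u \<in> ?H" using X by (auto simp: separated_def)
    ultimately have "length xs = rel_arity r"
      using compat_rel_length[OF is_alter_egoD(1)[OF S r]] by fastforce
    then show "xs \<in> relI X r"
      using X r xs m unfolding separated_def tuples_def by blast
  qed
  have op: "opI P h (map ?e xs) = map_option ?e (opI X h xs)"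
    if h: "h \<in> ops S" and xs: "set xs \<subseteq> univ X" for h xs
  proof (cases "\<forall>u\<in>?H. map u xs \<in> dom h")
    case True
    obtain u where "u \<in> ?H" using X by (auto simp: separated_def)
    then have "length xs = op_arity h"
      using compat_rel_length[OF is_alter_egoD(3)[OF S h]] True by fastforce
    then have "xs \<in> dom (opI X h)"
      using X h xs True unfolding separated_def tuples_def by blast
    then obtain y where y: "opI X h xs = Some y" by blast
    have yX: "y \<in> univ X" using is_structD(3)[OF X1 h y] .
    have hu: "h (map u xs) = Some (u y)" if "u \<in> ?H" for u
      using that y h unfolding str_hom_self_iff[OF d] by blast
    have "(\<lambda>u\<in>?H. the (h (map (\<lambda>z. z u) (map ?e xs)))) = ?e y"
      using epsilon_rows[OF xs] hu yX by (auto simp: epsilon_def simp del: map_map)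
    moreover note epsilon_lists[OF xs]
    ultimately show ?thesis
      using True y epsilon_rows[OF xs] unfolding P_def power_struct_simps
      by (simp del: map_map in_lists_conv_set)
  next
    case False
    have "opI X h xs = None"
    proof (rule ccontr)
      assume "opI X h xs \<noteq> None"
      then obtain y where y: "opI X h xs = Some y" by blast
      have "h (map u xs) = Some (u y)" if "u \<in> ?H" for u
        using that y h unfolding str_hom_self_iff[OF d] by blast
      then show False using False by blast
    qed
    then show ?thesis
      using False epsilon_rows[OF xs] unfolding P_def power_struct_simps by (auto simp del: map_map)
  qed
  have oc: "\<exists>y\<in>univ X. z = ?e y"
    if h: "h \<in> ops S" and xs: "set xs \<subseteq> univ X" and z: "opI P h (map ?e xs) = Some z" for h xs z
    using z op[OF h xs] is_structD(3)[OF X1 h] by auto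
  define g where "g = restrict (inv_into (univ X) ?e) Y"
  have ge: "g (?e x) = x" if "x \<in> univ X" for x
    using that inj by (simp add: g_def Y_def)
  have pull: "\<exists>xs. set xs \<subseteq> univ X \<and> zs = map ?e xs \<and> map g zs = xs" if zs: "set zs \<subseteq> Y" for zs
  proof (intro exI conjI)
    show "set (map g zs) \<subseteq> univ X" using zs ge by (auto simp: Y_def)
    show "zs = map ?e (map g zs)"
      using zs ge by (intro nth_equalityI) (auto simp: Y_def dest!: nth_mem subsetD)
  qed simp
  show "op_closed S P Y"
    unfolding op_closed_def
  proof (intro conjI ballI allI impI)
    show "Y \<subseteq> univ P" using YP by (simp add: P_def)
    fix h zs z assume h: "h \<in> ops S" and zs: "zs \<in> lists Y" and z: "opI P h zs = Some z"
    obtain xs where xs: "set xs \<subseteq> univ X" "zs = map ?e xs" using pull[of zs] zs unfolding lists_eq_set by blast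
    then show "z \<in> Y" using oc[OF h xs(1)] z unfolding xs(2) Y_def by blast
  qed
  have dY: "topo (induced P Y) = discrete_topology Y"
    unfolding induced_simps P_def power_struct_simps by (rule top(1)[OF finY])
  have mapY: "map ?e xs \<in> lists Y" if "set xs \<subseteq> univ X" for xs
    using that by (auto simp: lists_eq_set Y_def)
  have "?e \<in> str_hom S X (induced P Y)"
    unfolding str_hom_def
  proof (intro CollectI conjI ballI allI impI)
    show "?e \<in> univ X \<rightarrow>\<^sub>E univ (induced P Y)" by (auto simp: Y_def epsilon_def)
    show "continuous_map (topo X) (topo (induced P Y)) ?e"
      unfolding d dY by (auto simp: Y_def)
    fix r xs assume r: "r \<in> rels S" "xs \<in> relI X r"
    then have "set xs \<subseteq> univ X" using is_structD(1)[OF X1] by (auto simp: tuples_def)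
    then show "map ?e xs \<in> relI (induced P Y) r" using r rel mapY by simp
  next
    fix h xs y assume h: "h \<in> ops S" "opI X h xs = Some y"
    then have "set xs \<subseteq> univ X" using is_structD(2)[OF X1] by (auto simp: tuples_def)
    then show "opI (induced P Y) h (map ?e xs) = Some (?e y)"
      using h op mapY by (simp add: restrict_map_def)
  qed
  moreover have "bij_betw ?e (univ X) Y" using inj by (simp add: Y_def bij_betw_def)
  moreover have "g \<in> str_hom S (induced P Y) X"
    unfolding str_hom_def
  proof (intro CollectI conjI ballI allI impI)
    show "g \<in> univ (induced P Y) \<rightarrow>\<^sub>E univ X" using ge by (auto simp: g_def Y_def)
    then show "continuous_map (topo (induced P Y)) (topo X) g" unfolding d dY by auto
    fix r zs assume r: "r \<in> rels S" "zs \<in> relI (induced P Y) r"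
    then obtain xs where "set xs \<subseteq> univ X" "zs = map ?e xs" "map g zs = xs"
      using pull[of zs] unfolding induced_simps lists_eq_set by blast
    then show "map g zs \<in> relI X r" using r rel by simp
  next
    fix h zs z assume h: "h \<in> ops S" "opI (induced P Y) h zs = Some z"
    then have zs: "set zs \<subseteq> Y" "opI P h zs = Some z"
      by (auto simp: restrict_map_def lists_eq_set split: if_splits)
    obtain xs where xs: "set xs \<subseteq> univ X" "zs = map ?e xs" "map g zs = xs"
      using pull[OF zs(1)] by blast
    then obtain y where y: "opI X h xs = Some y" "z = ?e y"
      using op[OF h(1) xs(1)] zs(2) by auto
    then show "opI X h (map g zs) = Some (g z)"
      using xs(3) ge[OF is_structD(3)[OF X1 h(1) y(1)]] by simp
  qed
  ultimately show "str_iso S ?e X (induced P Y)"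
    unfolding str_iso_def g_def by simp
qed

lemma separated_IScP_plus:
  assumes "is_alter_ego M S" "separated M S X" "finite (univ X)"
  shows "IScP_plus M S X"
  unfolding IScP_plus_def
proof (intro conjI exI)
  show "is_tstruct S X" using assms(2) by (simp add: separated_def is_tstruct_def)
  show "morphs M S X \<noteq> {}" using assms(2) by (simp add: separated_def)
qed (rule separated_epsilon[OF assms])+

text \<open>The coordinates of the given embedding are themselves morphisms into \<open>M\<close>,
  and they are already enough to separate points and to reflect relations and domains.\<close>

lemma IScP_plus_separated:
  assumes S: "is_alter_ego M S" and I: "IScP_plus M S X" and finX: "finite (univ X)"
  shows "separated M S X"
proof -
  have X1: "is_struct S X" and tX: "topspace (topo X) = univ X"
    using I by (auto simp: IScP_plus_def is_tstruct_def)
  obtain I :: "('b \<Rightarrow> 'a) set" and Y f where I: "I \<noteq> {}" and oc: "op_closed S (power_struct M I) Y"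
    and iso: "str_iso S f X (induced (power_struct M I) Y)"
    using I unfolding IScP_plus_def by blast
  let ?P = "power_struct M I"
  define g where "g = restrict (inv_into (univ X) f) (univ (induced ?P Y))"
  have f: "f \<in> str_hom S X (induced ?P Y)" and bij: "bij_betw f (univ X) Y"
    and g: "g \<in> str_hom S (induced ?P Y) X"
    using iso unfolding str_iso_def g_def by simp_all
  have YP: "Y \<subseteq> I \<rightarrow>\<^sub>E carrier M" using oc by (simp add: op_closed_def)
  have finY: "finite Y" using bij finX bij_betw_finite by blast
  have gf: "g (f x) = x" if "x \<in> univ X" for x
    using that bij by (auto simp: g_def bij_betw_def)
  have fY: "f x \<in> Y" if "x \<in> univ X" for x
    using that bij by (auto simp: bij_betw_def)
  have mgf: "map g (map f xs) = xs" if "set xs \<subseteq> univ X" for xs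
    using that gf by (simp add: map_idI subset_iff)
  have d: "topo X = discrete_topology (univ X)"
  proof -
    have "topo (induced ?P Y) = discrete_topology Y"
      unfolding induced_simps power_struct_simps by (rule subtopology_product_discrete[OF finY YP])
    then have c: "continuous_map (topo X) (discrete_topology Y) f"
      using f by (simp add: str_hom_def)
    \<comment> \<open>As \<open>f\<close> is injective and continuous into a discrete space,
      singletons are preimages of open points.\<close>
    have "openin (topo X) {x}" if x: "x \<in> univ X" for x
    proof -
      have "openin (topo X) {y \<in> topspace (topo X). f y \<in> {f x}}"
        using c fY[OF x] by (intro openin_continuous_map_preimage[OF c]) simp
      moreover have "{y \<in> topspace (topo X). f y \<in> {f x}} = {x}"
        using x bij tX by (auto simp: bij_betw_def inj_on_def)
      ultimately show ?thesis by simp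
    qed
    then show ?thesis using tX discrete_topology_unique[of "univ X" "topo X"] by simp
  qed
  define u where "u i = (\<lambda>x\<in>univ X. f x i)" for i
  have mu: "map (u i) xs = map (\<lambda>z. z i) (map f xs)" if "set xs \<subseteq> univ X" for i xs
    using that by (auto simp: u_def)
  have uH: "u i \<in> morphs M S X" if i: "i \<in> I" for i
    unfolding str_hom_self_iff[OF d]
  proof (intro conjI ballI allI impI)
    show "u i \<in> univ X \<rightarrow>\<^sub>E carrier M"
      using fY YP i unfolding u_def by (intro restrict_PiE_iff[THEN iffD2]) (auto intro: PiE_mem)
    fix r xs assume r: "r \<in> rels S" "xs \<in> relI X r"
    then have xs: "set xs \<subseteq> univ X" using is_structD(1)[OF X1] by (auto simp: tuples_def)
    have "map f xs \<in> relI (induced ?P Y) r" using f r by (simp add: str_hom_def)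
    then show "map (u i) xs \<in> r" unfolding mu[OF xs] using i by (simp del: map_map)
  next
    fix h xs y assume h: "h \<in> ops S" "opI X h xs = Some y"
    then have xs: "set xs \<subseteq> univ X" using is_structD(2)[OF X1] by (auto simp: tuples_def)
    have y: "y \<in> univ X" using is_structD(3)[OF X1 h] .
    have "opI (induced ?P Y) h (map f xs) = Some (f y)" using f h by (simp add: str_hom_def)
    then have 1: "\<forall>i\<in>I. map (\<lambda>z. z i) (map f xs) \<in> dom h"
      and 2: "f y = (\<lambda>i\<in>I. the (h (map (\<lambda>z. z i) (map f xs))))"
      by (auto simp: restrict_map_def simp del: map_map split: if_splits)
    then show "h (map (u i) xs) = Some (u i y)"
      unfolding mu[OF xs] using i y by (auto simp: u_def simp del: map_map)
  qed
  show ?thesis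
    unfolding separated_def
  proof (intro conjI ballI impI)
    show "is_struct S X" by (rule X1)
    show "topo X = discrete_topology (univ X)" by (rule d)
    show "morphs M S X \<noteq> {}" using I uH by blast
    fix x y assume x: "x \<in> univ X" and y: "y \<in> univ X"
      and eq: "\<forall>u\<in>morphs M S X. u x = u y"
    have "f x = f y"
    proof (rule PiE_ext)
      show "f x \<in> I \<rightarrow>\<^sub>E carrier M" "f y \<in> I \<rightarrow>\<^sub>E carrier M" using fY YP x y by blast+
      fix i assume "i \<in> I"
      then show "f x i = f y i" using bspec[OF eq uH] x y by (simp add: u_def)
    qed
    then show "x = y" using gf x y by metis
  next
    fix r xs assume r: "r \<in> rels S" and "xs \<in> tuples (univ X) (rel_arity r)"
      and m: "\<forall>u\<in>morphs M S X. map u xs \<in> r"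
    then have xs: "set xs \<subseteq> univ X" by (simp add: tuples_def)
    have "map (\<lambda>z. z i) (map f xs) \<in> r" if "i \<in> I" for i
      using bspec[OF m uH[OF that]] mu[OF xs] by simp
    moreover have "map f xs \<in> lists Y" "map f xs \<in> lists (I \<rightarrow>\<^sub>E carrier M)"
      using fY YP xs unfolding lists_eq_set by auto
    ultimately have "map f xs \<in> relI (induced ?P Y) r" by (simp del: map_map in_lists_conv_set)
    then have "map g (map f xs) \<in> relI X r" using g r unfolding str_hom_def by blast
    then show "xs \<in> relI X r" using mgf[OF xs] by simp
  next
    fix h xs assume h: "h \<in> ops S" and "xs \<in> tuples (univ X) (op_arity h)"
      and m: "\<forall>u\<in>morphs M S X. map u xs \<in> dom h"
    then have xs: "set xs \<subseteq> univ X" by (simp add: tuples_def)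
    have "map (\<lambda>z. z i) (map f xs) \<in> dom h" if "i \<in> I" for i
      using bspec[OF m uH[OF that]] mu[OF xs] by simp
    moreover have "map f xs \<in> lists Y" "map f xs \<in> lists (I \<rightarrow>\<^sub>E carrier M)"
      using fY YP xs unfolding lists_eq_set by auto
    ultimately obtain z where "opI (induced ?P Y) h (map f xs) = Some z"
      by (simp del: map_map in_lists_conv_set)
    then have "opI X h (map g (map f xs)) = Some (g z)" using g h unfolding str_hom_def by blast
    then show "xs \<in> dom (opI X h)" using mgf[OF xs] by auto
  qed
qed

text \<open>By \<open>separated_epsilon\<close> the evaluation map is an isomorphism onto its image.
  What may fail is that every homomorphism on the dual is an evaluation, and this is the assumption
  \<open>surj\<close>.\<close>

lemma epsilon_iso_if_surj:
  assumes S: "is_alter_ego M S" and X: "separated M S X" "finite (univ X)"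
    and surj: "\<And>\<phi>. \<phi> \<in> alg_hom (dual_E M S X) M \<Longrightarrow>
      \<exists>x\<in>univ X. \<forall>u\<in>morphs M S X. \<phi> u = u x"
  shows "str_iso S (epsilon M S X) X (dual_D M (dual_E M S X))"
proof -
  have X1: "is_struct S X" and d: "topo X = discrete_topology (univ X)"
    using X by (auto simp: separated_def)
  have "alg_hom (dual_E M S X) M = epsilon M S X ` univ X"
  proof (intro equalityI subsetI)
    fix \<phi> assume \<phi>: "\<phi> \<in> alg_hom (dual_E M S X) M"
    obtain x where x: "x \<in> univ X" "\<forall>u\<in>morphs M S X. \<phi> u = u x"
      using surj[OF \<phi>] by blast
    have "\<phi> = epsilon M S X x"
    proof (rule extensionalityI)
      show "\<phi> \<in> extensional (morphs M S X)"
        using \<phi> by (auto simp: alg_hom_def PiE_def)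
    qed (use x in \<open>auto simp: epsilon_def\<close>)
    then show "\<phi> \<in> epsilon M S X ` univ X" using x by blast
  next
    fix \<phi> assume "\<phi> \<in> epsilon M S X ` univ X"
    then obtain x where x: "x \<in> univ X" "\<phi> = epsilon M S X x" by blast
    show "\<phi> \<in> alg_hom (dual_E M S X) M"
      unfolding alg_hom_def dual_E_simps
    proof (intro CollectI conjI ballI)
      show "\<phi> \<in> morphs M S X \<rightarrow>\<^sub>E carrier M" unfolding x(2) by (rule eval_in_power[OF x(1)])
      fix F us assume F: "F \<in> fsyms M" and us: "us \<in> tuples (morphs M S X) (arity M F)"
      have "map \<phi> us = map (\<lambda>u. u x) us" using us x by (auto simp: epsilon_def tuples_def)
      then show "\<phi> (\<lambda>z\<in>univ X. opn M F (map (\<lambda>u. u z) us)) = opn M F (map \<phi> us)"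
        using str_hom_opn_closed[OF alg S X1 d F us] x by (simp add: epsilon_def del: map_eq_conv)
    qed
  qed
  then show ?thesis
    unfolding dual_D_def using separated_epsilon(1)[OF S X] by simp
qed

end

section \<open>Copies of finite structures on the natural numbers\<close>

definition copy_struct :: "('x \<Rightarrow> 'y) \<Rightarrow> ('x, 'a, 'z) struct_scheme \<Rightarrow> ('y, 'a) tstruct" where
  "copy_struct b X = \<lparr>univ = b ` univ X,
     opI = (\<lambda>h ys. if ys \<in> lists (b ` univ X)
       then map_option b (opI X h (map (inv_into (univ X) b) ys)) else None),
     relI = (\<lambda>r. {ys \<in> lists (b ` univ X). map (inv_into (univ X) b) ys \<in> relI X r}),
     topo = discrete_topology (b ` univ X)\<rparr>"

lemma copy_struct_simps [simp]:
  "univ (copy_struct b X) = b ` univ X" "topo (copy_struct b X) = discrete_topology (b ` univ X)"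
  by (simp_all add: copy_struct_def)

lemma copy_struct:
  assumes X: "is_struct S X" and inj: "inj_on b (univ X)"
  defines "c \<equiv> inv_into (univ X) b"
  shows "is_struct S (copy_struct b X)"
    "r \<in> rels S \<Longrightarrow> relI (copy_struct b X) r = map b ` relI X r"
    "h \<in> ops S \<Longrightarrow> opI X h xs = Some y \<Longrightarrow> opI (copy_struct b X) h (map b xs) = Some (b y)"
    "h \<in> ops S \<Longrightarrow> opI (copy_struct b X) h ys = Some z \<Longrightarrow>
       \<exists>xs y. opI X h xs = Some y \<and> ys = map b xs \<and> z = b y"
    "preserves S X (copy_struct b X) b" "preserves S (copy_struct b X) X c"
proof -
  have cb: "map c (map b xs) = xs" if "set xs \<subseteq> univ X" for xs
    using that inj unfolding c_def by (auto intro!: map_idI)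
  have bc: "\<exists>xs. set xs \<subseteq> univ X \<and> ys = map b xs" if "set ys \<subseteq> b ` univ X" for ys
    using that by (metis lists_eq_set lists_image imageE mem_Collect_eq)
  show 1: "relI (copy_struct b X) r = map b ` relI X r" if r: "r \<in> rels S" for r
  proof (intro equalityI subsetI)
    fix ys assume "ys \<in> relI (copy_struct b X) r"
    then have "set ys \<subseteq> b ` univ X" "map c ys \<in> relI X r"
      by (auto simp: copy_struct_def c_def)
    moreover then obtain xs where "set xs \<subseteq> univ X" "ys = map b xs" using bc by blast
    ultimately show "ys \<in> map b ` relI X r" using cb by auto
  next
    fix ys assume "ys \<in> map b ` relI X r"
    then obtain xs where xs: "xs \<in> relI X r" "ys = map b xs" by blast
    then have "set xs \<subseteq> univ X" using is_structD(1)[OF X r] by (auto simp: tuples_def)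
    then show "ys \<in> relI (copy_struct b X) r"
      using xs cb[of xs] by (auto simp: copy_struct_def c_def subset_iff)
  qed
  show 2: "opI (copy_struct b X) h (map b xs) = Some (b y)"
    if h: "h \<in> ops S" and xs: "opI X h xs = Some y" for h xs y
  proof -
    have "set xs \<subseteq> univ X" using is_structD(2)[OF X h xs] by (auto simp: tuples_def)
    then show ?thesis using xs cb[of xs] by (auto simp: copy_struct_def c_def subset_iff)
  qed
  show 3: "\<exists>xs y. opI X h xs = Some y \<and> ys = map b xs \<and> z = b y"
    if h: "h \<in> ops S" and ys: "opI (copy_struct b X) h ys = Some z" for h ys z
  proof -
    have s: "set ys \<subseteq> b ` univ X" and o: "map_option b (opI X h (map c ys)) = Some z"
      using ys by (auto simp: copy_struct_def c_def split: if_splits)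
    obtain xs where xs: "set xs \<subseteq> univ X" "ys = map b xs" using bc[OF s] by blast
    show ?thesis using o xs cb[OF xs(1)] by auto
  qed
  show "is_struct S (copy_struct b X)"
    unfolding is_struct_def
  proof (intro conjI ballI)
    fix h assume h: "h \<in> ops S"
    have *: "ys \<in> tuples (b ` univ X) (op_arity h)" "z \<in> b ` univ X"
      if ys: "opI (copy_struct b X) h ys = Some z" for ys z
    proof -
      obtain xs y where xs: "opI X h xs = Some y" "ys = map b xs" "z = b y"
        using 3[OF h ys] by blast
      then show "ys \<in> tuples (b ` univ X) (op_arity h)" "z \<in> b ` univ X"
        using is_structD(2,3)[OF X h xs(1)] by (auto simp: tuples_def)
    qed
    show "dom (opI (copy_struct b X) h) \<subseteq> tuples (univ (copy_struct b X)) (op_arity h)"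
      using *(1) by auto
    show "ran (opI (copy_struct b X) h) \<subseteq> univ (copy_struct b X)"
      using *(2) by (auto simp: ran_def)
  next
    fix r assume r: "r \<in> rels S"
    then show "relI (copy_struct b X) r \<subseteq> tuples (univ (copy_struct b X)) (rel_arity r)"
      using 1 is_structD(1)[OF X] by (fastforce simp: tuples_def)
  qed
  show "preserves S X (copy_struct b X) b"
    unfolding preserves_def using 1 2 by blast
  show "preserves S (copy_struct b X) X c"
    unfolding preserves_def
  proof (intro conjI ballI allI impI)
    fix r ys assume r: "r \<in> rels S" "ys \<in> relI (copy_struct b X) r"
    then obtain xs where xs: "xs \<in> relI X r" "ys = map b xs" using 1 by blast
    then have "set xs \<subseteq> univ X" using is_structD(1)[OF X r(1)] by (auto simp: tuples_def)
    then show "map c ys \<in> relI X r" using xs cb by simp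
  next
    fix h ys z assume h: "h \<in> ops S" "opI (copy_struct b X) h ys = Some z"
    obtain xs y where xs: "opI X h xs = Some y" "ys = map b xs" "z = b y"
      using 3[OF h] by blast
    then have "set xs \<subseteq> univ X" "c (b y) = y"
      using is_structD(2,3)[OF X h(1) xs(1)] inj by (auto simp: tuples_def c_def)
    then show "opI X h (map c ys) = Some (c z)" using xs cb by simp
  qed
qed

context fin_alg
begin

text \<open>Full duality is stated for structures on natural numbers, while the structures to which
  it is applied consist of functions. The finite structure \<open>Z\<close> is copied, and
  \<open>up\<close> and \<open>down\<close> carry morphisms between \<open>Z\<close> and its
  copy.\<close>

lemma fully_dualises_surj:
  fixes Z :: "('x, 'a) tstruct"
  assumes S: "is_alter_ego M S" and full: "fully_dualises_fin M S"
    and Z: "separated M S Z" and finZ: "finite (univ Z)"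
    and \<phi>: "\<phi> \<in> alg_hom (dual_E M S Z) M"
  shows "\<exists>z\<in>univ Z. \<forall>u\<in>morphs M S Z. \<phi> u = u z"
proof -
  obtain b :: "'x \<Rightarrow> nat" where inj: "inj_on b (univ Z)"
    using finite_imp_inj_to_nat_seg[OF finZ] by blast
  define X where "X = copy_struct b Z"
  have Z1: "is_struct S Z" and dZ: "topo Z = discrete_topology (univ Z)"
    using Z by (auto simp: separated_def)
  note C = copy_struct[OF Z1 inj, folded X_def]
  have uX: "univ X = b ` univ Z" and dX: "topo X = discrete_topology (univ X)"
    by (simp_all add: X_def)
  have finX: "finite (univ X)" using finZ uX by simp
  define up where "up v = (\<lambda>x\<in>univ Z. v (b x))" for v :: "nat \<Rightarrow> 'a"
  define down where "down u = (\<lambda>y\<in>univ X. u (inv_into (univ Z) b y))" for u :: "'x \<Rightarrow> 'a"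
  have mup: "map (up v) xs = map v (map b xs)" if "set xs \<subseteq> univ Z" for v xs
    using that by (auto simp: up_def)
  have mdown: "map (down u) (map b xs) = map u xs" if "set xs \<subseteq> univ Z" for u xs
    using that inj uX by (auto simp: down_def inv_into_f_f subset_iff)
  have up: "up v \<in> morphs M S Z" if v: "v \<in> morphs M S X" for v
    unfolding str_hom_self_iff[OF dZ]
  proof (intro conjI ballI allI impI)
    note v' = v[unfolded str_hom_self_iff[OF dX]]
    show "up v \<in> univ Z \<rightarrow>\<^sub>E carrier M"
      using str_hom_in_carrier[OF v] uX by (auto simp: up_def)
    fix r xs assume r: "r \<in> rels S" "xs \<in> relI Z r"
    then have xs: "set xs \<subseteq> univ Z" using is_structD(1)[OF Z1] by (auto simp: tuples_def)
    show "map (up v) xs \<in> r" unfolding mup[OF xs] using v' r C(2)[OF r(1)] by blast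
  next
    note v' = v[unfolded str_hom_self_iff[OF dX]]
    fix h xs y assume h: "h \<in> ops S" "opI Z h xs = Some y"
    then have xs: "set xs \<subseteq> univ Z" "y \<in> univ Z"
      using is_structD(2,3)[OF Z1] by (auto simp: tuples_def)
    have "h (map v (map b xs)) = Some (v (b y))" using v' h(1) C(3)[OF h] by blast
    then show "h (map (up v) xs) = Some (up v y)"
      unfolding mup[OF xs(1)] using xs(2) by (simp add: up_def)
  qed
  have down: "down u \<in> morphs M S X" if u: "u \<in> morphs M S Z" for u
    unfolding str_hom_self_iff[OF dX]
  proof (intro conjI ballI allI impI)
    show "down u \<in> univ X \<rightarrow>\<^sub>E carrier M"
      using str_hom_in_carrier[OF u] uX inj by (auto simp: down_def)
    note u' = u[unfolded str_hom_self_iff[OF dZ]]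
    fix r ys assume r: "r \<in> rels S" "ys \<in> relI X r"
    then obtain xs where ys: "ys = map b xs" "xs \<in> relI Z r" using C(2) by blast
    then have xs: "set xs \<subseteq> univ Z" using is_structD(1)[OF Z1 r(1)] by (auto simp: tuples_def)
    show "map (down u) ys \<in> r" unfolding ys(1) mdown[OF xs] using u' r(1) ys(2) by blast
  next
    note u' = u[unfolded str_hom_self_iff[OF dZ]]
    fix h ys z assume h: "h \<in> ops S" "opI X h ys = Some z"
    then obtain xs y where y: "opI Z h xs = Some y" "ys = map b xs" "z = b y" using C(4) by blast
    then have xs: "set xs \<subseteq> univ Z" "y \<in> univ Z"
      using is_structD(2,3)[OF Z1 h(1)] by (auto simp: tuples_def)
    have "h (map u xs) = Some (u y)" using u' h(1) y(1) by blast
    then show "h (map (down u) ys) = Some (down u z)"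
      unfolding y(2,3) mdown[OF xs(1)] using mdown[of "[y]" u] xs(2) by simp
  qed
  obtain u0 where u0: "u0 \<in> morphs M S Z"
    using Z by (auto simp: separated_def)
  have sepX: "separated M S X"
    unfolding separated_def
  proof (intro conjI ballI impI)
    show "is_struct S X" by (rule C(1))
    show "topo X = discrete_topology (univ X)" by (rule dX)
    show "morphs M S X \<noteq> {}" using down[OF u0] by blast
    fix x y assume "x \<in> univ X" "y \<in> univ X" and eq: "\<forall>u\<in>morphs M S X. u x = u y"
    then obtain x' y' where xy: "x' \<in> univ Z" "y' \<in> univ Z" "x = b x'" "y = b y'" using uX by blast
    have "u x' = u y'" if "u \<in> morphs M S Z" for u
      using bspec[OF eq down[OF that]] mdown[of "[x']" u] mdown[of "[y']" u] xy by simp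
    then show "x = y" using separatedD(1)[OF Z xy(1,2)] xy by simp
  next
    fix r ys assume r: "r \<in> rels S" and ys: "ys \<in> tuples (univ X) (rel_arity r)"
      and m: "\<forall>u\<in>morphs M S X. map u ys \<in> r"
    have "set ys \<subseteq> b ` univ Z" "length ys = rel_arity r" using ys uX by (auto simp: tuples_def)
    then obtain xs where xs: "ys = map b xs" "set xs \<subseteq> univ Z"
      by (metis lists_eq_set lists_image imageE mem_Collect_eq)
    have "map u xs \<in> r" if "u \<in> morphs M S Z" for u
      using bspec[OF m down[OF that]] unfolding xs(1) mdown[OF xs(2)] .
    moreover have "xs \<in> tuples (univ Z) (rel_arity r)"
      using xs \<open>length ys = _\<close> by (simp add: tuples_def)
    ultimately have "xs \<in> relI Z r" using separatedD(2)[OF Z r] by simp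
    then show "ys \<in> relI X r" using C(2)[OF r] xs(1) by blast
  next
    fix h ys assume h: "h \<in> ops S" and ys: "ys \<in> tuples (univ X) (op_arity h)"
      and m: "\<forall>u\<in>morphs M S X. map u ys \<in> dom h"
    have "set ys \<subseteq> b ` univ Z" "length ys = op_arity h" using ys uX by (auto simp: tuples_def)
    then obtain xs where xs: "ys = map b xs" "set xs \<subseteq> univ Z"
      by (metis lists_eq_set lists_image imageE mem_Collect_eq)
    have "map u xs \<in> dom h" if "u \<in> morphs M S Z" for u
      using bspec[OF m down[OF that]] unfolding xs(1) mdown[OF xs(2)] .
    moreover have "xs \<in> tuples (univ Z) (op_arity h)"
      using xs \<open>length ys = _\<close> by (simp add: tuples_def)
    ultimately have "xs \<in> dom (opI Z h)" using separatedD(3)[OF Z h] by blast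
    then obtain y where "opI Z h xs = Some y" by blast
    then show "ys \<in> dom (opI X h)" using C(3)[OF h] xs(1) by blast
  qed
  have "str_iso S (epsilon M S X) X (dual_D M (dual_E M S X))"
    using full separated_IScP_plus[OF S sepX finX] finX unfolding fully_dualises_fin_def by blast
  then have surj: "alg_hom (dual_E M S X) M = epsilon M S X ` univ X"
    by (simp add: str_iso_def dual_D_def bij_betw_def)
  \<comment> \<open>The homomorphism \<open>\<phi>\<close> transported to the copy, where full
    duality makes it an evaluation.\<close>
  define \<psi> where "\<psi> = (\<lambda>v\<in>morphs M S X. \<phi> (up v))"
  have "\<psi> \<in> alg_hom (dual_E M S X) M"
    unfolding alg_hom_def dual_E_simps
  proof (intro CollectI conjI ballI)
    have "\<phi> u \<in> carrier M" if "u \<in> morphs M S Z" for u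
      using \<phi> that unfolding alg_hom_def by (auto dest: PiE_mem)
    then show "\<psi> \<in> morphs M S X \<rightarrow>\<^sub>E carrier M"
      using up unfolding \<psi>_def by (intro restrict_PiE_iff[THEN iffD2]) blast
    fix F vs assume F: "F \<in> fsyms M" and vs: "vs \<in> tuples (morphs M S X) (arity M F)"
    let ?w = "\<lambda>z\<in>univ X. opn M F (map (\<lambda>u. u z) vs)"
    have ups: "map up vs \<in> tuples (morphs M S Z) (arity M F)"
      using vs up by (auto simp: tuples_def)
    have "up ?w = opn (dual_E M S Z) F (map up vs)"
      using uX by (auto simp: up_def comp_def restrict_def fun_eq_iff)
    moreover have "\<phi> (opn (dual_E M S Z) F (map up vs)) = opn M F (map \<phi> (map up vs))"
      using \<phi> F ups unfolding alg_hom_def mem_Collect_eq dual_E_simps(1-3) by blast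
    moreover have "map \<phi> (map up vs) = map \<psi> vs"
      using vs by (auto simp: \<psi>_def tuples_def)
    ultimately show "\<psi> ?w = opn M F (map \<psi> vs)"
      using str_hom_opn_closed[OF alg S C(1) dX F vs] by (simp add: \<psi>_def del: map_eq_conv)
  qed
  then obtain x where x: "x \<in> univ X" "\<psi> = epsilon M S X x" using surj by blast
  then obtain z where z: "z \<in> univ Z" "x = b z" using uX by blast
  have "\<phi> u = u z" if u: "u \<in> morphs M S Z" for u
  proof -
    have "up (down u) = u"
    proof (rule extensionalityI)
      show "u \<in> extensional (univ Z)" using u by (simp add: str_hom_def PiE_def)
    qed (use inj uX in \<open>auto simp: up_def down_def\<close>)
    then have "\<phi> u = \<psi> (down u)" using down[OF u] by (simp add: \<psi>_def)
    also have "\<dots> = down u x" using x down[OF u] by (simp add: epsilon_def)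
    also have "\<dots> = u z" using mdown[of "[z]" u] z by simp
    finally show ?thesis .
  qed
  then show ?thesis using z by blast
qed


section \<open>Dualising alter egos define the hom-minimal relations\<close>

lemma rel_hom_proj:
  assumes r: "compat_rel M r" and i: "i < rel_arity r"
  shows "(\<lambda>zs\<in>r. zs ! i) \<in> rel_homs M r"
  unfolding rel_hom_iff
proof (intro conjI ballI)
  show "(\<lambda>zs\<in>r. zs ! i) \<in> r \<rightarrow>\<^sub>E carrier M"
    using compat_rel_nth[OF r _ i] by simp
  fix F zss assume F: "F \<in> fsyms M" and z: "zss \<in> tuples r (arity M F)"
  have "map (\<lambda>x. x ! i) zss = map (\<lambda>zs\<in>r. zs ! i) zss"
    using z by (auto simp: tuples_def)
  then show "(\<lambda>zs\<in>r. zs ! i) (rowwise M F (rel_arity r) zss)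
      = opn M F (map (\<lambda>zs\<in>r. zs ! i) zss)"
    using compat_relD(3)[OF r F z] i by (simp del: map_eq_conv)
qed

lemma finite_compat_rel: "compat_rel M r \<Longrightarrow> finite r"
  by (rule finite_subset[OF compat_relD(2) finite_tuples[OF fin]])

text \<open>Evaluation embeds \<open>A\<close> into the power of \<open>M\<close> indexed by the
  homomorphisms from \<open>A\<close>, an exponent of the type prescribed in
  \<open>ISP\<close>.\<close>

lemma ISP_if_separated:
  fixes A :: "('b, 'f) algebra"
  assumes A: "is_algebra A" "similar A M"
    and sep: "\<And>a b. a \<in> carrier A \<Longrightarrow> b \<in> carrier A \<Longrightarrow>
      (\<And>y. y \<in> alg_hom A M \<Longrightarrow> y a = y b) \<Longrightarrow> a = b"
  shows "ISP M A"
proof -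
  let ?I = "alg_hom A M"
  have fs: "fsyms A = fsyms M" and ar: "\<And>F. F \<in> fsyms M \<Longrightarrow> arity A F = arity M F"
    using A(2) by (auto simp: similar_def)
  define e where "e = (\<lambda>a\<in>carrier A. \<lambda>y\<in>?I. y a)"
  have yc: "y a \<in> carrier M" if "y \<in> ?I" "a \<in> carrier A" for y a
    using that by (auto simp: alg_hom_def dest: PiE_mem)
  have eI: "e a \<in> ?I \<rightarrow>\<^sub>E carrier M" if "a \<in> carrier A" for a
    using yc that by (simp add: e_def)
  have opn: "(\<lambda>y\<in>?I. opn M F (map (\<lambda>x. x y) (map e as))) = e (opn A F as)"
    and opA: "opn A F as \<in> carrier A"
    if F: "F \<in> fsyms M" and as: "as \<in> tuples (carrier A) (arity M F)" for F as
  proof -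
    show o: "opn A F as \<in> carrier A" using A(1) F as fs ar by (simp add: is_algebra_def)
    have "opn M F (map (\<lambda>x. x y) (map e as)) = y (opn A F as)" if y: "y \<in> ?I" for y
    proof -
      have "map (\<lambda>x. x y) (map e as) = map y as" using as y by (auto simp: e_def tuples_def)
      moreover have "y (opn A F as) = opn M F (map y as)"
        using y F as fs ar by (simp add: alg_hom_def)
      ultimately show ?thesis by (simp only:)
    qed
    then show "(\<lambda>y\<in>?I. opn M F (map (\<lambda>x. x y) (map e as))) = e (opn A F as)"
      using o by (auto simp: e_def simp del: map_map)
  qed
  have pull: "\<exists>as. as \<in> tuples (carrier A) n \<and> zs = map e as"
    if zs: "zs \<in> tuples (e ` carrier A) n" for zs n
  proof -
    have "zs \<in> map e ` lists (carrier A)" using zs by (auto simp: tuples_def lists_image[symmetric])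
    then show ?thesis using zs by (auto simp: tuples_def)
  qed
  have "subuniverse (alg_power M ?I) (e ` carrier A)"
    unfolding subuniverse_def
  proof (intro conjI ballI)
    show "e ` carrier A \<noteq> {}" using A(1) by (simp add: is_algebra_def)
    show "e ` carrier A \<subseteq> carrier (alg_power M ?I)"
      unfolding alg_power_def algebra.simps by (intro image_subsetI eI)
    fix F zs assume F: "F \<in> fsyms (alg_power M ?I)"
      and zs: "zs \<in> tuples (e ` carrier A) (arity (alg_power M ?I) F)"
    have F': "F \<in> fsyms M" using F by (simp add: alg_power_def)
    obtain as where as: "as \<in> tuples (carrier A) (arity M F)" "zs = map e as"
      using pull[OF zs] by (auto simp: alg_power_def)
    have "opn (alg_power M ?I) F zs = e (opn A F as)"
      unfolding alg_power_def algebra.simps as(2) by (rule opn[OF F' as(1)])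
    then show "opn (alg_power M ?I) F zs \<in> e ` carrier A" using opA[OF F' as(1)] by simp
  qed
  moreover have "alg_iso e A ((alg_power M ?I)\<lparr>carrier := e ` carrier A\<rparr>)"
    unfolding alg_iso_def alg_hom_def[of A "(alg_power M ?I)\<lparr>carrier := e ` carrier A\<rparr>"]
  proof (intro conjI CollectI ballI)
    show "e \<in> carrier A \<rightarrow>\<^sub>E carrier ((alg_power M ?I)\<lparr>carrier := e ` carrier A\<rparr>)"
      by (auto simp: e_def)
    fix F as assume F: "F \<in> fsyms A" and as: "as \<in> tuples (carrier A) (arity A F)"
    show "e (opn A F as) = opn ((alg_power M ?I)\<lparr>carrier := e ` carrier A\<rparr>) F (map e as)"
      unfolding alg_power_def algebra.simps
      using opn[of F as] F as fs ar by (simp del: map_map)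
  next
    have "inj_on e (carrier A)"
    proof (rule inj_onI)
      fix a b assume ab: "a \<in> carrier A" "b \<in> carrier A" "e a = e b"
      have "y a = y b" if "y \<in> ?I" for y
        using fun_cong[OF ab(3), of y] ab(1,2) that by (simp add: e_def)
      then show "a = b" using sep ab by simp
    qed
    then show "bij_betw e (carrier A) (carrier ((alg_power M ?I)\<lparr>carrier := e ` carrier A\<rparr>))"
      by (simp add: bij_betw_def)
  qed
  ultimately show ?thesis
    unfolding ISP_def using A by blast
qed

text \<open>The dual counterpart of \<open>str_hom_opn_closed\<close>: compatibility of
  \<open>h\<close> makes the operations act within \<open>dual_D M A\<close>.\<close>

lemma alg_hom_op_closed:
  assumes A: "is_algebra A" "similar A M" and h: "compat_op M h"
    and ys: "set ys \<subseteq> alg_hom A M" and dom: "\<And>a. a \<in> carrier A \<Longrightarrow> map (\<lambda>y. y a) ys \<in> dom h"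
  shows "(\<lambda>a\<in>carrier A. the (h (map (\<lambda>y. y a) ys))) \<in> alg_hom A M"
  unfolding alg_hom_def
proof (intro CollectI conjI ballI)
  have "the (h (map (\<lambda>y. y a) ys)) \<in> carrier M" if "a \<in> carrier A" for a
    using dom[OF that] compat_op_ran[OF h] by auto
  then show "(\<lambda>a\<in>carrier A. the (h (map (\<lambda>y. y a) ys))) \<in> carrier A \<rightarrow>\<^sub>E carrier M" by simp
  fix F as assume F: "F \<in> fsyms A" and as: "as \<in> tuples (carrier A) (arity A F)"
  have F': "F \<in> fsyms M" "arity A F = arity M F" using A(2) F by (auto simp: similar_def)
  define zss where "zss = map (\<lambda>a. map (\<lambda>y. y a) ys) as"
  have z: "zss \<in> tuples (dom h) (arity M F)"
    using as dom F' by (auto simp: zss_def tuples_def)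
  obtain a0 where "a0 \<in> carrier A" using A(1) by (auto simp: is_algebra_def)
  then have len: "length ys = op_arity h"
    using dom compat_rel_length[of M "dom h"] h by (fastforce simp: compat_op_iff)
  have oA: "opn A F as \<in> carrier A" using A(1) F as by (simp add: is_algebra_def)
  have "map (\<lambda>y. y (opn A F as)) ys = rowwise M F (op_arity h) zss"
  proof (rule nth_equalityI)
    fix i assume "i < length (map (\<lambda>y. y (opn A F as)) ys)"
    then have i: "i < length ys" by simp
    then have "ys ! i \<in> alg_hom A M" using ys nth_mem by blast
    then have "(ys ! i) (opn A F as) = opn M F (map (ys ! i) as)"
      using F as unfolding alg_hom_def by blast
    moreover have "map (\<lambda>x. x ! i) zss = map (ys ! i) as" using i by (simp add: zss_def)
    ultimately show "map (\<lambda>y. y (opn A F as)) ys ! i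
        = rowwise M F (op_arity h) zss ! i"
      using i len by simp
  qed (simp add: len)
  then have "h (map (\<lambda>y. y (opn A F as)) ys) = Some (opn M F (map (\<lambda>zs. the (h zs)) zss))"
    using compat_op_opn[OF h F'(1) z] by (simp only:)
  moreover have "map (\<lambda>zs. the (h zs)) zss = map (\<lambda>a\<in>carrier A. the (h (map (\<lambda>y. y a) ys))) as"
    using as by (auto simp: zss_def tuples_def)
  ultimately show "(\<lambda>a\<in>carrier A. the (h (map (\<lambda>y. y a) ys))) (opn A F as)
      = opn M F (map (\<lambda>a\<in>carrier A. the (h (map (\<lambda>y. y a) ys))) as)"
    using oA by (simp only: restrict_apply' option.sel)
qed

text \<open>The structure \<open>D(r)\<close> consists of the coordinate projections of \<open>r\<close>, so a tuple \<open>a\<close> that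
  satisfies all atomic formulas true throughout \<open>r\<close> is a morphism \<open>D(r) \<rightarrow> M\<close>, hence an
  evaluation at an element of \<open>r\<close>.\<close>

lemma hom_minimal_memI:
  assumes S: "is_alter_ego M S" and dual: "dualises_fin M S" and r: "hom_minimal M r"
    and a: "a \<in> tuples (carrier M) (rel_arity r)"
    and sat: "\<And>\<alpha>. wf_atom (rel_arity r) \<alpha> \<Longrightarrow> in_lang S \<alpha> \<Longrightarrow>
       pure_prem \<alpha> \<or> (\<exists>i j. \<alpha> = Eq (Var i) (Var j)) \<Longrightarrow>
       (\<And>zs. zs \<in> r \<Longrightarrow> holds (self_struct M) zs \<alpha>) \<Longrightarrow> holds (self_struct M) a \<alpha>"
  shows "a \<in> r"
proof -
  let ?n = "rel_arity r"
  have c: "compat_rel M r" and hm: "\<And>f. f \<in> rel_homs M r \<Longrightarrow> \<exists>i<?n. \<forall>zs\<in>r. f zs = zs ! i"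
    using r by (auto simp: hom_minimal_def)
  \<comment> \<open>Duality at the finite level is stated for algebras on natural numbers, so the
    algebra on \<open>r\<close> is copied there.\<close>
  obtain b :: "'a list \<Rightarrow> nat" where inj: "inj_on b r"
    using finite_imp_inj_to_nat_seg[OF finite_compat_rel[OF c]] by blast
  define c' where "c' = inv_into r b"
  have cb: "c' (b zs) = zs" if "zs \<in> r" for zs using that inj by (simp add: c'_def)
  define A where "A = \<lparr>carrier = b ` r, fsyms = fsyms M, arity = arity M,
    opn = (\<lambda>F ys. b (rowwise M F ?n (map c' ys)))\<rparr>"
  have A_simps: "carrier A = b ` r" "fsyms A = fsyms M" "arity A = arity M"
    "\<And>F ys. opn A F ys = b (rowwise M F ?n (map c' ys))"
    by (simp_all add: A_def)
  have ctup: "map c' ys \<in> tuples r k" if ys: "ys \<in> tuples (b ` r) k" for ys k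
  proof -
    have "c' y \<in> r" if "y \<in> b ` r" for y using that cb by auto
    then show ?thesis using ys by (auto simp: tuples_def)
  qed
  have algA: "is_algebra A"
    unfolding is_algebra_def A_simps
    using compat_relD(1)[OF c] compat_relD(3)[OF c _ ctup] by blast
  have simA: "similar A M" by (simp add: similar_def A_simps)
  have up: "(\<lambda>zs\<in>r. y (b zs)) \<in> rel_homs M r" if y: "y \<in> alg_hom A M" for y
    unfolding rel_hom_iff
  proof (intro conjI ballI)
    have "y (b zs) \<in> carrier M" if "zs \<in> r" for zs
      using y that unfolding alg_hom_def A_simps by (auto dest: PiE_mem)
    then show "(\<lambda>zs\<in>r. y (b zs)) \<in> r \<rightarrow>\<^sub>E carrier M" by simp
    fix F zss assume F: "F \<in> fsyms M" and z: "zss \<in> tuples r (arity M F)"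
    have "map b zss \<in> tuples (b ` r) (arity M F)" using z by (auto simp: tuples_def)
    then have "y (opn A F (map b zss)) = opn M F (map y (map b zss))"
      using y F unfolding alg_hom_def mem_Collect_eq A_simps(1-3) by blast
    moreover have "map c' (map b zss) = zss"
      using z cb by (auto simp: tuples_def subset_iff intro: map_idI)
    moreover have "map y (map b zss) = map (\<lambda>zs\<in>r. y (b zs)) zss"
      using z by (auto simp: tuples_def)
    ultimately show "(\<lambda>zs\<in>r. y (b zs)) (rowwise M F ?n zss)
        = opn M F (map (\<lambda>zs\<in>r. y (b zs)) zss)"
      using compat_relD(3)[OF c F z] unfolding A_simps by (simp only: restrict_apply')
  qed
  have down: "(\<lambda>n\<in>b ` r. f (c' n)) \<in> alg_hom A M" if f: "f \<in> rel_homs M r" for f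
    unfolding alg_hom_def A_simps
  proof (intro CollectI conjI ballI)
    show "(\<lambda>n\<in>b ` r. f (c' n)) \<in> b ` r \<rightarrow>\<^sub>E carrier M"
      using rel_hom_in_carrier[OF f] cb by auto
    fix F ys assume F: "F \<in> fsyms M" and ys: "ys \<in> tuples (b ` r) (arity M F)"
    let ?T = "rowwise M F ?n (map c' ys)"
    have "?T \<in> r" by (rule compat_relD(3)[OF c F ctup[OF ys]])
    moreover have "f ?T = opn M F (map f (map c' ys))"
      using f F ctup[OF ys] unfolding rel_hom_iff by blast
    moreover have "map f (map c' ys) = map (\<lambda>n\<in>b ` r. f (c' n)) ys"
      using ys by (auto simp: tuples_def)
    ultimately show "(\<lambda>n\<in>b ` r. f (c' n)) (b ?T) = opn M F (map (\<lambda>n\<in>b ` r. f (c' n)) ys)"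
      using cb by (simp del: map_map map_eq_conv)
  qed
  \<comment> \<open>By hom-minimality every homomorphism is a coordinate. The index is a choice,
    since coordinates of \<open>r\<close> may coincide.\<close>
  define ix where "ix y = (SOME i. i < ?n \<and> (\<forall>zs\<in>r. y (b zs) = zs ! i))" for y :: "nat \<Rightarrow> 'a"
  have ix: "ix y < ?n" "\<And>zs. zs \<in> r \<Longrightarrow> y (b zs) = zs ! ix y" if y: "y \<in> alg_hom A M" for y
  proof -
    have "\<exists>i<?n. \<forall>zs\<in>r. y (b zs) = zs ! i" using hm[OF up[OF y]] by simp
    then have "ix y < ?n \<and> (\<forall>zs\<in>r. y (b zs) = zs ! ix y)"
      unfolding ix_def by (rule someI_ex)
    then show "ix y < ?n" "\<And>zs. zs \<in> r \<Longrightarrow> y (b zs) = zs ! ix y" by auto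
  qed
  define p where "p i = (\<lambda>n\<in>b ` r. (\<lambda>zs\<in>r. zs ! i) (c' n))" for i
  have p: "p i \<in> alg_hom A M" if "i < ?n" for i
    unfolding p_def by (rule down[OF rel_hom_proj[OF c that]])
  have pb: "p i (b zs) = zs ! i" if "zs \<in> r" for i zs
    using that cb by (simp add: p_def)
  have "ISP M A"
  proof (rule ISP_if_separated[OF algA simA])
    fix m n assume "m \<in> carrier A" "n \<in> carrier A" and eq: "\<And>y. y \<in> alg_hom A M \<Longrightarrow> y m = y n"
    then obtain zs ws where zw: "zs \<in> r" "ws \<in> r" "m = b zs" "n = b ws" unfolding A_simps by blast
    have "zs ! i = ws ! i" if "i < ?n" for i
      using eq[OF p[OF that]] pb zw by simp
    then have "zs = ws" using compat_rel_length[OF c] zw by (intro nth_equalityI) auto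
    then show "m = n" using zw by simp
  qed
  moreover have finA: "finite (carrier A)" using finite_compat_rel[OF c] by (simp add: A_simps)
  ultimately have iso: "alg_iso (eta M A) A (dual_E M S (dual_D M A))"
    using dual unfolding dualises_fin_def by blast
  let ?H = "alg_hom A M" and ?D = "dual_D M A"
  have uD: "univ ?D = ?H" by (simp add: dual_D_def)
  have HP: "?H \<subseteq> carrier A \<rightarrow>\<^sub>E carrier M" by (auto simp: alg_hom_def)
  have finH: "finite ?H" by (rule finite_subset[OF HP finite_PiE[OF finA]]) (rule fin)
  have dD: "topo ?D = discrete_topology (univ ?D)"
    unfolding dual_D_def induced_simps power_struct_simps
    by (rule subtopology_product_discrete(1)[OF finH HP])
  \<comment> \<open>The candidate for the morphism given by \<open>a\<close>: a homomorphism that is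
    the coordinate \<open>ix y\<close> is sent to the entry of \<open>a\<close> at that
    index.\<close>
  define v where "v = (\<lambda>y\<in>?H. a ! ix y)"
  have ixs: "map (\<lambda>y. y (b zs)) ys = map (\<lambda>i. zs ! i) (map ix ys)" if "zs \<in> r" "set ys \<subseteq> ?H" for zs ys
    using that ix(2) by auto
  have vys: "map v ys = map (\<lambda>i. a ! i) (map ix ys)" if "set ys \<subseteq> ?H" for ys
    using that by (auto simp: v_def)
  have ixlt: "list_all (wf_term ?n) (map Var (map ix ys))" if "set ys \<subseteq> ?H" for ys
    using that ix(1) by (auto simp: list_all_iff)
  have "v \<in> morphs M S ?D"
    unfolding str_hom_self_iff[OF dD] uD
  proof (intro conjI ballI allI impI)
    show "v \<in> ?H \<rightarrow>\<^sub>E carrier M"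
      using a ix(1) by (auto simp: v_def tuples_def)
    fix s ys assume s: "s \<in> rels S" and ys: "ys \<in> relI ?D s"
    have ysH: "set ys \<subseteq> ?H" and row: "\<And>zs. zs \<in> r \<Longrightarrow> map (\<lambda>y. y (b zs)) ys \<in> s"
      using ys by (auto simp: dual_D_def lists_eq_set A_simps)
    obtain zs0 where "zs0 \<in> r" using compat_relD(1)[OF c] by blast
    then have len: "length ys = rel_arity s"
      using row compat_rel_length[OF is_alter_egoD(1)[OF S s]] by fastforce
    have "holds (self_struct M) a (Rel s (map Var (map ix ys)))"
    proof (rule sat)
      show "wf_atom ?n (Rel s (map Var (map ix ys)))" using len ixlt[OF ysH] by simp
      show "in_lang S (Rel s (map Var (map ix ys)))" using s by (auto simp: in_lang_def)
      show "pure_prem (Rel s (map Var (map ix ys))) \<or> (\<exists>i j. Rel s (map Var (map ix ys)) = Eq (Var i) (Var j))"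
        unfolding pure_prem_def by blast
      fix zs assume "zs \<in> r"
      then show "holds (self_struct M) zs (Rel s (map Var (map ix ys)))"
        unfolding holds_pure_simps self_struct_simps using row ixs ysH by metis
    qed
    then show "map v ys \<in> s" unfolding holds_pure_simps self_struct_simps vys[OF ysH] .
  next
    fix h ys z assume h: "h \<in> ops S" and ys: "opI ?D h ys = Some z"
    have ysH: "set ys \<subseteq> ?H" and dom: "\<And>zs. zs \<in> r \<Longrightarrow> map (\<lambda>y. y (b zs)) ys \<in> dom h"
      and z: "z = (\<lambda>n\<in>b ` r. the (h (map (\<lambda>y. y n) ys)))"
      using ys by (auto simp: dual_D_def lists_eq_set A_simps restrict_map_def split: if_splits)
    note hc = is_alter_egoD(2,3)[OF S h]
    obtain zs0 where "zs0 \<in> r" using compat_relD(1)[OF c] by blast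
    then have len: "length ys = op_arity h"
      using dom compat_rel_length[OF hc(2)] by fastforce
    have dom': "map (\<lambda>i. zs ! i) (map ix ys) \<in> dom h" if "zs \<in> r" for zs
      using dom[OF that] ixs[OF that ysH] by simp
    have "map (\<lambda>y. y n) ys \<in> dom h" if "n \<in> carrier A" for n
      using dom that by (auto simp: A_simps)
    from alg_hom_op_closed[OF algA simA hc(1) ysH this]
    have zH: "z \<in> ?H" unfolding z A_simps .
    have "holds (self_struct M) a (Eq (App h (map Var (map ix ys))) (Var (ix z)))"
    proof (rule sat)
      show "wf_atom ?n (Eq (App h (map Var (map ix ys))) (Var (ix z)))"
        using len ixlt[OF ysH] ix(1)[OF zH] by simp
      show "in_lang S (Eq (App h (map Var (map ix ys))) (Var (ix z)))"
        using h by (auto simp: in_lang_def)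
      show "pure_prem (Eq (App h (map Var (map ix ys))) (Var (ix z))) \<or>
         (\<exists>i j. Eq (App h (map Var (map ix ys))) (Var (ix z)) = Eq (Var i) (Var j))"
        unfolding pure_prem_def by blast
      fix zs assume zs: "zs \<in> r"
      have "h (map (\<lambda>i. zs ! i) (map ix ys)) = Some (z (b zs))"
      proof -
        have "z (b zs) = the (h (map (\<lambda>i. zs ! i) (map ix ys)))"
          unfolding z restrict_apply'[OF imageI[OF zs]] ixs[OF zs ysH] ..
        then show ?thesis using dom'[OF zs] by (auto simp del: map_map)
      qed
      then show "holds (self_struct M) zs (Eq (App h (map Var (map ix ys))) (Var (ix z)))"
        unfolding holds_pure_simps self_struct_simps ix(2)[OF zH zs] .
    qed
    then show "h (map v ys) = Some (v z)"
      unfolding holds_pure_simps self_struct_simps vys[OF ysH] using zH by (simp add: v_def)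
  qed
  then have "v \<in> eta M A ` carrier A"
    using iso by (simp add: alg_iso_def bij_betw_def)
  then obtain zs where zs: "zs \<in> r" "v = eta M A (b zs)" unfolding A_simps by blast
  have "a ! i = zs ! i" if i: "i < ?n" for i
  proof -
    \<comment> \<open>The index chosen for the \<open>i\<close>-th projection may differ from
      \<open>i\<close> when two coordinates agree on \<open>r\<close>. The equation between the two
      variables then holds throughout \<open>r\<close> and hence at \<open>a\<close>.\<close>
    have "holds (self_struct M) a (Eq (Var i) (Var (ix (p i))))"
    proof (rule sat)
      show "wf_atom ?n (Eq (Var i) (Var (ix (p i))))" using i ix(1)[OF p[OF i]] by simp
      show "holds (self_struct M) ws (Eq (Var i) (Var (ix (p i))))" if "ws \<in> r" for ws
        unfolding holds_pure_simps using ix(2)[OF p[OF i] that] pb[OF that] by simp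
    qed (auto simp: in_lang_def)
    then have "a ! i = v (p i)" unfolding holds_pure_simps using p[OF i] by (simp add: v_def)
    also have "\<dots> = zs ! i" using zs p[OF i] pb[OF zs(1)] by (simp add: eta_def A_simps)
    finally show ?thesis .
  qed
  then have "a = zs" using a compat_rel_length[OF c zs(1)] by (intro nth_equalityI) (auto simp: tuples_def)
  then show ?thesis using zs by simp
qed

text \<open>By \<open>hom_minimal_memI\<close> the atomic formulas true throughout \<open>r\<close>
  confine a tuple to \<open>r\<close>; finiteness of \<open>M\<close> leaves finitely many of
  them.\<close>

lemma hom_minimal_Rel_ca:
  assumes S: "is_alter_ego M S" and dual: "dualises_fin M S" and r: "hom_minimal M r"
  shows "r \<in> Rel_ca M S"
proof -
  let ?n = "rel_arity r"
  have c: "compat_rel M r" using r by (simp add: hom_minimal_def)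
  define \<Delta> where "\<Delta> = {\<alpha>. wf_atom ?n \<alpha> \<and> in_lang S \<alpha> \<and> (\<forall>zs\<in>r. holds (self_struct M) zs \<alpha>)}"
  obtain \<Delta>' where \<Delta>': "\<Delta>' \<subseteq> \<Delta>" "finite \<Delta>'"
    "{a \<in> tuples (carrier M) ?n. \<forall>\<alpha>\<in>\<Delta>'. holds (self_struct M) a \<alpha>}
      = {a \<in> tuples (carrier M) ?n. \<forall>\<alpha>\<in>\<Delta>. holds (self_struct M) a \<alpha>}"
    using finite_subset_same_filter[OF finite_tuples[OF fin, of ?n], of \<Delta>
        "\<lambda>a \<alpha>. holds (self_struct M) a \<alpha>"]
    by metis
  obtain \<alpha>s where \<alpha>s: "set \<alpha>s = \<Delta>'" using finite_list[OF \<Delta>'(2)] by blast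
  have "{a \<in> tuples (carrier M) ?n. \<forall>\<alpha>\<in>\<Delta>. holds (self_struct M) a \<alpha>} = r"
  proof (intro equalityI subsetI)
    fix a assume "a \<in> {a \<in> tuples (carrier M) ?n. \<forall>\<alpha>\<in>\<Delta>. holds (self_struct M) a \<alpha>}"
    then show "a \<in> r" by (intro hom_minimal_memI[OF S dual r]) (auto simp: \<Delta>_def)
  next
    fix a assume "a \<in> r"
    then show "a \<in> {a \<in> tuples (carrier M) ?n. \<forall>\<alpha>\<in>\<Delta>. holds (self_struct M) a \<alpha>}"
      using compat_relD(2)[OF c] by (auto simp: \<Delta>_def)
  qed
  then have "r = defined_rel (self_struct M) ?n \<alpha>s"
    unfolding defined_rel_def \<alpha>s self_struct_simps \<Delta>'(3) by simp
  moreover have "ca_formula S ?n \<alpha>s"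
    using \<Delta>'(1) \<alpha>s by (auto simp: ca_formula_def \<Delta>_def)
  ultimately show ?thesis using compat_relD(1)[OF c] unfolding Rel_ca_def by blast
qed

end

section \<open>Full duality and operational richness\<close>

text \<open>The substructure of \<open>M^r\<close> generated by the projections, presented by clone
  operations defined on all of \<open>r\<close>. Elements are extensional, so that agreement on
  \<open>r\<close> is equality.\<close>

definition clo_fun :: "('a, 'f) algebra \<Rightarrow> 'a alter_ego \<Rightarrow> 'a frel \<Rightarrow> ('a list \<Rightarrow> 'a) set" where
  "clo_fun M S r = {x \<in> r \<rightarrow>\<^sub>E carrier M.
     \<exists>g\<in>Clo_ep M S. op_arity g = rel_arity r \<and> (\<forall>zs\<in>r. g zs = Some (x zs))}"

definition proj_on :: "'a frel \<Rightarrow> nat \<Rightarrow> 'a list \<Rightarrow> 'a" where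
  "proj_on r i = (\<lambda>zs\<in>r. zs ! i)"

definition projs :: "'a frel \<Rightarrow> ('a list \<Rightarrow> 'a) list" where
  "projs r = map (proj_on r) [0..<rel_arity r]"

definition on_rel :: "'a frel \<Rightarrow> ('a list \<Rightarrow> 'a) \<Rightarrow> ('a list \<Rightarrow> 'a) list \<Rightarrow> 'a list \<Rightarrow> 'a" where
  "on_rel r f xs = (\<lambda>zs\<in>r. f (map (\<lambda>x. x zs) xs))"

lemma Clo_ep_mono:
  assumes "ops S \<subseteq> ops T"
  shows "g \<in> Clo_ep M S \<Longrightarrow> g \<in> Clo_ep M T"
proof (induction rule: Clo_ep.induct)
  case (base h)
  then show ?case using assms by (intro Clo_ep.base) blast
next
  case (proj i n)
  then show ?case by (rule Clo_ep.proj)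
next
  case (comp g hs k)
  then show ?case by (intro Clo_ep.comp) auto
qed

lemma has_extension_mono: "ops S \<subseteq> ops T \<Longrightarrow> has_extension M S h \<Longrightarrow> has_extension M T h"
  using Clo_ep_mono unfolding has_extension_def by blast

lemma Rel_ca_mono:
  assumes "ops S \<subseteq> ops T" "rels S \<subseteq> rels T"
  shows "Rel_ca M S \<subseteq> Rel_ca M T"
proof -
  have "in_lang S \<alpha> \<Longrightarrow> in_lang T \<alpha>" for \<alpha>
    using assms by (auto simp: in_lang_def)
  then have "ca_formula S n \<alpha>s \<Longrightarrow> ca_formula T n \<alpha>s" for n \<alpha>s
    by (auto simp: ca_formula_def)
  then show ?thesis unfolding Rel_ca_def by blast
qed

context fin_alg
begin

lemma Clo_ep_ran:
  assumes "is_alter_ego M S"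
  shows "g \<in> Clo_ep M S \<Longrightarrow> g xs = Some y \<Longrightarrow> y \<in> carrier M"
proof (induction arbitrary: xs y rule: Clo_ep.induct)
  case (base h)
  then show ?case using compat_op_ran[OF is_alter_egoD(2)[OF assms]] by simp
next
  case (proj i n)
  then show ?case by (auto simp: projection_def tuples_def split: if_splits)
next
  case (comp g hs k)
  then obtain ys where "g ys = Some y"
    by (auto simp: compose_def bind_eq_Some_conv split: if_splits)
  then show ?case by (rule comp.IH(1))
qed

lemma proj_on_clo_fun:
  assumes r: "compat_rel M r" and i: "i < rel_arity r"
  shows "proj_on r i \<in> clo_fun M S r"
proof -
  let ?n = "rel_arity r"
  obtain zs where zs: "zs \<in> r" using compat_relD(1)[OF r] by blast
  note rt = compat_relD(2)[OF r]
  have "dom (projection M ?n i) = tuples (carrier M) ?n"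
    by (auto simp: projection_def split: if_splits)
  then have "op_arity (projection M ?n i) = ?n"
    using zs rt by (intro rel_arity_eqI[of zs _ "carrier M"]) auto
  moreover have "\<forall>zs\<in>r. projection M ?n i zs = Some (proj_on r i zs)"
    using rt by (auto simp: projection_def proj_on_def)
  moreover have "proj_on r i \<in> r \<rightarrow>\<^sub>E carrier M"
    using compat_rel_nth[OF r _ i] by (simp add: proj_on_def)
  ultimately show ?thesis using Clo_ep.proj[OF i, of M S] unfolding clo_fun_def by blast
qed

lemma clo_fun_subset: "clo_fun M S r \<subseteq> r \<rightarrow>\<^sub>E carrier M"
  by (auto simp: clo_fun_def)

lemma finite_clo_fun:
  assumes "compat_rel M r" shows "finite (clo_fun M S r)"
  by (rule finite_subset[OF clo_fun_subset finite_PiE]) (use assms finite_compat_rel fin in auto)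

text \<open>For each entry of \<open>xs\<close> a clone operation restricting to it is chosen, and
  these are composed with \<open>g\<close>. The composite is not empty, as the closure rule demands,
  because it is defined on the nonempty set \<open>r\<close>.\<close>

lemma clo_fun_Clo_ep:
  assumes S: "is_alter_ego M S" and r: "compat_rel M r" and g: "g \<in> Clo_ep M S"
    and xs: "xs \<in> tuples (clo_fun M S r) (op_arity g)"
    and dom: "\<And>zs. zs \<in> r \<Longrightarrow> map (\<lambda>x. x zs) xs \<in> dom g"
  shows "on_rel r (\<lambda>zs. the (g zs)) xs \<in> clo_fun M S r"
proof -
  let ?n = "rel_arity r"
  obtain zs0 where zs0: "zs0 \<in> r" using compat_relD(1)[OF r] by blast
  note rt = compat_relD(2)[OF r]
  have "\<forall>x\<in>set xs. \<exists>h. h \<in> Clo_ep M S \<and> op_arity h = ?n \<and> (\<forall>zs\<in>r. h zs = Some (x zs))"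
    using xs by (auto simp: tuples_def clo_fun_def)
  then obtain H where H: "\<And>x. x \<in> set xs \<Longrightarrow> H x \<in> Clo_ep M S \<and> op_arity (H x) = ?n
       \<and> (\<forall>zs\<in>r. H x zs = Some (x zs))"
    by metis
  define c where "c = compose M ?n g (map H xs)"
  have ctup: "dom c \<subseteq> tuples (carrier M) ?n"
    by (auto simp: c_def compose_def split: if_splits)
  have cval: "c zs = g (map (\<lambda>x. x zs) xs)" if zs: "zs \<in> r" for zs
  proof -
    have "map (\<lambda>h. h zs) (map H xs) = map Some (map (\<lambda>x. x zs) xs)"
      using H zs by simp
    then have "those (map (\<lambda>h. h zs) (map H xs)) = Some (map (\<lambda>x. x zs) xs)"
      by (simp only: those_eq_Some_iff)
    moreover have "zs \<in> tuples (carrier M) ?n" using zs rt by blast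
    ultimately show ?thesis unfolding c_def compose_def by (simp del: map_map)
  qed
  have c0: "zs0 \<in> dom c" using cval[OF zs0] dom[OF zs0] by (simp add: domIff)
  then have "op_arity c = ?n" by (rule rel_arity_eqI[OF _ ctup])
  moreover have "c \<noteq> Map.empty" using c0 by auto
  then have "c \<in> Clo_ep M S"
    unfolding c_def using g H xs by (intro Clo_ep.comp) (auto simp: tuples_def)
  moreover have val: "\<forall>zs\<in>r. c zs = Some (on_rel r (\<lambda>zs. the (g zs)) xs zs)"
  proof
    fix zs assume zs: "zs \<in> r"
    obtain y where "g (map (\<lambda>x. x zs) xs) = Some y" using dom[OF zs] by blast
    then show "c zs = Some (on_rel r (\<lambda>zs. the (g zs)) xs zs)"
      using cval[OF zs] zs by (simp add: on_rel_def)
  qed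
  moreover have "on_rel r (\<lambda>zs. the (g zs)) xs \<in> r \<rightarrow>\<^sub>E carrier M"
  proof -
    have "on_rel r (\<lambda>zs. the (g zs)) xs zs \<in> carrier M" if "zs \<in> r" for zs
      using Clo_ep_ran[OF S \<open>c \<in> Clo_ep M S\<close>] val that by blast
    then show ?thesis unfolding on_rel_def by simp
  qed
  ultimately show ?thesis unfolding clo_fun_def by blast
qed

lemma clo_fun_has_extension:
  assumes S: "is_alter_ego M S" and r: "compat_rel M r" and h: "has_extension M S h"
    and xs: "xs \<in> tuples (clo_fun M S r) (op_arity h)" and hc: "compat_rel M (dom h)"
    and dom: "\<And>zs. zs \<in> r \<Longrightarrow> map (\<lambda>x. x zs) xs \<in> dom h"
  shows "on_rel r (\<lambda>zs. the (h zs)) xs \<in> clo_fun M S r"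
proof -
  obtain g where g: "g \<in> Clo_ep M S" "h \<subseteq>\<^sub>m g" using h by (auto simp: has_extension_def)
  have eq: "g (map (\<lambda>x. x zs) xs) = h (map (\<lambda>x. x zs) xs)" if "zs \<in> r" for zs
    using g(2) dom[OF that] unfolding map_le_def by metis
  have "dom h \<subseteq> dom g" using g(2) by (rule map_le_implies_dom_le)
  obtain zs0 where zs0: "zs0 \<in> r" using compat_relD(1)[OF r] by blast
  \<comment> \<open>\<open>op_arity\<close> is read off an arbitrary member of the domain. The
    domain of a clone operation consists of tuples of one length, so the arity of the extension
    \<open>g\<close> is the length of \<open>xs\<close>.\<close>
  have gt: "dom g' \<subseteq> tuples (carrier M) (op_arity g')" if "g' \<in> Clo_ep M S" for g'
    using that
  proof induction
    case (base h)
    show ?case by (rule compat_relD(2)[OF is_alter_egoD(3)[OF S base]])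
  next
    case (proj i n)
    have "dom (projection M n i) = tuples (carrier M) n"
      by (auto simp: projection_def split: if_splits)
    moreover obtain x where "x \<in> carrier M" using carrier_ne by blast
    then have "replicate n x \<in> tuples (carrier M) n" by (auto simp: tuples_def)
    ultimately show ?case using rel_arity_eqI[of "replicate n x" "tuples (carrier M) n" "carrier M" n]
      by simp
  next
    case (comp g hs k)
    have "dom (compose M k g hs) \<subseteq> tuples (carrier M) k"
      by (auto simp: compose_def split: if_splits)
    moreover obtain zs where "zs \<in> dom (compose M k g hs)"
      using comp.hyps by (metis all_not_in_conv dom_eq_empty_conv)
    ultimately show ?case using rel_arity_eqI by metis
  qed
  have "length xs = op_arity g"
  proof -
    have "map (\<lambda>x. x zs0) xs \<in> dom g" using dom[OF zs0] \<open>dom h \<subseteq> dom g\<close> by blast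
    then show ?thesis using gt[OF g(1)] by (auto simp: tuples_def)
  qed
  then have "on_rel r (\<lambda>zs. the (g zs)) xs \<in> clo_fun M S r"
    using xs dom \<open>dom h \<subseteq> dom g\<close>
    by (intro clo_fun_Clo_ep[OF S r g(1)]) (auto simp: tuples_def)
  moreover have "on_rel r (\<lambda>zs. the (g zs)) xs = on_rel r (\<lambda>zs. the (h zs)) xs"
    unfolding on_rel_def using eq by (intro restrict_ext) simp
  ultimately show ?thesis by simp
qed

lemma projs_simps:
  "length (projs r) = rel_arity r"
  "zs \<in> r \<Longrightarrow> compat_rel M r \<Longrightarrow> map (\<lambda>x. x zs) (projs r) = zs"
proof -
  show "length (projs r) = rel_arity r" by (simp add: projs_def)
  show "map (\<lambda>x. x zs) (projs r) = zs" if "zs \<in> r" "compat_rel M r"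
    using compat_rel_length[OF that(2,1)] that(1)
    by (intro nth_equalityI) (auto simp: projs_def proj_on_def)
qed

lemma set_projs: "compat_rel M r \<Longrightarrow> set (projs r) \<subseteq> clo_fun M S r"
  using proj_on_clo_fun by (auto simp: projs_def)

text \<open>The core of both richness arguments: under a full duality the homomorphism
  \<open>u \<mapsto> h(u(\<pi>\<^sub>0), \<dots>, u(\<pi>\<^bsub>n-1\<^esub>))\<close> is evaluation at an element of \<open>Z\<close>, and that element restricts
  an operation in the clone and agrees with \<open>h\<close>.\<close>

lemma has_extension_if_fully_dual:
  fixes Z :: "('a list \<Rightarrow> 'a, 'a) tstruct"
  assumes S: "is_alter_ego M S" and full: "fully_dualises_fin M S"
    and Z: "separated M S Z" and uZ: "univ Z = clo_fun M T r"
    and h: "compat_op M h" and r: "dom h = r"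
    and ev: "\<And>zs. zs \<in> r \<Longrightarrow> (\<lambda>x\<in>univ Z. x zs) \<in> morphs M S Z"
    and pr: "\<And>u. u \<in> morphs M S Z \<Longrightarrow> map u (projs r) \<in> r"
  shows "has_extension M T h"
proof -
  let ?H = "morphs M S Z"
  have rc: "compat_rel M r" using h r by (simp add: compat_op_iff)
  have Z1: "is_struct S Z" and dZ: "topo Z = discrete_topology (univ Z)"
    using Z by (auto simp: separated_def)
  have finZ: "finite (univ Z)" unfolding uZ by (rule finite_clo_fun[OF rc])
  define \<phi> where "\<phi> = (\<lambda>u\<in>?H. the (h (map u (projs r))))"
  have pZ: "set (projs r) \<subseteq> univ Z" unfolding uZ by (rule set_projs[OF rc])
  have "\<phi> \<in> alg_hom (dual_E M S Z) M"
    unfolding alg_hom_def dual_E_simps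
  proof (intro CollectI conjI ballI)
    have "the (h (map u (projs r))) \<in> carrier M" if "u \<in> ?H" for u
      using pr[OF that] compat_op_ran[OF h] r by auto
    then show "\<phi> \<in> ?H \<rightarrow>\<^sub>E carrier M" by (simp add: \<phi>_def)
    fix F us assume F: "F \<in> fsyms M" and us: "us \<in> tuples ?H (arity M F)"
    let ?w = "\<lambda>z\<in>univ Z. opn M F (map (\<lambda>u. u z) us)"
    define zss where "zss = map (\<lambda>u. map u (projs r)) us"
    have zt: "zss \<in> tuples (dom h) (arity M F)"
      using us pr r by (auto simp: zss_def tuples_def)
    have "map ?w (projs r) = rowwise M F (op_arity h) zss"
      unfolding r
    proof (rule nth_equalityI)
      show "length (map ?w (projs r)) = length (rowwise M F (rel_arity r) zss)"
        by (simp add: projs_simps)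
      fix i assume "i < length (map ?w (projs r))"
      then have i: "i < length (projs r)" by simp
      then have "projs r ! i \<in> univ Z" using pZ nth_mem by blast
      then show "map ?w (projs r) ! i = rowwise M F (rel_arity r) zss ! i"
        using i by (simp add: zss_def comp_def projs_simps)
    qed
    then have "h (map ?w (projs r)) = Some (opn M F (map (\<lambda>zs. the (h zs)) zss))"
      using compat_op_opn[OF h F zt] by (simp only:)
    moreover have "map (\<lambda>zs. the (h zs)) zss = map \<phi> us"
      using us by (auto simp: zss_def \<phi>_def tuples_def)
    moreover have "?w \<in> ?H" by (rule str_hom_opn_closed[OF alg S Z1 dZ F us])
    ultimately show "\<phi> ?w = opn M F (map \<phi> us)"
      unfolding \<phi>_def[THEN fun_cong, of ?w] by (simp only: restrict_apply' option.sel)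
  qed
  then obtain z where z: "z \<in> univ Z" "\<And>u. u \<in> ?H \<Longrightarrow> \<phi> u = u z"
    using fully_dualises_surj[OF S full Z finZ] by blast
  \<comment> \<open>Evaluation at \<open>zs\<close> sends the tuple of projections to
    \<open>zs\<close> itself, so \<open>\<phi>\<close> takes the value of \<open>h\<close> at
    \<open>zs\<close> there; as \<open>\<phi>\<close> is evaluation at \<open>z\<close>, this value
    is \<open>z zs\<close>.\<close>
  have "h zs = Some (z zs)" if zs: "zs \<in> r" for zs
  proof -
    have "map (\<lambda>x\<in>univ Z. x zs) (projs r) = map (\<lambda>x. x zs) (projs r)"
      using pZ by auto
    then have "the (h zs) = z zs"
      using z(2)[OF ev[OF zs]] ev[OF zs] z(1) projs_simps(2)[OF zs rc] by (simp add: \<phi>_def del: map_eq_conv)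
    then show ?thesis using zs r by auto
  qed
  moreover obtain g where "g \<in> Clo_ep M T" "\<forall>zs\<in>r. g zs = Some (z zs)"
    using z(1) unfolding uZ clo_fun_def by blast
  ultimately have "g \<in> Clo_ep M T" "h \<subseteq>\<^sub>m g" using r by (auto simp: map_le_def)
  then show ?thesis unfolding has_extension_def by blast
qed

text \<open>Here the clone functions form an induced substructure \<open>Z\<close> of a power, since
  the clone is that of \<open>S\<close> itself. The formula defining \<open>r\<close> is true of the
  projections in each coordinate, hence in \<open>Z\<close>, and morphisms preserve it; so
  \<open>h\<close> can be applied to the values of a morphism at the projections.\<close>

lemma fully_dualises_rich:
  assumes S: "is_alter_ego M S" and full: "fully_dualises_fin M S"
    and h: "compat_op M h" and r: "dom h \<in> Rel_ca M S"
  shows "has_extension M S h"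
proof -
  define r where "r = dom h"
  have rc: "compat_rel M r" using h by (simp add: r_def compat_op_iff)
  define X where "X = clo_fun M S r"
  have XP: "X \<subseteq> r \<rightarrow>\<^sub>E carrier M" unfolding X_def by (rule clo_fun_subset)
  have finX: "finite X" unfolding X_def by (rule finite_clo_fun[OF rc])
  define Z where "Z = induced (power_struct M r) X"
  have uZ: "univ Z = X" by (simp add: Z_def)
  have dZ: "topo Z = discrete_topology (univ Z)"
    unfolding uZ unfolding Z_def induced_simps power_struct_simps
    by (rule subtopology_product_discrete(1)[OF finX XP])
  have listsP: "lists X \<subseteq> lists (r \<rightarrow>\<^sub>E carrier M)" using XP by (rule lists_mono)
  have relZ: "xs \<in> relI Z s \<longleftrightarrow> set xs \<subseteq> X \<and> (\<forall>zs\<in>r. map (\<lambda>x. x zs) xs \<in> s)" for s xs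
    using listsP unfolding Z_def induced_simps power_struct_simps by (auto simp: lists_eq_set)
  have opZ: "opI Z k xs = (if set xs \<subseteq> X \<and> (\<forall>zs\<in>r. map (\<lambda>x. x zs) xs \<in> dom k)
      then Some (on_rel r (\<lambda>zs. the (k zs)) xs) else None)" for k xs
  proof (cases "xs \<in> lists X")
    case True
    then have "xs \<in> lists (r \<rightarrow>\<^sub>E carrier M)" using listsP by blast
    then show ?thesis using True
      unfolding Z_def induced_simps power_struct_simps on_rel_def
      by (auto simp: lists_eq_set restrict_map_def)
  next
    case False
    then show ?thesis
      unfolding Z_def induced_simps by (auto simp: lists_eq_set restrict_map_def)
  qed
  obtain zs0 where zs0: "zs0 \<in> r" using compat_relD(1)[OF rc] by blast
  have closed: "on_rel r (\<lambda>zs. the (k zs)) xs \<in> X" and len: "length xs = op_arity k"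
    if k: "k \<in> ops S" "set xs \<subseteq> X" "\<forall>zs\<in>r. map (\<lambda>x. x zs) xs \<in> dom k" for k xs
  proof -
    show l: "length xs = op_arity k"
      using compat_rel_length[OF is_alter_egoD(3)[OF S k(1)]] k(3) zs0 by fastforce
    show "on_rel r (\<lambda>zs. the (k zs)) xs \<in> X"
      unfolding X_def using k l
      by (intro clo_fun_Clo_ep[OF S rc Clo_ep.base]) (auto simp: tuples_def X_def)
  qed
  have Z1: "is_struct S Z"
    unfolding is_struct_def
  proof (intro conjI ballI)
    fix k assume k: "k \<in> ops S"
    show "dom (opI Z k) \<subseteq> tuples (univ Z) (op_arity k)"
      using len[OF k] uZ by (auto simp: opZ tuples_def split: if_splits)
    show "ran (opI Z k) \<subseteq> univ Z"
      using closed[OF k] uZ by (auto simp: opZ ran_def split: if_splits)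
  next
    fix s assume s: "s \<in> rels S"
    show "relI Z s \<subseteq> tuples (univ Z) (rel_arity s)"
    proof
      fix xs assume "xs \<in> relI Z s"
      then show "xs \<in> tuples (univ Z) (rel_arity s)"
        using compat_rel_length[OF is_alter_egoD(1)[OF S s]] zs0 uZ
        by (fastforce simp: relZ tuples_def)
    qed
  qed
  define ev where "ev zs = (\<lambda>x\<in>univ Z. x zs)" for zs
  have mev: "map (ev zs) xs = map (\<lambda>x. x zs) xs" if "set xs \<subseteq> X" for zs xs
    using that uZ by (auto simp: ev_def)
  have ev: "ev zs \<in> morphs M S Z" if zs: "zs \<in> r" for zs
    unfolding str_hom_self_iff[OF dZ]
  proof (intro conjI ballI allI impI)
    have "x zs \<in> carrier M" if "x \<in> X" for x using XP that zs by (auto dest: PiE_mem)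
    then show "ev zs \<in> univ Z \<rightarrow>\<^sub>E carrier M" by (simp add: ev_def uZ)
    show "map (ev zs) xs \<in> s" if "xs \<in> relI Z s" for s xs
      using that mev zs by (auto simp: relZ simp del: map_eq_conv)
    fix k xs y assume k: "k \<in> ops S" "opI Z k xs = Some y"
    have s: "set xs \<subseteq> X" "\<forall>zs\<in>r. map (\<lambda>x. x zs) xs \<in> dom k"
      and y: "y = on_rel r (\<lambda>zs. the (k zs)) xs"
      using k(2) by (auto simp: opZ split: if_splits)
    have "y \<in> univ Z" using closed[OF k(1) s] y uZ by simp
    then have "ev zs y = the (k (map (\<lambda>x. x zs) xs))" using zs by (simp add: ev_def y on_rel_def)
    then show "k (map (ev zs) xs) = Some (ev zs y)"
      unfolding mev[OF s(1)] using bspec[OF s(2) zs] by auto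
  qed
  have sep: "separated M S Z"
    unfolding separated_def
  proof (intro conjI ballI impI)
    show "is_struct S Z" "topo Z = discrete_topology (univ Z)" by (fact Z1, fact dZ)
    show "morphs M S Z \<noteq> {}" using ev[OF zs0] by blast
    fix x y assume x: "x \<in> univ Z" and y: "y \<in> univ Z"
      and eq: "\<forall>u\<in>morphs M S Z. u x = u y"
    show "x = y"
    proof (rule PiE_ext)
      show "x \<in> r \<rightarrow>\<^sub>E carrier M" "y \<in> r \<rightarrow>\<^sub>E carrier M" using x y XP uZ by blast+
      fix zs assume "zs \<in> r"
      then show "x zs = y zs" using bspec[OF eq ev] x y by (simp add: ev_def)
    qed
  next
    fix s xs assume "xs \<in> tuples (univ Z) (rel_arity s)"
      and m: "\<forall>u\<in>morphs M S Z. map u xs \<in> s"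
    then have xs: "set xs \<subseteq> X" using uZ by (simp add: tuples_def)
    then show "xs \<in> relI Z s" unfolding relZ using bspec[OF m ev] mev[OF xs] by metis
  next
    fix k xs assume "xs \<in> tuples (univ Z) (op_arity k)"
      and m: "\<forall>u\<in>morphs M S Z. map u xs \<in> dom k"
    then have xs: "set xs \<subseteq> X" using uZ by (simp add: tuples_def)
    have "\<forall>zs\<in>r. map (\<lambda>x. x zs) xs \<in> dom k" using bspec[OF m ev] mev[OF xs] by metis
    then show "xs \<in> dom (opI Z k)" using xs by (simp add: opZ domIff)
  qed
  have full_on: "full_on M S r Z"
    unfolding full_on_def
  proof (intro conjI ballI impI)
    show "univ Z \<subseteq> r \<rightarrow>\<^sub>E carrier M" using XP uZ by simp
    fix k xs assume k: "k \<in> ops S" and "xs \<in> tuples (univ Z) (op_arity k)"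
      and d: "\<forall>i\<in>r. map (\<lambda>x. x i) xs \<in> dom k"
    then have xs: "set xs \<subseteq> X" using uZ by (simp add: tuples_def)
    show "opI Z k xs = Some (\<lambda>i\<in>r. the (k (map (\<lambda>x. x i) xs)))"
      using xs d by (simp add: opZ on_rel_def)
    show "(\<lambda>i\<in>r. the (k (map (\<lambda>x. x i) xs))) \<in> univ Z"
      using closed[OF k xs d] by (simp add: uZ on_rel_def)
  next
    fix s xs assume "xs \<in> tuples (univ Z) (rel_arity s)" "\<forall>i\<in>r. map (\<lambda>x. x i) xs \<in> s"
    then show "xs \<in> relI Z s" using uZ by (simp add: relZ tuples_def)
  qed
  obtain \<alpha>s where ca: "ca_formula S (rel_arity r) \<alpha>s"
    and rd: "r = defined_rel (self_struct M) (rel_arity r) \<alpha>s"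
    using Rel_caE r unfolding r_def by blast
  have pX: "set (projs r) \<subseteq> univ Z" unfolding uZ X_def by (rule set_projs[OF rc])
  have pr: "map u (projs r) \<in> r" if u: "u \<in> morphs M S Z" for u
  proof -
    have "holds (self_struct M) (map u (projs r)) \<alpha>" if \<alpha>: "\<alpha> \<in> set \<alpha>s" for \<alpha>
    proof -
      have wf: "wf_atom (length (projs r)) \<alpha>" "in_lang S \<alpha>"
        using ca \<alpha> by (auto simp: ca_formula_def projs_simps)
      have "holds Z (projs r) \<alpha>"
      proof (rule full_on_holds[OF full_on pX wf])
        fix zs assume "zs \<in> r"
        then show "holds (self_struct M) (map (\<lambda>x. x zs) (projs r)) \<alpha>"
          unfolding projs_simps(2)[OF \<open>zs \<in> r\<close> rc] using \<alpha> rd by (auto simp: defined_rel_def)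
      qed
      then show ?thesis using preserves_holds[OF str_hom_preserves[OF u]] wf by blast
    qed
    moreover have "map u (projs r) \<in> tuples (carrier M) (rel_arity r)"
      using str_hom_in_carrier[OF u] pX by (auto simp: tuples_def projs_simps)
    ultimately show ?thesis by (subst rd) (simp add: defined_rel_def)
  qed
  show ?thesis
    using has_extension_if_fully_dual[OF S full sep _ h, of S r] ev pr
    unfolding ev_def uZ X_def r_def by blast
qed


section \<open>Full duality for \<open>M_alpha\<close>\<close>

lemma finite_rel_homs: "compat_rel M r \<Longrightarrow> finite (rel_homs M r)"
  by (rule finite_subset[OF _ finite_PiE[OF finite_compat_rel, of r "\<lambda>_. carrier M"]])
    (use fin in \<open>auto simp: rel_hom_iff\<close>)

lemma rel_hat_rows:
  assumes r: "compat_rel M r" and fs: "set fs = rel_homs M r"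
    and F: "F \<in> fsyms M" and z: "zss \<in> tuples r (arity M F)"
  defines "ext \<equiv> \<lambda>zs. zs @ map (\<lambda>f. f zs) fs"
  shows "rowwise M F (rel_arity r + length fs) (map ext zss)
    = ext (rowwise M F (rel_arity r) zss)"
proof (rule nth_equalityI)
  let ?T = "rowwise M F (rel_arity r) zss"
  show "length (rowwise M F (rel_arity r + length fs) (map ext zss))
    = length (ext ?T)"
    by (simp add: ext_def)
  fix i assume "i < length (rowwise M F (rel_arity r + length fs) (map ext zss))"
  then have i: "i < rel_arity r + length fs" by simp
  then have L: "rowwise M F (rel_arity r + length fs) (map ext zss) ! i
      = opn M F (map (\<lambda>x. x ! i) (map ext zss))" by simp
  have len: "length zs = rel_arity r" if "zs \<in> set zss" for zs
    using compat_rel_length[OF r] z that by (auto simp: tuples_def)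
  show "rowwise M F (rel_arity r + length fs) (map ext zss) ! i = ext ?T ! i"
  proof (cases "i < rel_arity r")
    case True
    then have "map (\<lambda>x. x ! i) (map ext zss) = map (\<lambda>x. x ! i) zss"
      using len by (auto simp: ext_def nth_append)
    moreover have "ext ?T ! i = opn M F (map (\<lambda>x. x ! i) zss)"
      using True by (simp add: ext_def nth_append)
    ultimately show ?thesis unfolding L by (simp only:)
  next
    case False
    then have "map (\<lambda>x. x ! i) (map ext zss) = map (fs ! (i - rel_arity r)) zss"
      using len i by (auto simp: ext_def nth_append)
    moreover have "fs ! (i - rel_arity r) \<in> rel_homs M r"
      using fs i False by (metis nth_mem add_less_cancel_left le_add_diff_inverse not_less)
    then have "(fs ! (i - rel_arity r)) ?T = opn M F (map (fs ! (i - rel_arity r)) zss)"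
      using F z unfolding rel_hom_iff by blast
    moreover have "ext ?T ! i = (fs ! (i - rel_arity r)) ?T"
      using False i by (simp add: ext_def nth_append)
    ultimately show ?thesis unfolding L by (simp only:)
  qed
qed

text \<open>A homomorphism on \<open>rel_hat fs r\<close>, composed with \<open>ext\<close>, is a
  homomorphism on \<open>r\<close> and so occurs in \<open>fs\<close>: it is one of the appended
  coordinates.\<close>

lemma rel_hat:
  assumes r: "compat_rel M r" and fs: "set fs = rel_homs M r"
  shows "rel_arity (rel_hat fs r) = rel_arity r + length fs" "hom_minimal M (rel_hat fs r)"
proof -
  define ext where "ext = (\<lambda>zs. zs @ map (\<lambda>f. f zs) fs)"
  have rows: "rowwise M F (rel_arity r + length fs) (map ext zss)
    = ext (rowwise M F (rel_arity r) zss)"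
    if "F \<in> fsyms M" "zss \<in> tuples r (arity M F)" for F zss
    unfolding ext_def by (rule rel_hat_rows[OF r fs that])
  have hat: "rel_hat fs r = ext ` r" by (auto simp: rel_hat_def ext_def)
  obtain zs0 where zs0: "zs0 \<in> r" using compat_relD(1)[OF r] by blast
  have sub: "rel_hat fs r \<subseteq> tuples (carrier M) (rel_arity r + length fs)"
  proof
    fix ws assume "ws \<in> rel_hat fs r"
    then obtain zs where zs: "zs \<in> r" "ws = ext zs" unfolding hat by blast
    have "f zs \<in> carrier M" if "f \<in> set fs" for f
      using rel_hom_in_carrier zs(1) that fs by blast
    then show "ws \<in> tuples (carrier M) (rel_arity r + length fs)"
      using zs compat_relD(2)[OF r] by (auto simp: ext_def tuples_def)
  qed
  show ar: "rel_arity (rel_hat fs r) = rel_arity r + length fs"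
    using zs0 sub hat by (intro rel_arity_eqI[of "ext zs0"]) auto
  have pull: "\<exists>zss\<in>tuples r k. wss = map ext zss" if w: "wss \<in> tuples (rel_hat fs r) k" for wss k
  proof -
    have "wss \<in> map ext ` lists r"
      using w by (auto simp: tuples_def hat lists_image[symmetric])
    then show ?thesis using w by (auto simp: tuples_def)
  qed
  have c: "compat_rel M (rel_hat fs r)"
  proof (rule compat_relI[OF _ sub])
    show "rel_hat fs r \<noteq> {}" using zs0 hat by blast
    fix F wss assume F: "F \<in> fsyms M" and w: "wss \<in> tuples (rel_hat fs r) (arity M F)"
    obtain zss where z: "zss \<in> tuples r (arity M F)" "wss = map ext zss" using pull[OF w] by blast
    show "rowwise M F (rel_arity r + length fs) wss \<in> rel_hat fs r"
      unfolding z(2) rows[OF F z(1)] hat by (rule imageI, rule compat_relD(3)[OF r F z(1)])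
  qed
  show "hom_minimal M (rel_hat fs r)"
    unfolding hom_minimal_def
  proof (intro conjI ballI)
    show "compat_rel M (rel_hat fs r)" by (rule c)
    fix f assume f: "f \<in> rel_homs M (rel_hat fs r)"
    have "(\<lambda>zs\<in>r. f (ext zs)) \<in> rel_homs M r"
      unfolding rel_hom_iff
    proof (intro conjI ballI)
      show "(\<lambda>zs\<in>r. f (ext zs)) \<in> r \<rightarrow>\<^sub>E carrier M"
        using rel_hom_in_carrier[OF f] hat by simp
      fix F zss assume F: "F \<in> fsyms M" and z: "zss \<in> tuples r (arity M F)"
      let ?T = "rowwise M F (rel_arity r) zss"
      have "map ext zss \<in> tuples (rel_hat fs r) (arity M F)"
        using z by (auto simp: tuples_def hat)
      then have "f (rowwise M F (rel_arity r + length fs) (map ext zss))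
          = opn M F (map f (map ext zss))"
        using f F unfolding rel_hom_iff ar by blast
      then have "f (ext ?T) = opn M F (map f (map ext zss))"
        unfolding rows[OF F z] .
      moreover have "map f (map ext zss) = map (\<lambda>zs\<in>r. f (ext zs)) zss"
        using z by (auto simp: tuples_def)
      ultimately show "(\<lambda>zs\<in>r. f (ext zs)) ?T = opn M F (map (\<lambda>zs\<in>r. f (ext zs)) zss)"
        using compat_relD(3)[OF r F z] by (simp only: restrict_apply')
    qed
    then obtain k where k: "k < length fs" "(\<lambda>zs\<in>r. f (ext zs)) = fs ! k"
      using fs by (metis in_set_conv_nth)
    have "f ws = ws ! (rel_arity r + k)" if "ws \<in> rel_hat fs r" for ws
    proof -
      obtain zs where zs: "zs \<in> r" "ws = ext zs" using \<open>ws \<in> rel_hat fs r\<close> hat by blast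
      have "f ws = (fs ! k) zs" using fun_cong[OF k(2), of zs] zs by simp
      then show ?thesis
        using compat_rel_length[OF r zs(1)] k(1) zs(2) by (simp add: ext_def nth_append)
    qed
    then show "\<exists>i<rel_arity (rel_hat fs r). \<forall>xs\<in>rel_hat fs r. f xs = xs ! i"
      using k(1) ar by (intro exI[of _ "rel_arity r + k"]) simp
  qed
qed

section \<open>Evaluations of finite algebras and structures over \<open>M_alpha\<close>\<close>

lemma ISP_separates:
  assumes "ISP M A" "a \<in> carrier A" "b \<in> carrier A" "\<And>y. y \<in> alg_hom A M \<Longrightarrow> y a = y b"
  shows "a = b"
proof -
  obtain I :: "('b \<Rightarrow> 'a) set" and B e where
    B: "subuniverse (alg_power M I) B" and e: "alg_iso e A ((alg_power M I)\<lparr>carrier := B\<rparr>)"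
    using assms(1) unfolding ISP_def by blast
  have s: "similar A M" using assms(1) by (simp add: ISP_def)
  have eh: "e \<in> alg_hom A ((alg_power M I)\<lparr>carrier := B\<rparr>)" and bij: "bij_betw e (carrier A) B"
    using e by (auto simp: alg_iso_def)
  have BP: "B \<subseteq> I \<rightarrow>\<^sub>E carrier M" using B by (simp add: subuniverse_def alg_power_def)
  have eP: "e x \<in> I \<rightarrow>\<^sub>E carrier M" if "x \<in> carrier A" for x
    using bij BP that by (auto simp: bij_betw_def)
  have y: "(\<lambda>x\<in>carrier A. e x i) \<in> alg_hom A M" if i: "i \<in> I" for i
    unfolding alg_hom_def
  proof (intro CollectI conjI ballI)
    have "e x i \<in> carrier M" if "x \<in> carrier A" for x using PiE_mem[OF eP[OF that] i] .
    then show "(\<lambda>x\<in>carrier A. e x i) \<in> carrier A \<rightarrow>\<^sub>E carrier M" by simp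
    fix F as assume F: "F \<in> fsyms A" and as: "as \<in> tuples (carrier A) (arity A F)"
    have "e (opn A F as) = opn ((alg_power M I)\<lparr>carrier := B\<rparr>) F (map e as)"
      using eh F as unfolding alg_hom_def by blast
    also have "\<dots> = (\<lambda>i\<in>I. opn M F (map (\<lambda>x. x i) (map e as)))" by (simp add: alg_power_def)
    finally have "e (opn A F as) i = opn M F (map (\<lambda>x. x i) (map e as))" using i by simp
    moreover have "map (\<lambda>x. x i) (map e as) = map (\<lambda>x\<in>carrier A. e x i) as"
      using as by (auto simp: tuples_def)
    moreover have "opn A F as \<in> carrier A"
      using assms(1) F as by (simp add: ISP_def is_algebra_def)
    ultimately show "(\<lambda>x\<in>carrier A. e x i) (opn A F as) = opn M F (map (\<lambda>x\<in>carrier A. e x i) as)"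
      by (simp only: restrict_apply')
  qed
  have "e a = e b"
  proof (rule PiE_ext[OF eP eP])
    fix i assume "i \<in> I"
    from assms(4)[OF y[OF this]] show "e a i = e b i" using assms(2,3) by simp
  qed (use assms in auto)
  then show ?thesis using bij assms(2,3) by (auto simp: bij_betw_def inj_on_def)
qed

text \<open>The values of all homomorphisms from \<open>A\<close>, in a fixed order, form a relation
  \<open>r\<close>. A homomorphism on \<open>r\<close>, composed with \<open>t\<close>, is again one
  of the listed maps, so \<open>r\<close> is hom-minimal and belongs to \<open>M_alpha\<close>. A
  morphism on the dual preserves \<open>r\<close> at the list of all homomorphisms, which says that
  it is an evaluation.\<close>

lemma dualises_fin_M_alpha: "dualises_fin M (M_alpha M)"
  unfolding dualises_fin_def
proof (intro allI impI)
  fix A :: "(nat, 'f) algebra" assume A: "finite (carrier A) \<and> ISP M A"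
  then have algA: "is_algebra A" and sim: "similar A M" and I: "ISP M A" and finA: "finite (carrier A)"
    by (auto simp: ISP_def)
  let ?S = "M_alpha M" and ?H = "alg_hom A M" and ?D = "dual_D M A"
  note S = is_alter_ego_M_alpha
  have uD: "univ ?D = ?H" by (simp add: dual_D_def)
  have HP: "?H \<subseteq> carrier A \<rightarrow>\<^sub>E carrier M" by (auto simp: alg_hom_def)
  have finH: "finite ?H" by (rule finite_subset[OF HP finite_PiE[OF finA]]) (rule fin)
  have dD: "topo ?D = discrete_topology (univ ?D)"
    unfolding dual_D_def induced_simps power_struct_simps
    by (rule subtopology_product_discrete(1)[OF finH HP])
  have fs: "fsyms A = fsyms M" and ar: "\<And>F. F \<in> fsyms M \<Longrightarrow> arity A F = arity M F"
    using sim by (auto simp: similar_def)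
  have yc: "y a \<in> carrier M" if "y \<in> ?H" "a \<in> carrier A" for y a
    by (rule PiE_mem[OF subsetD[OF HP that(1)] that(2)])
  have me: "map (eta M A a) ys = map (\<lambda>y. y a) ys" if "a \<in> carrier A" "set ys \<subseteq> ?H" for a ys
    using that by (auto simp: eta_def)
  have eta: "eta M A a \<in> morphs M ?S ?D" if a: "a \<in> carrier A" for a
    unfolding str_hom_self_iff[OF dD] uD
  proof (intro conjI ballI allI impI)
    show "eta M A a \<in> ?H \<rightarrow>\<^sub>E carrier M" using yc a by (simp add: eta_def)
    fix s ys assume "ys \<in> relI ?D s"
    then have "set ys \<subseteq> ?H" "map (\<lambda>y. y a) ys \<in> s"
      using a by (auto simp: dual_D_def lists_eq_set)
    then show "map (eta M A a) ys \<in> s" using me[OF a] by (simp only:)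
  next
    fix h ys z assume h: "h \<in> ops ?S" and ys: "opI ?D h ys = Some z"
    have ysH: "set ys \<subseteq> ?H" and dom: "\<And>a. a \<in> carrier A \<Longrightarrow> map (\<lambda>y. y a) ys \<in> dom h"
      and z: "z = (\<lambda>a\<in>carrier A. the (h (map (\<lambda>y. y a) ys)))"
      using ys by (auto simp: dual_D_def lists_eq_set restrict_map_def split: if_splits)
    have "z \<in> ?H" unfolding z
      by (rule alg_hom_op_closed[OF algA sim is_alter_egoD(2)[OF S h] ysH dom])
    then have "eta M A a z = the (h (map (\<lambda>y. y a) ys))" using a by (simp add: eta_def z)
    then show "h (map (eta M A a) ys) = Some (eta M A a z)"
      unfolding me[OF a ysH] using dom[OF a] by auto
  qed
  have "inj_on (eta M A) (carrier A)"
  proof (rule inj_onI)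
    fix a b assume ab: "a \<in> carrier A" "b \<in> carrier A" "eta M A a = eta M A b"
    show "a = b"
    proof (rule ISP_separates[OF I ab(1,2)])
      fix y assume "y \<in> ?H"
      then show "y a = y b" using fun_cong[OF ab(3), of y] ab(1,2) by (simp add: eta_def)
    qed
  qed
  moreover have "\<exists>a\<in>carrier A. u = eta M A a" if u: "u \<in> morphs M ?S ?D" for u
  proof -
    obtain xs where xs: "set xs = ?H" using finite_list[OF finH] by blast
    define t where "t a = map (\<lambda>x. x a) xs" for a
    define r where "r = t ` carrier A"
    obtain a0 where a0: "a0 \<in> carrier A" using algA by (auto simp: is_algebra_def)
    have rt: "r \<subseteq> tuples (carrier M) (length xs)"
      using yc xs by (auto simp: r_def t_def tuples_def)
    have rar: "rel_arity r = length xs"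
      using a0 rt by (intro rel_arity_eqI[of "t a0"]) (auto simp: r_def)
    have rows: "rowwise M F (length xs) (map t as) = t (opn A F as)"
      if F: "F \<in> fsyms M" and as: "as \<in> tuples (carrier A) (arity M F)" for F as
    proof (rule nth_equalityI)
      fix i assume "i < length (rowwise M F (length xs) (map t as))"
      then have i: "i < length xs" by simp
      then have "xs ! i \<in> ?H" using xs nth_mem by blast
      then have "(xs ! i) (opn A F as) = opn M F (map (xs ! i) as)"
        using F as fs ar unfolding alg_hom_def by simp
      moreover have "map (\<lambda>x. x ! i) (map t as) = map (xs ! i) as" using i by (simp add: t_def)
      ultimately show "rowwise M F (length xs) (map t as) ! i
          = t (opn A F as) ! i"
        using i by (simp add: t_def del: map_map)
    qed (simp add: t_def)
    have opA: "opn A F as \<in> carrier A" if "F \<in> fsyms M" "as \<in> tuples (carrier A) (arity M F)" for F as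
      using algA that fs ar by (simp add: is_algebra_def)
    have c: "compat_rel M r"
    proof (rule compat_relI[OF _ rt])
      show "r \<noteq> {}" using a0 by (auto simp: r_def)
      fix F zss assume F: "F \<in> fsyms M" and z: "zss \<in> tuples r (arity M F)"
      have "zss \<in> map t ` lists (carrier A)"
        using z by (auto simp: tuples_def r_def lists_image[symmetric])
      then obtain as where as: "as \<in> lists (carrier A)" "zss = map t as" by blast
      then have as: "as \<in> tuples (carrier A) (arity M F)" "zss = map t as"
        using z by (auto simp: tuples_def)
      show "rowwise M F (length xs) zss \<in> r"
        unfolding as(2) rows[OF F as(1)] r_def by (rule imageI, rule opA[OF F as(1)])
    qed
    have "hom_minimal M r"
      unfolding hom_minimal_def
    proof (intro conjI ballI)
      show "compat_rel M r" by (rule c)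
      fix f assume f: "f \<in> rel_homs M r"
      have "(\<lambda>a\<in>carrier A. f (t a)) \<in> ?H"
        unfolding alg_hom_def
      proof (intro CollectI conjI ballI)
        show "(\<lambda>a\<in>carrier A. f (t a)) \<in> carrier A \<rightarrow>\<^sub>E carrier M"
          using rel_hom_in_carrier[OF f] by (simp add: r_def)
        fix F as assume F0: "F \<in> fsyms A" and as0: "as \<in> tuples (carrier A) (arity A F)"
        then have F: "F \<in> fsyms M" and as: "as \<in> tuples (carrier A) (arity M F)" using fs ar by auto
        have "map t as \<in> tuples r (arity M F)" using as by (auto simp: tuples_def r_def)
        then have "f (rowwise M F (rel_arity r) (map t as))
            = opn M F (map f (map t as))"
          using f F unfolding rel_hom_iff by blast
        then have "f (t (opn A F as)) = opn M F (map f (map t as))"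
          unfolding rar rows[OF F as] .
        moreover have "map f (map t as) = map (\<lambda>a\<in>carrier A. f (t a)) as"
          using as by (auto simp: tuples_def)
        ultimately show "(\<lambda>a\<in>carrier A. f (t a)) (opn A F as) = opn M F (map (\<lambda>a\<in>carrier A. f (t a)) as)"
          using opA[OF F as] by (simp only: restrict_apply')
      qed
      then obtain k where k: "k < length xs" "(\<lambda>a\<in>carrier A. f (t a)) = xs ! k"
        using xs by (metis in_set_conv_nth)
      have "f zs = zs ! k" if "zs \<in> r" for zs
      proof -
        obtain a where a: "a \<in> carrier A" "zs = t a" using \<open>zs \<in> r\<close> by (auto simp: r_def)
        then show ?thesis using fun_cong[OF k(2), of a] k(1) by (simp add: t_def)
      qed
      then show "\<exists>i<rel_arity r. \<forall>zs\<in>r. f zs = zs ! i" using k(1) rar by auto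
    qed
    then have "r \<in> rels ?S" by (simp add: M_alpha_def hom_minimal_R_alpha)
    \<comment> \<open>In the coordinate \<open>a\<close> the list of all homomorphisms has the row
      \<open>t a\<close>, a member of \<open>r\<close>.\<close>
    moreover have "xs \<in> relI ?D r"
      unfolding dual_D_def induced_simps power_struct_simps using xs HP
      by (auto simp: lists_eq_set r_def t_def)
    ultimately have "map u xs \<in> r" using u unfolding str_hom_self_iff[OF dD] by blast
    then obtain a where a: "a \<in> carrier A" "map u xs = t a" by (auto simp: r_def)
    have "u = eta M A a"
    proof (rule extensionalityI)
      show "u \<in> extensional ?H" using u uD by (simp add: str_hom_def PiE_def)
      show "eta M A a \<in> extensional ?H" using a by (simp add: eta_def)
      fix y assume "y \<in> ?H"
      then show "u y = eta M A a y" using a xs by (simp add: t_def eta_def)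
    qed
    then show ?thesis using a by blast
  qed
  then have "eta M A ` carrier A = morphs M ?S ?D" using eta by blast
  moreover have "eta M A \<in> alg_hom A (dual_E M ?S ?D)"
    unfolding alg_hom_def[of A "dual_E M ?S ?D"] dual_E_simps uD
  proof (intro CollectI conjI ballI)
    show "eta M A \<in> carrier A \<rightarrow>\<^sub>E morphs M ?S ?D"
      using eta by (intro PiE_I) (auto simp: eta_def)
    fix F as assume F0: "F \<in> fsyms A" and as0: "as \<in> tuples (carrier A) (arity A F)"
    have oA: "opn A F as \<in> carrier A" using algA F0 as0 by (simp add: is_algebra_def)
    have "y (opn A F as) = opn M F (map (\<lambda>u. u y) (map (eta M A) as))" if y: "y \<in> ?H" for y
    proof -
      have "map (\<lambda>u. u y) (map (eta M A) as) = map y as"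
        using as0 y by (auto simp: tuples_def eta_def)
      moreover have "y (opn A F as) = opn M F (map y as)"
        using y F0 as0 unfolding alg_hom_def by blast
      ultimately show ?thesis by (simp only:)
    qed
    then show "eta M A (opn A F as) = (\<lambda>y\<in>?H. opn M F (map (\<lambda>u. u y) (map (eta M A) as)))"
      unfolding eta_def[THEN fun_cong, of M A "opn A F as"] restrict_apply'[OF oA]
      by (intro restrict_ext)
  qed
  ultimately show "alg_iso (eta M A) A (dual_E M ?S ?D)"
    by (simp add: alg_iso_def bij_betw_def)
qed


lemma M_alpha_simps [simp]:
  "ops (M_alpha M) = {h. compat_op M h \<and> dom h \<in> R_alpha M}" "rels (M_alpha M) = R_alpha M"
  by (simp_all add: M_alpha_def)

text \<open>Let \<open>r\<close> be the relation formed by the values of all morphisms \<open>X \<rightarrow> M\<close> on an enumeration of \<open>X\<close>.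
  It lies in \<open>R_alpha\<close>: preservation of an operation with domain \<open>s\<close> amounts to preservation of the
  hom-minimal relation \<open>rel_hat fs s\<close>, because \<open>X\<close> contains the values of all operations with
  domain \<open>s\<close>.\<close>

lemma separated_M_alpha_surj:
  assumes X: "separated M (M_alpha M) X" and finX: "finite (univ X)"
    and \<phi>: "\<phi> \<in> alg_hom (dual_E M (M_alpha M) X) M"
  shows "\<exists>x\<in>univ X. \<forall>u\<in>morphs M (M_alpha M) X. \<phi> u = u x"
proof -
  let ?S = "M_alpha M"
  let ?H = "morphs M ?S X"
  note S = is_alter_ego_M_alpha
  have X1: "is_struct ?S X" and d: "topo X = discrete_topology (univ X)"
    using X by (auto simp: separated_def)
  obtain u0 where u0: "u0 \<in> ?H" using X by (auto simp: separated_def)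
  obtain xs where xs: "set xs = univ X" "distinct xs" using finite_distinct_list[OF finX] by blast
  define n where "n = length xs"
  define ix where "ix x = (SOME i. i < n \<and> xs ! i = x)" for x
  have ix: "ix x < n" "xs ! ix x = x" if "x \<in> univ X" for x
  proof -
    have "\<exists>i<n. xs ! i = x" using that xs(1) by (metis in_set_conv_nth n_def)
    then have "ix x < n \<and> xs ! ix x = x" unfolding ix_def by (rule someI_ex)
    then show "ix x < n" "xs ! ix x = x" by auto
  qed
  have ixi: "ix (xs ! i) = i" if "i < n" for i
    using ix[of "xs ! i"] that xs nth_mem[of i xs] nth_eq_iff_index_eq[OF xs(2)] by (simp add: n_def)
  \<comment> \<open>The inverse of applying a function to the enumeration \<open>xs\<close>: a tuple
    is read as a function on \<open>X\<close>.\<close>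
  define fn where "fn a = (\<lambda>x\<in>univ X. a ! ix x)" for a :: "'a list"
  have mfn: "map (fn a) ys = map (\<lambda>i. a ! i) (map ix ys)" if "set ys \<subseteq> univ X" for a ys
    using that by (auto simp: fn_def)
  have fnxs: "map (fn a) xs = a" if "length a = n" for a
    using that ixi xs(1) nth_mem[of _ xs] by (intro nth_equalityI) (auto simp: fn_def n_def)
  have nthu: "map (\<lambda>i. map u xs ! i) (map ix ys) = map u ys" if "set ys \<subseteq> univ X" for u :: "'b \<Rightarrow> 'a" and ys
    using that ix by (auto simp: n_def)
  have fnu: "fn (map u xs) = u" if "u \<in> ?H" for u
  proof (rule extensionalityI)
    show "u \<in> extensional (univ X)" using that by (simp add: str_hom_def PiE_def)
    show "fn (map u xs) \<in> extensional (univ X)" by (simp add: fn_def)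
    show "fn (map u xs) x = u x" if "x \<in> univ X" for x
      using ix[OF that] that by (simp add: fn_def n_def)
  qed
  define r where "r = (\<lambda>u. map u xs) ` ?H"
  \<comment> \<open>All constraints from \<open>R_alpha\<close> that are valid on \<open>r\<close>.
    They define \<open>r\<close>, because a tuple satisfying them turns out to be a
    morphism.\<close>
  define \<Delta> where "\<Delta> = {(s, is). s \<in> R_alpha M \<and> length is = rel_arity s \<and> (\<forall>i\<in>set is. i < n) \<and>
    (\<forall>zs\<in>r. map (\<lambda>i. zs ! i) is \<in> s)}"
  have rt: "r \<subseteq> tuples (carrier M) n"
    using str_hom_in_carrier xs(1) by (fastforce simp: r_def tuples_def n_def)
  have in_\<Delta>: "(s, map ix ys) \<in> \<Delta>"
    if s: "s \<in> R_alpha M" "length ys = rel_arity s" and ysX: "set ys \<subseteq> univ X"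
      and m: "\<And>u. u \<in> ?H \<Longrightarrow> map u ys \<in> s" for s ys
  proof -
    have "map (\<lambda>i. zs ! i) (map ix ys) \<in> s" if zs: "zs \<in> r" for zs
    proof -
      obtain u where "u \<in> ?H" "zs = map u xs" using zs by (auto simp: r_def)
      then show ?thesis using m nthu[OF ysX, of u] by (simp only:)
    qed
    then show ?thesis using s ysX ix(1) by (auto simp: \<Delta>_def)
  qed
  have fnH: "fn a \<in> ?H" if a: "a \<in> conj_rel M n \<Delta>" for a
    unfolding str_hom_self_iff[OF d]
  proof (intro conjI ballI allI impI)
    have at: "a \<in> tuples (carrier M) n"
      and a\<Delta>: "\<And>s is. (s, is) \<in> \<Delta> \<Longrightarrow> map (\<lambda>i. a ! i) is \<in> s"
      using a by (auto simp: conj_rel_def)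
    show "fn a \<in> univ X \<rightarrow>\<^sub>E carrier M" using at ix(1) by (auto simp: fn_def tuples_def)
    {
      fix s ys assume s: "s \<in> rels ?S" and ys: "ys \<in> relI X s"
      have yt: "ys \<in> tuples (univ X) (rel_arity s)" by (rule is_structD(1)[OF X1 s ys])
      then have ysX: "set ys \<subseteq> univ X" by (simp add: tuples_def)
      have "(s, map ix ys) \<in> \<Delta>"
      proof (rule in_\<Delta>)
        show "map u ys \<in> s" if "u \<in> ?H" for u
          using that s ys unfolding str_hom_self_iff[OF d] by blast
      qed (use s yt in \<open>auto simp: tuples_def\<close>)
      then show "map (fn a) ys \<in> s" unfolding mfn[OF ysX] by (rule a\<Delta>)
    }
    fix h ys y assume h: "h \<in> ops ?S" and ys: "opI X h ys = Some y"
    define s where "s = dom h"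
    have hc: "compat_op M h" and sR: "s \<in> R_alpha M" and sc: "compat_rel M s"
      using h by (auto simp: s_def compat_op_iff)
    have yt: "ys \<in> tuples (univ X) (rel_arity s)" and yX: "y \<in> univ X"
      using is_structD(2,3)[OF X1 h ys] by (simp_all add: s_def)
    have ysX: "set ys \<subseteq> univ X" using yt by (simp add: tuples_def)
    have hu: "h (map u ys) = Some (u y)" if "u \<in> ?H" for u
      using that h ys unfolding str_hom_self_iff[OF d] by blast
    have us: "map u ys \<in> s" if "u \<in> ?H" for u using hu[OF that] by (auto simp: s_def)
    obtain fs where fs: "set fs = rel_homs M s"
      using finite_list[OF finite_rel_homs[OF sc]] by blast
    \<comment> \<open>Each homomorphism \<open>f\<close> from \<open>s\<close> gives an operation of
      \<open>M_alpha\<close>, and since domains are reflected it is defined at \<open>ys\<close> in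
      \<open>X\<close>; its value there is \<open>z\<close>.\<close>
    have "\<exists>z\<in>univ X. \<forall>u\<in>?H. u z = f (map u ys)" if f: "f \<in> set fs" for f
    proof -
      have k: "op_of s f \<in> ops ?S" using compat_op_op_of[OF sc] f fs sR by simp
      have "ys \<in> dom (opI X (op_of s f))"
        by (rule separatedD(3)[OF X k]) (use yt us in simp_all)
      then obtain z where z: "opI X (op_of s f) ys = Some z" by blast
      have "u z = f (map u ys)" if "u \<in> ?H" for u
      proof -
        have "op_of s f (map u ys) = Some (u z)"
          using \<open>u \<in> ?H\<close> k z unfolding str_hom_self_iff[OF d] by blast
        then show ?thesis using us[OF \<open>u \<in> ?H\<close>] by (simp add: op_of_def)
      qed
      then show ?thesis using is_structD(3)[OF X1 k z] by blast
    qed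
    then obtain w where w: "\<And>f. f \<in> set fs \<Longrightarrow> w f \<in> univ X"
      "\<And>f u. f \<in> set fs \<Longrightarrow> u \<in> ?H \<Longrightarrow> u (w f) = f (map u ys)"
      by metis
    define ws where "ws = ys @ map w fs"
    have wsX: "set ws \<subseteq> univ X" using ysX w(1) by (auto simp: ws_def)
    have "(rel_hat fs s, map ix ws) \<in> \<Delta>"
    proof (rule in_\<Delta>)
      show "rel_hat fs s \<in> R_alpha M" by (rule hom_minimal_R_alpha[OF rel_hat(2)[OF sc fs]])
      show "length ws = rel_arity (rel_hat fs s)"
        using yt by (simp add: ws_def rel_hat(1)[OF sc fs] tuples_def)
      show "set ws \<subseteq> univ X" by (rule wsX)
      fix u assume u: "u \<in> ?H"
      have "map u ws = map u ys @ map (\<lambda>f. f (map u ys)) fs"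
        using w(2)[OF _ u] by (simp add: ws_def)
      then show "map u ws \<in> rel_hat fs s" using us[OF u] unfolding rel_hat_def by blast
    qed
    then have "map (fn a) ws \<in> rel_hat fs s" unfolding mfn[OF wsX] by (rule a\<Delta>)
    then obtain bs where bs: "map (fn a) ws = bs @ map (\<lambda>f. f bs) fs" "bs \<in> s"
      unfolding rel_hat_def by blast
    have "length bs = length (map (fn a) ys)"
      using compat_rel_length[OF sc bs(2)] yt by (simp add: tuples_def)
    then have b: "bs = map (fn a) ys" "map (fn a) (map w fs) = map (\<lambda>f. f bs) fs"
      using bs(1) by (simp_all add: ws_def)
    \<comment> \<open>\<open>h\<close> is itself one of the homomorphisms in \<open>fs\<close>, so
      its value is among the appended coordinates; separation of points identifies the corresponding
      element with \<open>y\<close>.\<close>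
    define f0 where "f0 = (\<lambda>zs\<in>s. the (h zs))"
    have f0: "f0 \<in> set fs" using hc fs by (simp add: compat_op_iff f0_def s_def)
    have "w f0 = y"
    proof (rule separatedD(1)[OF X w(1)[OF f0] yX])
      fix u assume u: "u \<in> ?H"
      have "u (w f0) = f0 (map u ys)" by (rule w(2)[OF f0 u])
      also have "\<dots> = u y" using us[OF u] hu[OF u] by (simp add: f0_def)
      finally show "u (w f0) = u y" .
    qed
    moreover have "fn a (w f0) = f0 bs" using b(2) f0 by simp
    moreover have "h bs = Some (f0 bs)" using bs(2) by (auto simp: f0_def s_def)
    ultimately show "h (map (fn a) ys) = Some (fn a y)" using b(1) by simp
  qed
  have r_eq: "r = conj_rel M n \<Delta>"
  proof (intro equalityI subsetI)
    fix zs assume "zs \<in> r"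
    then show "zs \<in> conj_rel M n \<Delta>" using rt by (auto simp: conj_rel_def \<Delta>_def)
  next
    fix a assume a: "a \<in> conj_rel M n \<Delta>"
    then have "map (fn a) xs = a" by (intro fnxs) (simp add: conj_rel_def tuples_def)
    then show "a \<in> r" using fnH[OF a] unfolding r_def by (metis imageI)
  qed
  have "r \<noteq> {}" using u0 by (auto simp: r_def)
  then have rR: "r \<in> R_alpha M"
    unfolding r_eq by (rule conj_rel_R_alpha) (auto simp: \<Delta>_def)
  note rc = R_alpha_compat[OF rR]
  have rar: "rel_arity r = n" using \<open>r \<noteq> {}\<close> rt rel_arity_eqI by (metis all_not_in_conv)
  have fnr: "fn zs \<in> ?H" if "zs \<in> r" for zs using fnH that r_eq by simp
  define f where "f = (\<lambda>zs\<in>r. \<phi> (fn zs))"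
  have f: "f \<in> rel_homs M r"
    unfolding rel_hom_iff rar
  proof (intro conjI ballI)
    have "\<phi> u \<in> carrier M" if "u \<in> ?H" for u
      using \<phi> that unfolding alg_hom_def dual_E_simps by (auto dest: PiE_mem)
    then show "f \<in> r \<rightarrow>\<^sub>E carrier M" using fnr by (simp add: f_def)
    fix F zss assume F: "F \<in> fsyms M" and z: "zss \<in> tuples r (arity M F)"
    let ?T = "rowwise M F n zss"
    have us: "map fn zss \<in> tuples ?H (arity M F)" using z fnr by (auto simp: tuples_def)
    have "fn ?T = (\<lambda>x\<in>univ X. opn M F (map (\<lambda>u. u x) (map fn zss)))"
      unfolding fn_def
    proof (rule restrict_ext)
      fix x assume x: "x \<in> univ X"
      have "map (\<lambda>u. u x) (map (\<lambda>a. \<lambda>x\<in>univ X. a ! ix x) zss) = map (\<lambda>z. z ! ix x) zss"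
        using x by simp
      then show "?T ! ix x = opn M F (map (\<lambda>u. u x) (map (\<lambda>a. \<lambda>x\<in>univ X. a ! ix x) zss))"
        using ix(1)[OF x] by (simp del: map_map map_eq_conv)
    qed
    moreover have "\<phi> (\<lambda>x\<in>univ X. opn M F (map (\<lambda>u. u x) (map fn zss))) = opn M F (map \<phi> (map fn zss))"
      using \<phi> F us unfolding alg_hom_def dual_E_simps by blast
    moreover have "map \<phi> (map fn zss) = map f zss" using z by (auto simp: f_def tuples_def)
    moreover have "?T \<in> r" using compat_relD(3)[OF rc F z] unfolding rar .
    ultimately show "f ?T = opn M F (map f zss)"
      unfolding f_def[THEN fun_cong, of ?T] by (simp only: restrict_apply')
  qed
  \<comment> \<open>As \<open>r\<close> is in \<open>R_alpha\<close>, the homomorphism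
    \<open>f\<close> is an operation of \<open>M_alpha\<close>. Its value at the enumeration
    \<open>xs\<close> is the required point.\<close>
  have k: "op_of r f \<in> ops ?S" using compat_op_op_of[OF rc f] rR by simp
  have "xs \<in> dom (opI X (op_of r f))"
  proof (rule separatedD(3)[OF X k])
    show "xs \<in> tuples (univ X) (op_arity (op_of r f))" using xs rar by (simp add: tuples_def n_def)
    show "map u xs \<in> dom (op_of r f)" if "u \<in> ?H" for u
      using that unfolding dom_op_of r_def by (rule imageI)
  qed
  then obtain y where y: "opI X (op_of r f) xs = Some y" by blast
  have "\<phi> u = u y" if u: "u \<in> ?H" for u
  proof -
    have "op_of r f (map u xs) = Some (u y)" using u k y unfolding str_hom_self_iff[OF d] by blast
    moreover have "map u xs \<in> r" using u unfolding r_def by (rule imageI)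
    ultimately show ?thesis using fnu[OF u] by (simp add: op_of_def f_def)
  qed
  then show ?thesis using is_structD(3)[OF X1 k y] by blast
qed

lemma fully_dualises_fin_M_alpha: "fully_dualises_fin M (M_alpha M)"
  unfolding fully_dualises_fin_def
proof (intro conjI allI impI)
  show "dualises_fin M (M_alpha M)" by (rule dualises_fin_M_alpha)
  fix X :: "(nat, 'a) tstruct" assume "finite (univ X) \<and> IScP_plus M (M_alpha M) X"
  then have X: "separated M (M_alpha M) X" "finite (univ X)"
    using IScP_plus_separated[OF is_alter_ego_M_alpha] by auto
  show "str_iso (M_alpha M) (epsilon M (M_alpha M) X) X (dual_D M (dual_E M (M_alpha M) X))"
    by (rule epsilon_iso_if_surj[OF is_alter_ego_M_alpha X separated_M_alpha_surj[OF X]])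
qed

lemma M_alpha_smallest:
  assumes S: "is_alter_ego M S" and full: "fully_dualises_fin M S"
  shows "structural_reduct M (M_alpha M) S"
proof -
  have "dualises_fin M S" using full by (simp add: fully_dualises_fin_def)
  then have sub: "R_alpha M \<subseteq> Rel_ca M S"
    using hom_minimal_Rel_ca[OF S] by (intro R_alpha_subset_Rel_ca)
  then have "\<forall>h\<in>ops (M_alpha M). has_extension M S h"
    using fully_dualises_rich[OF S full] by auto
  then show ?thesis using sub unfolding structural_reduct_def by auto
qed

end

section \<open>Sentences in the structure of clone functions\<close>

lemma op_graph_iff [simp]: "xs @ [y] \<in> op_graph h \<longleftrightarrow> h xs = Some y"
  by (auto simp: op_graph_def)

lemma rel_arity_op_graph:
  assumes "compat_op M h"
  shows "rel_arity (op_graph h) = Suc (op_arity h)"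
proof -
  have c: "compat_rel M (op_graph h)" "compat_rel M (dom h)"
    using assms by (simp add: compat_op_def, simp add: compat_op_iff)
  obtain xs where "xs \<in> dom h" using compat_relD(1)[OF c(2)] by blast
  then obtain y where "xs @ [y] \<in> op_graph h" by auto
  from compat_rel_length[OF c(1) this] compat_rel_length[OF c(2) \<open>xs \<in> dom h\<close>]
  show ?thesis by simp
qed

text \<open>Appending the value of \<open>h\<close> is an isomorphism from the domain onto the
  graph, along which homomorphisms are pulled back.\<close>

lemma op_graph_hom:
  assumes h: "compat_op M h" and f: "f \<in> rel_homs M (op_graph h)"
  shows "(\<lambda>zs\<in>dom h. f (zs @ [the (h zs)])) \<in> rel_homs M (dom h)"
  unfolding rel_hom_iff
proof (intro conjI ballI)
  have c: "compat_rel M (dom h)" using h by (simp add: compat_op_iff)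
  have g: "zs @ [the (h zs)] \<in> op_graph h" if "zs \<in> dom h" for zs using that by auto
  show "(\<lambda>zs\<in>dom h. f (zs @ [the (h zs)])) \<in> dom h \<rightarrow>\<^sub>E carrier M"
    using rel_hom_in_carrier[OF f g] by simp
  fix F zss assume F: "F \<in> fsyms M" and z: "zss \<in> tuples (dom h) (arity M F)"
  let ?n = "op_arity h"
  let ?T = "rowwise M F ?n zss"
  have T: "?T \<in> dom h" by (rule compat_relD(3)[OF c F z])
  define gss where "gss = map (\<lambda>zs. zs @ [the (h zs)]) zss"
  have len: "length zs = ?n" if "zs \<in> set zss" for zs
    using compat_rel_length[OF c, of zs] z that unfolding tuples_def by blast
  have "map (\<lambda>x. x ! i) gss = map (\<lambda>x. x ! i) zss" if "i < ?n" for i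
    using len that by (auto simp: gss_def nth_append)
  moreover have "map (\<lambda>x. x ! ?n) gss = map (\<lambda>zs. the (h zs)) zss"
    using len by (auto simp: gss_def nth_append)
  ultimately have "rowwise M F (Suc ?n) gss
      = ?T @ [opn M F (map (\<lambda>zs. the (h zs)) zss)]"
    by simp
  also have "\<dots> = ?T @ [the (h ?T)]" using compat_op_opn[OF h F z] by simp
  finally have rows: "rowwise M F (rel_arity (op_graph h)) gss
      = ?T @ [the (h ?T)]"
    unfolding rel_arity_op_graph[OF h] .
  have "gss \<in> tuples (op_graph h) (arity M F)"
    using z g unfolding gss_def tuples_def by fastforce
  then have "f (rowwise M F (rel_arity (op_graph h)) gss)
      = opn M F (map f gss)"
    using f F unfolding rel_hom_iff by blast
  moreover have "map f gss = map (\<lambda>zs\<in>dom h. f (zs @ [the (h zs)])) zss"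
    using z by (auto simp: gss_def tuples_def)
  ultimately show "(\<lambda>zs\<in>dom h. f (zs @ [the (h zs)])) ?T
      = opn M F (map (\<lambda>zs\<in>dom h. f (zs @ [the (h zs)])) zss)"
    unfolding rows using T by (simp only: restrict_apply')
qed

section \<open>Instances of the formulas \<open>\<beta>\<close>\<close>

lemma hat_choiceD:
  assumes "hat_choice M S en \<beta>" "compat_rel M r"
  shows "set (en r) = rel_homs M r"
    "ca_formula S (rel_arity r + length (en r)) (\<beta> r)"
    "defined_rel (self_struct M) (rel_arity r + length (en r)) (\<beta> r) = rel_hat (en r) r"
  using assms unfolding hat_choice_def by blast+

lemma beta_inst_Var:
  "beta_inst en \<beta> k r (map Var is) =
     map (subst_atom (\<lambda>i. map Var (is @ [k..<k + length (en r)]) ! i)) (\<beta> r)"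
  by (simp add: beta_inst_def)

lemma ca_formula_beta_inst:
  assumes "hat_choice M S en \<beta>" "compat_rel M r" "length is = rel_arity r" "\<forall>i\<in>set is. i < k"
  shows "ca_formula S (k + length (en r)) (beta_inst en \<beta> k r (map Var is))"
  unfolding ca_formula_def
proof
  fix \<alpha> assume "\<alpha> \<in> set (beta_inst en \<beta> k r (map Var is))"
  then obtain \<gamma> where \<gamma>: "\<gamma> \<in> set (\<beta> r)"
    and \<alpha>: "\<alpha> = subst_atom (\<lambda>i. map Var (is @ [k..<k + length (en r)]) ! i) \<gamma>"
    unfolding beta_inst_Var by auto
  have wf: "wf_atom (length (is @ [k..<k + length (en r)])) \<gamma>" "in_lang S \<gamma>"
    using hat_choiceD(2)[OF assms(1,2)] \<gamma> assms(3) by (auto simp: ca_formula_def)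
  have lt: "\<forall>j\<in>set (is @ [k..<k + length (en r)]). j < k + length (en r)"
    using assms(4) by auto
  show "wf_atom (k + length (en r)) \<alpha> \<and> in_lang S \<alpha>"
    unfolding \<alpha> using wf_atom_subst_Var[OF wf(1) lt] in_lang_subst_Var[OF wf(1)] wf(2) by blast
qed

text \<open>The variables from \<open>k\<close> on stand for the values of the enumerated
  homomorphisms. The assignment \<open>zs\<close> may be longer than this instance requires, since
  later premises add further variables.\<close>

lemma holds_beta_inst_iff:
  assumes hc: "hat_choice M S en \<beta>" "compat_rel M r" and len: "length is = rel_arity r"
    and lt: "\<forall>i\<in>set is. i < k" and zs: "set zs \<subseteq> carrier M" "k + length (en r) \<le> length zs"
  shows "(\<forall>\<alpha>\<in>set (beta_inst en \<beta> k r (map Var is)). holds (self_struct M) zs \<alpha>) \<longleftrightarrow>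
     map (\<lambda>i. zs ! i) is @ map (\<lambda>i. zs ! i) [k..<k + length (en r)] \<in> rel_hat (en r) r"
proof -
  let ?js = "is @ [k..<k + length (en r)]"
  have wf: "wf_atom (length ?js) \<gamma>" if "\<gamma> \<in> set (\<beta> r)" for \<gamma>
    using hat_choiceD(2)[OF hc] that len by (auto simp: ca_formula_def)
  have "(\<forall>\<alpha>\<in>set (beta_inst en \<beta> k r (map Var is)). holds (self_struct M) zs \<alpha>) \<longleftrightarrow>
     (\<forall>\<gamma>\<in>set (\<beta> r). holds (self_struct M) (map (\<lambda>i. zs ! i) ?js) \<gamma>)"
    unfolding beta_inst_Var by (auto simp: holds_subst_Var[OF wf] simp del: map_append)
  also have "\<dots> \<longleftrightarrow> map (\<lambda>i. zs ! i) ?js \<in> defined_rel (self_struct M) (rel_arity r + length (en r)) (\<beta> r)"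
  proof -
    have "zs ! j \<in> carrier M" if "j \<in> set ?js" for j
    proof -
      have "j < length zs" using that lt zs(2) by auto
      then show ?thesis using zs(1) nth_mem by blast
    qed
    then have "map (\<lambda>i. zs ! i) ?js \<in> tuples (carrier M) (rel_arity r + length (en r))"
      using len by (auto simp: tuples_def)
    then show ?thesis by (simp add: defined_rel_def del: map_append)
  qed
  finally show ?thesis unfolding hat_choiceD(3)[OF hc] by simp
qed

lemma rel_hat_iff:
  assumes "compat_rel M r" "length xs = rel_arity r"
  shows "xs @ ys \<in> rel_hat fs r \<longleftrightarrow> xs \<in> r \<and> ys = map (\<lambda>f. f xs) fs"
  using compat_rel_length[OF assms(1)] assms(2) unfolding rel_hat_def by auto

text \<open>\<open>sharp M T r s\<close> is the relation defined by \<open>\<beta> s\<close> on the substructure of \<open>M\<^sup>r\<close> generated by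
  the projections: the bound variables of \<open>\<beta> s\<close> take the values of the homomorphisms from \<open>s\<close>, so
  these must belong to the substructure.\<close>

definition sharp ::
  "('a, 'f) algebra \<Rightarrow> 'a alter_ego \<Rightarrow> 'a frel \<Rightarrow> 'a frel \<Rightarrow> ('a list \<Rightarrow> 'a) frel" where
  "sharp M T r s = {xs \<in> tuples (clo_fun M T r) (rel_arity s).
     (\<forall>zs\<in>r. map (\<lambda>x. x zs) xs \<in> s) \<and>
     (\<forall>f\<in>rel_homs M s. on_rel r f xs \<in> clo_fun M T r)}"

text \<open>For an operation to be defined it is not enough that its arguments lie in the domain
  pointwise and its value is a clone function: the values of all homomorphisms from the domain must
  be clone functions. Definedness is then expressed by \<open>\<beta>\<close> of the domain, as in
  \<open>natural_concl\<close>.\<close>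

definition sharp_struct ::
  "('a, 'f) algebra \<Rightarrow> 'a alter_ego \<Rightarrow> 'a frel \<Rightarrow> ('a list \<Rightarrow> 'a, 'a) tstruct" where
  "sharp_struct M T r = \<lparr>univ = clo_fun M T r,
     opI = (\<lambda>h xs. if xs \<in> sharp M T r (dom h) then Some (on_rel r (\<lambda>zs. the (h zs)) xs) else None),
     relI = (\<lambda>s. sharp M T r s),
     topo = discrete_topology (clo_fun M T r)\<rparr>"

lemma sharp_struct_simps [simp]:
  "univ (sharp_struct M T r) = clo_fun M T r"
  "opI (sharp_struct M T r) h xs =
     (if xs \<in> sharp M T r (dom h) then Some (on_rel r (\<lambda>zs. the (h zs)) xs) else None)"
  "relI (sharp_struct M T r) s = sharp M T r s"
  "topo (sharp_struct M T r) = discrete_topology (clo_fun M T r)"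
  by (simp_all add: sharp_struct_def)

lemma on_rel_cong:
  assumes "\<And>zs. zs \<in> r \<Longrightarrow> f (map (\<lambda>x. x zs) xs) = g (map (\<lambda>x. x zs) ys)"
  shows "on_rel r f xs = on_rel r g ys"
  unfolding on_rel_def using assms by (rule restrict_ext)

lemma map_rows: "\<forall>i\<in>set is. i < length xs \<Longrightarrow>
    map (\<lambda>x. x z) (map (\<lambda>i. xs ! i) is) = map (\<lambda>i. map (\<lambda>x. x z) xs ! i) is"
  by simp

text \<open>By \<open>op_graph_hom\<close> every homomorphism on the graph acts as one on the
  domain, so its value is already known to be a clone function.\<close>

lemma sharp_op_graph:
  assumes h: "compat_op M h" and xs: "xs \<in> sharp M T r (dom h)"
    and y: "y = on_rel r (\<lambda>zs. the (h zs)) xs" and yX: "y \<in> clo_fun M T r"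
  shows "xs @ [y] \<in> sharp M T r (op_graph h)"
proof -
  have rows: "map (\<lambda>x. x zs) (xs @ [y]) = map (\<lambda>x. x zs) xs @ [the (h (map (\<lambda>x. x zs) xs))]"
    if "zs \<in> r" for zs
    using that by (simp add: y on_rel_def)
  have dom: "\<And>zs. zs \<in> r \<Longrightarrow> map (\<lambda>x. x zs) xs \<in> dom h" using xs by (simp add: sharp_def)
  have "on_rel r f (xs @ [y]) \<in> clo_fun M T r" if f: "f \<in> rel_homs M (op_graph h)" for f
  proof -
    have "on_rel r f (xs @ [y]) = on_rel r (\<lambda>zs\<in>dom h. f (zs @ [the (h zs)])) xs"
      by (rule on_rel_cong) (use rows dom in simp)
    then show ?thesis using op_graph_hom[OF h f] xs by (simp add: sharp_def)
  qed
  moreover have "map (\<lambda>x. x zs) (xs @ [y]) \<in> op_graph h" if "zs \<in> r" for zs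
    unfolding rows[OF that] using dom[OF that] by auto
  moreover have "xs @ [y] \<in> tuples (clo_fun M T r) (rel_arity (op_graph h))"
    using xs yX rel_arity_op_graph[OF h] by (simp add: sharp_def tuples_def)
  ultimately show ?thesis unfolding sharp_def by blast
qed

text \<open>Both kinds of pure premise put selected variables into a compatible relation, either a
  basic relation or a graph. The inductions along \<open>natural_prem\<close> then have a single
  case.\<close>

lemma pure_premD:
  assumes S: "is_alter_ego M S" and \<alpha>: "pure_prem \<alpha>" "wf_atom n \<alpha>" "in_lang S \<alpha>"
  obtains s "is" where "compat_rel M s" "length is = rel_arity s" "\<forall>i\<in>set is. i < n"
    "\<And>zs. holds (self_struct M) zs \<alpha> \<longleftrightarrow> map (\<lambda>i. zs ! i) is \<in> s"
    "\<And>en \<beta> k \<alpha>s. natural_prem en \<beta> k (\<alpha> # \<alpha>s) =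
       (let (k', \<alpha>s') = natural_prem en \<beta> (k + length (en s)) \<alpha>s
        in (k', beta_inst en \<beta> k s (map Var is) @ \<alpha>s'))"
    "\<And>T r xs. set xs \<subseteq> clo_fun M T r \<Longrightarrow> n \<le> length xs \<Longrightarrow>
       holds (sharp_struct M T r) xs \<alpha> \<Longrightarrow> map (\<lambda>i. xs ! i) is \<in> sharp M T r s"
proof -
  consider s "is" where "\<alpha> = Rel s (map Var is)" | h "is" j where "\<alpha> = Eq (App h (map Var is)) (Var j)"
    using \<alpha>(1) unfolding pure_prem_def by blast
  then show thesis
  proof cases
    case 1
    have "s \<in> rels S" using \<alpha>(3) 1 by (auto simp: in_lang_def)
    then have "compat_rel M s" by (rule is_alter_egoD(1)[OF S])
    moreover have "length is = rel_arity s" "\<forall>i\<in>set is. i < n"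
      using \<alpha>(2) 1 by (auto simp: list_all_iff)
    ultimately show ?thesis
      by (intro that[of s "is"]) (simp_all add: 1 holds_pure_simps del: holds.simps)
  next
    case 2
    have h: "h \<in> ops S" using \<alpha>(3) 2 by (auto simp: in_lang_def)
    have c: "compat_op M h" by (rule is_alter_egoD(2)[OF S h])
    have lt: "\<forall>i\<in>set is. i < n" "j < n" using \<alpha>(2) 2 by (auto simp: list_all_iff)
    show ?thesis
    proof (rule that[of "op_graph h" "is @ [j]"])
      show "compat_rel M (op_graph h)" using c by (simp add: compat_op_def)
      show "length (is @ [j]) = rel_arity (op_graph h)" "\<forall>i\<in>set (is @ [j]). i < n"
        using \<alpha>(2) 2 lt rel_arity_op_graph[OF c] by simp_all
      show "holds (self_struct M) zs \<alpha> \<longleftrightarrow> map (\<lambda>i. zs ! i) (is @ [j]) \<in> op_graph h" for zs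
        unfolding 2 holds_pure_simps by simp
      show "natural_prem en \<beta> k (\<alpha> # \<alpha>s) =
         (let (k', \<alpha>s') = natural_prem en \<beta> (k + length (en (op_graph h))) \<alpha>s
          in (k', beta_inst en \<beta> k (op_graph h) (map Var (is @ [j])) @ \<alpha>s'))" for en \<beta> k \<alpha>s
        unfolding 2 by simp
      fix T r and xs :: "('a list \<Rightarrow> 'a) list"
      assume xs: "set xs \<subseteq> clo_fun M T r" "n \<le> length xs" and hd: "holds (sharp_struct M T r) xs \<alpha>"
      have sh: "map (\<lambda>i. xs ! i) is \<in> sharp M T r (dom h)"
        and y: "xs ! j = on_rel r (\<lambda>zs. the (h zs)) (map (\<lambda>i. xs ! i) is)"
        using hd unfolding 2 holds_pure_simps by (auto split: if_splits)
      have "xs ! j \<in> clo_fun M T r" using lt(2) xs(2) by (intro subsetD[OF xs(1)] nth_mem) simp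
      from sharp_op_graph[OF c sh y this]
      show "map (\<lambda>i. xs ! i) (is @ [j]) \<in> sharp M T r (op_graph h)" by simp
    qed
  qed
qed

lemma natural_prem_ca:
  assumes S: "is_alter_ego M S" and hc: "hat_choice M T en \<beta>"
    and \<alpha>s: "\<And>\<alpha>. \<alpha> \<in> set \<alpha>s \<Longrightarrow> pure_prem \<alpha> \<and> wf_atom n \<alpha> \<and> in_lang S \<alpha>"
    and "n \<le> k" "natural_prem en \<beta> k \<alpha>s = (k', \<alpha>s')"
  shows "k \<le> k' \<and> ca_formula T k' \<alpha>s'"
  using \<alpha>s assms(4-)
proof (induction \<alpha>s arbitrary: k k' \<alpha>s')
  case Nil
  then show ?case by (simp add: ca_formula_def)
next
  case (Cons \<alpha> \<alpha>s)
  have "pure_prem \<alpha>" "wf_atom n \<alpha>" "in_lang S \<alpha>" using Cons.prems(1) by simp_all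
  then obtain r "is" where r: "compat_rel M r" "length is = rel_arity r" "\<forall>i\<in>set is. i < n"
    "\<And>k \<alpha>s. natural_prem en \<beta> k (\<alpha> # \<alpha>s) =
       (let (k', \<alpha>s') = natural_prem en \<beta> (k + length (en r)) \<alpha>s
        in (k', beta_inst en \<beta> k r (map Var is) @ \<alpha>s'))"
    using pure_premD[OF S] by metis
  obtain \<gamma>s where \<gamma>s: "natural_prem en \<beta> (k + length (en r)) \<alpha>s = (k', \<gamma>s)"
    "\<alpha>s' = beta_inst en \<beta> k r (map Var is) @ \<gamma>s"
    using Cons.prems(3) unfolding r(4) by (auto simp: Let_def split: prod.splits)
  have IH: "k + length (en r) \<le> k' \<and> ca_formula T k' \<gamma>s"
    using Cons.IH[OF _ _ \<gamma>s(1)] Cons.prems(1,2) by simp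
  have "ca_formula T (k + length (en r)) (beta_inst en \<beta> k r (map Var is))"
    using r(3) Cons.prems(2) by (intro ca_formula_beta_inst[OF hc r(1,2)]) auto
  then have "ca_formula T k' (beta_inst en \<beta> k r (map Var is))"
    using IH wf_atom_mono unfolding ca_formula_def by blast
  then show ?case using IH unfolding \<gamma>s(2) by (auto simp: ca_formula_def)
qed

text \<open>A tuple of \<open>rel_hat\<close> begins with a member of the original relation, so
  forgetting the added variables leaves the original premise.\<close>

lemma natural_prem_sound:
  assumes S: "is_alter_ego M S" and hc: "hat_choice M T en \<beta>"
    and \<alpha>s: "\<And>\<alpha>. \<alpha> \<in> set \<alpha>s \<Longrightarrow> pure_prem \<alpha> \<and> wf_atom n \<alpha> \<and> in_lang S \<alpha>"
    and "n \<le> k" "natural_prem en \<beta> k \<alpha>s = (k', \<alpha>s')"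
    and zs: "zs \<in> tuples (carrier M) k'"
    and "\<And>\<alpha>. \<alpha> \<in> set \<alpha>s' \<Longrightarrow> holds (self_struct M) zs \<alpha>"
  shows "\<forall>\<alpha>\<in>set \<alpha>s. holds (self_struct M) zs \<alpha>"
  using \<alpha>s assms(4,5,7)
proof (induction \<alpha>s arbitrary: k \<alpha>s')
  case Nil
  then show ?case by simp
next
  case (Cons \<alpha> \<alpha>s)
  have "pure_prem \<alpha>" "wf_atom n \<alpha>" "in_lang S \<alpha>" using Cons.prems(1) by simp_all
  then obtain r "is" where r: "compat_rel M r" "length is = rel_arity r" "\<forall>i\<in>set is. i < n"
    "\<And>k \<alpha>s. natural_prem en \<beta> k (\<alpha> # \<alpha>s) =
       (let (k', \<alpha>s') = natural_prem en \<beta> (k + length (en r)) \<alpha>s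
        in (k', beta_inst en \<beta> k r (map Var is) @ \<alpha>s'))"
    "\<And>zs. holds (self_struct M) zs \<alpha> \<longleftrightarrow> map (\<lambda>i. zs ! i) is \<in> r"
    using pure_premD[OF S] by metis
  obtain \<gamma>s where \<gamma>s: "natural_prem en \<beta> (k + length (en r)) \<alpha>s = (k', \<gamma>s)"
    "\<alpha>s' = beta_inst en \<beta> k r (map Var is) @ \<gamma>s"
    using Cons.prems(3) unfolding r(4) by (auto simp: Let_def split: prod.splits)
  have "k + length (en r) \<le> k'"
    using natural_prem_ca[OF S hc _ _ \<gamma>s(1), where n = n] Cons.prems(1,2) by simp
  moreover have "\<forall>i\<in>set is. i < k" using r(3) Cons.prems(2) by fastforce
  ultimately have "map (\<lambda>i. zs ! i) is @ map (\<lambda>i. zs ! i) [k..<k + length (en r)] \<in> rel_hat (en r) r"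
    using holds_beta_inst_iff[OF hc r(1,2), of k zs] zs Cons.prems(4) \<gamma>s(2)
    by (auto simp: tuples_def)
  then have "holds (self_struct M) zs \<alpha>"
    unfolding r(5) using rel_hat_iff[OF r(1)] r(2) by simp
  moreover have "\<forall>\<alpha>\<in>set \<alpha>s. holds (self_struct M) zs \<alpha>"
    using Cons.IH[OF _ _ \<gamma>s(1)] Cons.prems(1,2,4) \<gamma>s(2) by simp
  ultimately show ?case by simp
qed

context fin_alg
begin

section \<open>Morphisms on the structure of clone functions\<close>

lemma sharp_opI_closed:
  assumes h: "compat_op M h" and xs: "xs \<in> sharp M T r (dom h)"
  shows "on_rel r (\<lambda>zs. the (h zs)) xs \<in> clo_fun M T r"
proof -
  have "on_rel r (\<lambda>zs. the (h zs)) xs = on_rel r (\<lambda>zs\<in>dom h. the (h zs)) xs"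
    by (rule on_rel_cong) (use xs in \<open>simp add: sharp_def\<close>)
  then show ?thesis using xs h by (simp add: sharp_def compat_op_iff)
qed

lemma is_struct_sharp:
  assumes S: "is_alter_ego M S"
  shows "is_struct S (sharp_struct M T r)"
  unfolding is_struct_def
proof (intro conjI ballI)
  fix h assume h: "h \<in> ops S"
  show "dom (opI (sharp_struct M T r) h) \<subseteq> tuples (univ (sharp_struct M T r)) (op_arity h)"
    by (auto simp: sharp_def split: if_splits)
  show "ran (opI (sharp_struct M T r) h) \<subseteq> univ (sharp_struct M T r)"
    using sharp_opI_closed[OF is_alter_egoD(2)[OF S h]] by (auto simp: ran_def split: if_splits)
next
  fix s show "relI (sharp_struct M T r) s \<subseteq> tuples (univ (sharp_struct M T r)) (rel_arity s)"
    by (auto simp: sharp_def)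
qed

text \<open>Membership in \<open>sharp\<close> includes pointwise membership, and operations are
  computed pointwise, so evaluation at a member of \<open>r\<close> respects everything. These
  evaluations separate the clone functions.\<close>

lemma sharp_eval:
  assumes S: "is_alter_ego M S" and zs: "zs \<in> r"
  shows "(\<lambda>x\<in>clo_fun M T r. x zs) \<in> morphs M S (sharp_struct M T r)"
proof -
  let ?Z = "sharp_struct M T r"
  let ?e = "\<lambda>x\<in>clo_fun M T r. x zs"
  have d: "topo ?Z = discrete_topology (univ ?Z)" by simp
  have me: "map ?e xs = map (\<lambda>x. x zs) xs" if "xs \<in> sharp M T r s" for xs s
    using that by (auto simp: sharp_def tuples_def)
  show ?thesis
    unfolding str_hom_self_iff[OF d]
  proof (intro conjI ballI allI impI)
    have "x zs \<in> carrier M" if "x \<in> clo_fun M T r" for x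
      using PiE_mem[OF subsetD[OF clo_fun_subset that] zs] .
    then show "?e \<in> univ ?Z \<rightarrow>\<^sub>E carrier M" by simp
    show "map ?e xs \<in> s" if "xs \<in> relI ?Z s" for s xs
    proof -
      have xs: "xs \<in> sharp M T r s" using that by simp
      show ?thesis unfolding me[OF xs] using xs zs by (simp add: sharp_def)
    qed
    fix h xs y assume h: "h \<in> ops S" and "opI ?Z h xs = Some y"
    then have xs: "xs \<in> sharp M T r (dom h)" and y: "y = on_rel r (\<lambda>zs. the (h zs)) xs"
      by (auto split: if_splits)
    have "y \<in> clo_fun M T r" unfolding y by (rule sharp_opI_closed[OF is_alter_egoD(2)[OF S h] xs])
    then have "?e y = the (h (map (\<lambda>x. x zs) xs))" using zs by (simp add: y on_rel_def)
    moreover have "map (\<lambda>x. x zs) xs \<in> dom h" using xs zs by (simp add: sharp_def)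
    ultimately show "h (map ?e xs) = Some (?e y)" unfolding me[OF xs] by auto
  qed
qed

text \<open>Richness extends every homomorphism from \<open>s\<close> to the clone, so the clause of
  \<open>sharp\<close> on homomorphisms follows from the pointwise one.\<close>

lemma sharp_if_rich:
  assumes T: "is_alter_ego M T" and r: "compat_rel M r" and s: "compat_rel M s"
    and rich: "\<And>h. compat_op M h \<Longrightarrow> dom h = s \<Longrightarrow> has_extension M T h"
    and xs: "xs \<in> tuples (clo_fun M T r) (rel_arity s)"
    and pw: "\<And>zs. zs \<in> r \<Longrightarrow> map (\<lambda>x. x zs) xs \<in> s"
  shows "xs \<in> sharp M T r s"
proof -
  have "on_rel r f xs \<in> clo_fun M T r" if f: "f \<in> rel_homs M s" for f
  proof -
    have "on_rel r (\<lambda>zs. the (op_of s f zs)) xs \<in> clo_fun M T r"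
      using xs pw s by (intro clo_fun_has_extension[OF T r rich[OF compat_op_op_of[OF s f]]]) simp_all
    moreover have "on_rel r (\<lambda>zs. the (op_of s f zs)) xs = on_rel r f xs"
      by (rule on_rel_cong) (use pw in \<open>simp add: op_of_def\<close>)
    ultimately show ?thesis by simp
  qed
  then show ?thesis using xs pw by (simp add: sharp_def)
qed

text \<open>Applied with \<open>M0\<close> for \<open>S\<close>: for its symbols the structure is
  interpreted pointwise, which allows conclusions in the language of \<open>M0\<close> to be lifted
  from \<open>M\<close>.\<close>

lemma full_on_sharp:
  assumes T: "is_alter_ego M T" and S: "is_alter_ego M S" and r: "compat_rel M r"
    and rich: "\<And>h. compat_op M h \<Longrightarrow> dom h \<in> rels S \<union> dom ` ops S \<Longrightarrow> has_extension M T h"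
  shows "full_on M S r (sharp_struct M T r)"
  unfolding full_on_def
proof (intro conjI ballI impI)
  show "univ (sharp_struct M T r) \<subseteq> r \<rightarrow>\<^sub>E carrier M" by (simp add: clo_fun_subset)
  fix h xs assume h: "h \<in> ops S" and xs: "xs \<in> tuples (univ (sharp_struct M T r)) (op_arity h)"
    and pw: "\<forall>i\<in>r. map (\<lambda>x. x i) xs \<in> dom h"
  have s: "xs \<in> sharp M T r (dom h)"
    using xs pw h by (intro sharp_if_rich[OF T r is_alter_egoD(3)[OF S h] rich]) auto
  then show "opI (sharp_struct M T r) h xs = Some (\<lambda>i\<in>r. the (h (map (\<lambda>x. x i) xs)))"
    by (simp add: on_rel_def)
  show "(\<lambda>i\<in>r. the (h (map (\<lambda>x. x i) xs))) \<in> univ (sharp_struct M T r)"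
    using sharp_opI_closed[OF is_alter_egoD(2)[OF S h] s] by (simp add: on_rel_def)
next
  fix s xs assume s: "s \<in> rels S" and xs: "xs \<in> tuples (univ (sharp_struct M T r)) (rel_arity s)"
    and pw: "\<forall>i\<in>r. map (\<lambda>x. x i) xs \<in> s"
  show "xs \<in> relI (sharp_struct M T r) s"
    using xs pw s unfolding sharp_struct_simps
    by (intro sharp_if_rich[OF T r is_alter_egoD(1)[OF S s] rich]) auto
qed

lemma clo_fun_eqI:
  assumes "x \<in> clo_fun M T r" "y \<in> r \<rightarrow>\<^sub>E carrier M" "\<And>zs. zs \<in> r \<Longrightarrow> x zs = y zs"
  shows "x = y"
  using assms(3) by (rule PiE_ext[OF subsetD[OF clo_fun_subset assms(1)] assms(2)])

text \<open>A homomorphism from \<open>s'\<close>, pulled back to the hom-minimal relation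
  \<open>s\<close>, is a projection. Its value at the selected entries is therefore itself an entry
  of \<open>xs\<close>, hence a clone function.\<close>

lemma sharp_hom_minimal:
  assumes s: "hom_minimal M s" and s': "compat_rel M s'" and len: "length is = rel_arity s'"
    and lt: "\<forall>i\<in>set is. i < rel_arity s" and sub: "\<And>zs. zs \<in> s \<Longrightarrow> map (\<lambda>i. zs ! i) is \<in> s'"
    and xs: "xs \<in> tuples (clo_fun M T r) (rel_arity s)"
    and pw: "\<And>zs. zs \<in> r \<Longrightarrow> map (\<lambda>x. x zs) xs \<in> s"
  shows "map (\<lambda>i. xs ! i) is \<in> sharp M T r s'"
proof -
  have sc: "compat_rel M s" using s by (simp add: hom_minimal_def)
  have lx: "length xs = rel_arity s" and xX: "set xs \<subseteq> clo_fun M T r" using xs by (auto simp: tuples_def)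
  have rows: "map (\<lambda>x. x zs) (map (\<lambda>i. xs ! i) is) = map (\<lambda>i. map (\<lambda>x. x zs) xs ! i) is" for zs
    using lt lx by (intro map_rows) simp
  have "on_rel r f (map (\<lambda>i. xs ! i) is) \<in> clo_fun M T r" if f: "f \<in> rel_homs M s'" for f
  proof -
    obtain j where j: "j < rel_arity s" "\<And>zs. zs \<in> s \<Longrightarrow> f (map (\<lambda>i. zs ! i) is) = zs ! j"
      using rel_hom_pullback[OF sc f len lt sub] s unfolding hom_minimal_def by fastforce
    have xj: "xs ! j \<in> clo_fun M T r" using j(1) lx by (intro subsetD[OF xX] nth_mem) simp
    have "xs ! j = on_rel r f (map (\<lambda>i. xs ! i) is)"
    proof (rule clo_fun_eqI[OF xj])
      have v: "f (map (\<lambda>x. x zs) (map (\<lambda>i. xs ! i) is)) = (xs ! j) zs" if "zs \<in> r" for zs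
        unfolding rows j(2)[OF pw[OF that]] using j(1) lx by simp
      show "on_rel r f (map (\<lambda>i. xs ! i) is) \<in> r \<rightarrow>\<^sub>E carrier M"
        using v PiE_mem[OF subsetD[OF clo_fun_subset xj]] by (simp add: on_rel_def)
      show "(xs ! j) zs = on_rel r f (map (\<lambda>i. xs ! i) is) zs" if "zs \<in> r" for zs
        using v that by (simp add: on_rel_def)
    qed
    then show ?thesis using xj by simp
  qed
  moreover have "map (\<lambda>x. x zs) (map (\<lambda>i. xs ! i) is) \<in> s'" if "zs \<in> r" for zs
    unfolding rows by (rule sub[OF pw[OF that]])
  moreover have "map (\<lambda>i. xs ! i) is \<in> tuples (clo_fun M T r) (rel_arity s')"
  proof -
    have "xs ! i \<in> clo_fun M T r" if "i \<in> set is" for i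
      using that lt lx by (intro subsetD[OF xX] nth_mem) simp
    then show ?thesis using len by (auto simp: tuples_def)
  qed
  ultimately show ?thesis unfolding sharp_def by blast
qed

text \<open>The relation \<open>s\<close> need not be in the signature of \<open>S\<close>, so a
  morphism does not preserve it by definition. It does preserve the atoms that hold at
  \<open>xs\<close>; by \<open>sharp_hom_minimal\<close> these include every pure premise atom and
  variable equation over \<open>S\<close> true throughout \<open>s\<close>, and by
  \<open>hom_minimal_memI\<close> such atoms confine \<open>map u xs\<close> to
  \<open>s\<close>.\<close>

lemma sharp_hom_preserves_hom_minimal:
  assumes S: "is_alter_ego M S" and dual: "dualises_fin M S" and s: "hom_minimal M s"
    and u: "u \<in> morphs M S (sharp_struct M T r)"
    and xs: "xs \<in> tuples (clo_fun M T r) (rel_arity s)"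
    and pw: "\<And>zs. zs \<in> r \<Longrightarrow> map (\<lambda>x. x zs) xs \<in> s"
  shows "map u xs \<in> s"
proof (rule hom_minimal_memI[OF S dual s])
  have sc: "compat_rel M s" using s by (simp add: hom_minimal_def)
  have lx: "length xs = rel_arity s" and xX: "set xs \<subseteq> clo_fun M T r" using xs by (auto simp: tuples_def)
  have xj: "xs ! j \<in> clo_fun M T r" if "j < rel_arity s" for j using lx that by (intro subsetD[OF xX] nth_mem) simp
  show "map u xs \<in> tuples (carrier M) (rel_arity s)"
    using str_hom_in_carrier[OF u] xX lx by (auto simp: tuples_def)
  fix \<alpha> assume wf: "wf_atom (rel_arity s) \<alpha>" and lang: "in_lang S \<alpha>"
    and p: "pure_prem \<alpha> \<or> (\<exists>i j. \<alpha> = Eq (Var i) (Var j))"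
    and tr: "\<And>zs. zs \<in> s \<Longrightarrow> holds (self_struct M) zs \<alpha>"
  have pe: "xs ! j = y" if j: "j < rel_arity s" and y: "y \<in> r \<rightarrow>\<^sub>E carrier M"
    and e: "\<And>zs. zs \<in> r \<Longrightarrow> map (\<lambda>x. x zs) xs ! j = y zs" for j y
    using e j lx by (intro clo_fun_eqI[OF xj[OF j] y]) simp
  consider s' "is" where "\<alpha> = Rel s' (map Var is)" | h "is" j where "\<alpha> = Eq (App h (map Var is)) (Var j)"
    | i j where "\<alpha> = Eq (Var i) (Var j)"
    using p unfolding pure_prem_def by blast
  then have "holds (sharp_struct M T r) xs \<alpha>"
  proof cases
    case 1
    have s': "s' \<in> rels S" using lang 1 by (auto simp: in_lang_def)
    have "length is = rel_arity s'" "\<forall>i\<in>set is. i < rel_arity s"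
      using wf 1 by (auto simp: list_all_iff)
    then have "map (\<lambda>i. xs ! i) is \<in> sharp M T r s'"
    proof (rule sharp_hom_minimal[OF s is_alter_egoD(1)[OF S s'] _ _ _ xs pw])
      show "map (\<lambda>i. zs ! i) is \<in> s'" if "zs \<in> s" for zs
        using tr[OF that] unfolding 1 holds_pure_simps by simp
    qed
    then show ?thesis unfolding 1 holds_pure_simps by simp
  next
    case 2
    have h: "h \<in> ops S" using lang 2 by (auto simp: in_lang_def)
    have l: "length is = op_arity h" "\<forall>i\<in>set is. i < rel_arity s" and j: "j < rel_arity s"
      using wf 2 by (auto simp: list_all_iff)
    have hv: "h (map (\<lambda>i. zs ! i) is) = Some (zs ! j)" if "zs \<in> s" for zs
      using tr[OF that] unfolding 2 holds_pure_simps by simp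
    have sh: "map (\<lambda>i. xs ! i) is \<in> sharp M T r (dom h)"
    proof (rule sharp_hom_minimal[OF s is_alter_egoD(3)[OF S h] l _ xs pw])
      show "map (\<lambda>i. zs ! i) is \<in> dom h" if "zs \<in> s" for zs using hv[OF that] by blast
    qed
    have "xs ! j = on_rel r (\<lambda>zs. the (h zs)) (map (\<lambda>i. xs ! i) is)"
    proof (rule pe[OF j])
      show "on_rel r (\<lambda>zs. the (h zs)) (map (\<lambda>i. xs ! i) is) \<in> r \<rightarrow>\<^sub>E carrier M"
        using sharp_opI_closed[OF is_alter_egoD(2)[OF S h] sh] clo_fun_subset by blast
      fix zs assume zs: "zs \<in> r"
      have "map (\<lambda>x. x zs) (map (\<lambda>i. xs ! i) is) = map (\<lambda>i. map (\<lambda>x. x zs) xs ! i) is"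
        using l(2) lx by (intro map_rows) simp
      then have "h (map (\<lambda>x. x zs) (map (\<lambda>i. xs ! i) is)) = Some (map (\<lambda>x. x zs) xs ! j)"
        using hv[OF pw[OF zs]] by (simp only:)
      then show "map (\<lambda>x. x zs) xs ! j = on_rel r (\<lambda>zs. the (h zs)) (map (\<lambda>i. xs ! i) is) zs"
        using zs by (simp add: on_rel_def del: map_map)
    qed
    then show ?thesis unfolding 2 holds_pure_simps using sh by simp
  next
    case 3
    have ij: "i < rel_arity s" "j < rel_arity s" using wf 3 by auto
    have "xs ! i = xs ! j"
    proof (rule pe[OF ij(1)])
      show "xs ! j \<in> r \<rightarrow>\<^sub>E carrier M" using xj[OF ij(2)] clo_fun_subset by blast
      fix zs assume "zs \<in> r"
      then show "map (\<lambda>x. x zs) xs ! i = (xs ! j) zs"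
        using tr[OF pw] ij lx unfolding 3 holds_pure_simps by simp
    qed
    then show ?thesis unfolding 3 holds_pure_simps .
  qed
  then show "holds (self_struct M) (map u xs) \<alpha>"
    using preserves_holds[OF str_hom_preserves[OF u]] wf lang lx by simp
qed

text \<open>Membership in \<open>R_alpha\<close> enters here: \<open>r\<close> is cut out by
  hom-minimal relations and equalities, and a morphism respects each of them at the projections,
  whose row at \<open>zs\<close> is \<open>zs\<close> itself.\<close>

lemma sharp_hom_projs:
  assumes S: "is_alter_ego M S" and dual: "dualises_fin M S" and r: "r \<in> R_alpha M"
    and u: "u \<in> morphs M S (sharp_struct M T r)"
  shows "map u (projs r) \<in> r"
proof -
  note rc = R_alpha_compat[OF r]
  have pX: "set (projs r) \<subseteq> clo_fun M T r" by (rule set_projs[OF rc])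
  have pj: "projs r ! i \<in> clo_fun M T r" if "i < rel_arity r" for i
    using that by (intro subsetD[OF pX] nth_mem) (simp add: projs_simps)
  obtain \<Delta> where \<Delta>: "r = conj_rel M (rel_arity r) \<Delta>"
    "\<And>s is. (s, is) \<in> \<Delta> \<Longrightarrow> (hom_minimal M s \<or> s = diag M) \<and> length is = rel_arity s
        \<and> (\<forall>i\<in>set is. i < rel_arity r)"
    using R_alphaE[OF r] by blast
  have "map (\<lambda>i. map u (projs r) ! i) is \<in> s" if si: "(s, is) \<in> \<Delta>" for s "is"
  proof -
    have l: "length is = rel_arity s" "\<forall>i\<in>set is. i < rel_arity r" using \<Delta>(2)[OF si] by auto
    let ?ys = "map (\<lambda>i. projs r ! i) is"
    have ys: "?ys \<in> tuples (clo_fun M T r) (rel_arity s)"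
      using l pj by (auto simp: tuples_def)
    have row: "map (\<lambda>x. x zs) ?ys = map (\<lambda>i. zs ! i) is" if "zs \<in> r" for zs
    proof -
      have "map (\<lambda>x. x zs) ?ys = map (\<lambda>i. map (\<lambda>x. x zs) (projs r) ! i) is"
        using l(2) by (intro map_rows) (simp add: projs_simps)
      then show ?thesis unfolding projs_simps(2)[OF that rc] .
    qed
    have pw: "map (\<lambda>x. x zs) ?ys \<in> s" if "zs \<in> r" for zs
      unfolding row[OF that] using that \<Delta>(1) si by (auto simp: conj_rel_def)
    have "map u ?ys \<in> s"
    proof (cases "hom_minimal M s")
      case True
      then show ?thesis by (rule sharp_hom_preserves_hom_minimal[OF S dual _ u ys pw])
    next
      case False
      then have s: "s = diag M" using \<Delta>(2)[OF si] by blast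
      then have "length is = 2" using l(1) by (simp add: rel_arity_diag)
      then obtain i j where ij: "is = [i, j]" by (auto simp: numeral_2_eq_2 length_Suc_conv)
      have "projs r ! i = projs r ! j"
      proof (rule clo_fun_eqI)
        show "projs r ! i \<in> clo_fun M T r" "projs r ! j \<in> r \<rightarrow>\<^sub>E carrier M"
          using pj[of i] pj[of j] subsetD[OF clo_fun_subset] l(2) ij by auto
        show "(projs r ! i) zs = (projs r ! j) zs" if "zs \<in> r" for zs
          using pw[OF that] s ij by (auto simp: diag_def)
      qed
      moreover have "u (projs r ! i) \<in> carrier M"
        using str_hom_in_carrier[OF u] pj[of i] l(2) ij by simp
      ultimately show ?thesis unfolding s ij by (simp add: diag_def)
    qed
    moreover have "map u ?ys = map (\<lambda>i. map u (projs r) ! i) is"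
      using l(2) by (simp add: projs_simps)
    ultimately show ?thesis by (simp only:)
  qed
  moreover have "map u (projs r) \<in> tuples (carrier M) (rel_arity r)"
    using str_hom_in_carrier[OF u] pX by (auto simp: tuples_def projs_simps)
  ultimately show ?thesis by (subst \<Delta>(1)) (auto simp: conj_rel_def)
qed


text \<open>Clone functions for the added variables come from the definition of
  \<open>sharp\<close>: they are the values, at the arguments of each premise, of the homomorphisms
  from its relation.\<close>

lemma natural_prem_complete:
  assumes S: "is_alter_ego M S" and hc: "hat_choice M T0 en \<beta>"
    and \<alpha>s: "\<And>\<alpha>. \<alpha> \<in> set \<alpha>s \<Longrightarrow> pure_prem \<alpha> \<and> wf_atom n \<alpha> \<and> in_lang S \<alpha>"
    and "n \<le> k" "natural_prem en \<beta> k \<alpha>s = (k', \<alpha>s')"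
    and "set xs \<subseteq> clo_fun M T r" "length xs = k"
    and "\<And>\<alpha>. \<alpha> \<in> set \<alpha>s \<Longrightarrow> holds (sharp_struct M T r) xs \<alpha>"
  shows "\<exists>ws. set ws \<subseteq> clo_fun M T r \<and> length (xs @ ws) = k' \<and>
     (\<forall>zs\<in>r. \<forall>\<alpha>\<in>set \<alpha>s'. holds (self_struct M) (map (\<lambda>x. x zs) (xs @ ws)) \<alpha>)"
  using \<alpha>s assms(4-)
proof (induction \<alpha>s arbitrary: k \<alpha>s' xs)
  case Nil
  then show ?case by (intro exI[of _ "[]"]) simp
next
  case (Cons \<alpha> \<alpha>s)
  let ?X = "clo_fun M T r"
  have "pure_prem \<alpha>" "wf_atom n \<alpha>" "in_lang S \<alpha>" using Cons.prems(1) by simp_all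
  then obtain s "is" where s: "compat_rel M s" "length is = rel_arity s" "\<forall>i\<in>set is. i < n"
    "\<And>k \<alpha>s. natural_prem en \<beta> k (\<alpha> # \<alpha>s) =
       (let (k', \<alpha>s') = natural_prem en \<beta> (k + length (en s)) \<alpha>s
        in (k', beta_inst en \<beta> k s (map Var is) @ \<alpha>s'))"
    "\<And>xs. set xs \<subseteq> clo_fun M T r \<Longrightarrow> n \<le> length xs \<Longrightarrow>
       holds (sharp_struct M T r) xs \<alpha> \<Longrightarrow> map (\<lambda>i. xs ! i) is \<in> sharp M T r s"
    by (rule pure_premD[OF S]) blast
  let ?m = "length (en s)"
  obtain \<gamma>s where \<gamma>s: "natural_prem en \<beta> (k + ?m) \<alpha>s = (k', \<gamma>s)"
    "\<alpha>s' = beta_inst en \<beta> k s (map Var is) @ \<gamma>s"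
    using Cons.prems(3) unfolding s(4) by (auto simp: Let_def split: prod.splits)
  define ys where "ys = map (\<lambda>i. xs ! i) is"
  have sh: "ys \<in> sharp M T r s"
    unfolding ys_def using Cons.prems(2,4-6) by (intro s(5)) simp_all
  define vs where "vs = map (\<lambda>f. on_rel r f ys) (en s)"
  have vX: "set vs \<subseteq> ?X" using sh hat_choiceD(1)[OF hc s(1)] by (auto simp: vs_def sharp_def)
  have "\<exists>ws. set ws \<subseteq> ?X \<and> length ((xs @ vs) @ ws) = k' \<and>
     (\<forall>zs\<in>r. \<forall>\<alpha>\<in>set \<gamma>s. holds (self_struct M) (map (\<lambda>x. x zs) ((xs @ vs) @ ws)) \<alpha>)"
  proof (rule Cons.IH[OF _ _ \<gamma>s(1)])
    show "pure_prem \<alpha> \<and> wf_atom n \<alpha> \<and> in_lang S \<alpha>" if "\<alpha> \<in> set \<alpha>s" for \<alpha>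
      using Cons.prems(1) that by simp
    show "n \<le> k + ?m" using Cons.prems(2) by simp
    show "set (xs @ vs) \<subseteq> ?X" using Cons.prems(4) vX by simp
    show "length (xs @ vs) = k + ?m" using Cons.prems(5) by (simp add: vs_def)
    fix \<gamma> assume \<gamma>: "\<gamma> \<in> set \<alpha>s"
    \<comment> \<open>The remaining premises mention only the original variables, so appending
      \<open>vs\<close> does not affect them.\<close>
    have "wf_atom (length xs) \<gamma>" using Cons.prems(1,2,5) \<gamma> wf_atom_mono by auto
    then show "holds (sharp_struct M T r) (xs @ vs) \<gamma>"
      using Cons.prems(6) \<gamma> by (simp add: holds_append)
  qed
  then obtain ws where ws: "set ws \<subseteq> ?X" "length ((xs @ vs) @ ws) = k'"
     "\<And>zs \<alpha>. zs \<in> r \<Longrightarrow> \<alpha> \<in> set \<gamma>s \<Longrightarrow> holds (self_struct M) (map (\<lambda>x. x zs) ((xs @ vs) @ ws)) \<alpha>"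
    by blast
  have "holds (self_struct M) (map (\<lambda>x. x zs) (xs @ vs @ ws)) \<gamma>"
    if zs: "zs \<in> r" and \<gamma>: "\<gamma> \<in> set (beta_inst en \<beta> k s (map Var is))" for zs \<gamma>
  proof -
    let ?row = "map (\<lambda>x. x zs) (xs @ vs @ ws)"
    have lt: "\<forall>i\<in>set is. i < k" using s(3) Cons.prems(2) by fastforce
    have "x zs \<in> carrier M" if "x \<in> ?X" for x
      using PiE_mem[OF subsetD[OF clo_fun_subset that] zs] .
    then have c: "set ?row \<subseteq> carrier M" using Cons.prems(4) vX ws(1) by auto
    have l: "k + ?m \<le> length ?row" using Cons.prems(5) by (simp add: vs_def)
    have 1: "map (\<lambda>i. ?row ! i) is = map (\<lambda>x. x zs) ys"
      using lt Cons.prems(5) by (auto simp: ys_def nth_append)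
    have 2: "map (\<lambda>i. ?row ! i) [k..<k + ?m] = map (\<lambda>f. f (map (\<lambda>x. x zs) ys)) (en s)"
      using Cons.prems(5) zs by (intro nth_equalityI) (auto simp: vs_def nth_append on_rel_def)
    have "map (\<lambda>x. x zs) ys \<in> s" using sh zs by (simp add: sharp_def)
    then have "map (\<lambda>i. ?row ! i) is @ map (\<lambda>i. ?row ! i) [k..<k + ?m] \<in> rel_hat (en s) s"
      unfolding 1 2 rel_hat_def by blast
    then show ?thesis using holds_beta_inst_iff[OF hc s(1,2) lt c l] \<gamma> by blast
  qed
  then have "\<forall>zs\<in>r. \<forall>\<alpha>\<in>set \<alpha>s'. holds (self_struct M) (map (\<lambda>x. x zs) (xs @ vs @ ws)) \<alpha>"
    using ws(3) unfolding \<gamma>s(2) by auto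
  then show ?case using vX ws(1,2) by (intro exI[of _ "vs @ ws"]) simp
qed

text \<open>This hides the case distinction in \<open>new_domain\<close>: if the premise is in the
  language of \<open>S0\<close>, no variables are added and pointwise truth is enough; otherwise
  they are those of \<open>natural\<close>. The last clause leads from a premise true of clone
  functions to arguments for operations with the new domain.\<close>

lemma new_domain_formula:
  assumes S0: "is_alter_ego M S0" and S: "is_alter_ego M S" and hc: "hat_choice M S0 en \<beta>"
    and \<phi>: "uH_sentence S \<phi>" "pure \<phi>"
  obtains k \<alpha>s where "nvars \<phi> \<le> k" "ca_formula S0 k \<alpha>s"
    "new_domain M S0 en \<beta> \<phi> = defined_rel (self_struct M) k \<alpha>s"
    "\<And>zs. zs \<in> new_domain M S0 en \<beta> \<phi> \<Longrightarrow> take (nvars \<phi>) zs \<in> pr (self_struct M) \<phi>"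
    "\<And>T r xs. xs \<in> pr (sharp_struct M T r) \<phi> \<Longrightarrow> set xs \<subseteq> clo_fun M T r \<Longrightarrow>
       (\<And>zs. zs \<in> r \<Longrightarrow> map (\<lambda>x. x zs) xs \<in> pr (self_struct M) \<phi>) \<Longrightarrow>
       \<exists>ws. set ws \<subseteq> clo_fun M T r \<and> length (xs @ ws) = k \<and>
         (\<forall>zs\<in>r. map (\<lambda>x. x zs) (xs @ ws) \<in> new_domain M S0 en \<beta> \<phi>)"
proof (cases "prem_in_lang S0 \<phi>")
  case True
  let ?N = "nvars \<phi>"
  have D: "new_domain M S0 en \<beta> \<phi> = pr (self_struct M) \<phi>" using True by (simp add: new_domain_def)
  show ?thesis
  proof (rule that[of ?N "prem \<phi>"])
    show "ca_formula S0 ?N (prem \<phi>)"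
      using \<phi>(1) True by (auto simp: uH_sentence_def ca_formula_def prem_in_lang_def)
    show "new_domain M S0 en \<beta> \<phi> = defined_rel (self_struct M) ?N (prem \<phi>)"
      unfolding D pr_def ..
    show "take ?N zs \<in> pr (self_struct M) \<phi>" if "zs \<in> new_domain M S0 en \<beta> \<phi>" for zs
      using that unfolding D by (auto simp: pr_def defined_rel_def tuples_def)
    fix T r and xs :: "('a list \<Rightarrow> 'a) list"
    assume "xs \<in> pr (sharp_struct M T r) \<phi>"
      and "\<And>zs. zs \<in> r \<Longrightarrow> map (\<lambda>x. x zs) xs \<in> pr (self_struct M) \<phi>"
    then show "\<exists>ws. set ws \<subseteq> clo_fun M T r \<and> length (xs @ ws) = ?N \<and>
         (\<forall>zs\<in>r. map (\<lambda>x. x zs) (xs @ ws) \<in> new_domain M S0 en \<beta> \<phi>)"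
      unfolding D by (intro exI[of _ "[]"]) (auto simp: pr_def defined_rel_def tuples_def)
  qed simp
next
  case False
  let ?N = "nvars \<phi>"
  obtain k \<alpha>s where n: "natural_prem en \<beta> ?N (prem \<phi>) = (k, \<alpha>s)" by fastforce
  have D: "new_domain M S0 en \<beta> \<phi> = defined_rel (self_struct M) k \<alpha>s"
    using False n by (simp add: new_domain_def natural_def pr_def)
  have p: "pure_prem \<alpha> \<and> wf_atom ?N \<alpha> \<and> in_lang S \<alpha>" if "\<alpha> \<in> set (prem \<phi>)" for \<alpha>
    using \<phi> that by (auto simp: pure_def uH_sentence_def ca_formula_def)
  have kc: "?N \<le> k \<and> ca_formula S0 k \<alpha>s"
    by (rule natural_prem_ca[OF S hc p order_refl n])
  show ?thesis
  proof (rule that[of k \<alpha>s])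
    show "?N \<le> k" "ca_formula S0 k \<alpha>s" using kc by simp_all
    show "new_domain M S0 en \<beta> \<phi> = defined_rel (self_struct M) k \<alpha>s" by (rule D)
    show "take ?N zs \<in> pr (self_struct M) \<phi>" if "zs \<in> new_domain M S0 en \<beta> \<phi>" for zs
    proof -
      have zs: "zs \<in> tuples (carrier M) k" "\<And>\<alpha>. \<alpha> \<in> set \<alpha>s \<Longrightarrow> holds (self_struct M) zs \<alpha>"
        using that unfolding D by (auto simp: defined_rel_def)
      have "take ?N zs \<in> tuples (carrier M) ?N"
        using zs(1) kc set_take_subset[of ?N zs] by (auto simp: tuples_def)
      moreover have "holds (self_struct M) (take ?N zs) \<alpha>" if \<alpha>: "\<alpha> \<in> set (prem \<phi>)" for \<alpha>
      proof -
        have "holds (self_struct M) zs \<alpha>"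
          using natural_prem_sound[OF S hc p order_refl n zs] \<alpha> by blast
        then have "holds (self_struct M) (take ?N zs @ drop ?N zs) \<alpha>" by simp
        moreover have "wf_atom (length (take ?N zs)) \<alpha>"
          using p[OF \<alpha>] zs(1) kc by (simp add: tuples_def)
        ultimately show ?thesis using holds_append by blast
      qed
      ultimately show ?thesis by (simp add: pr_def defined_rel_def)
    qed
    fix T r and xs :: "('a list \<Rightarrow> 'a) list"
    assume xs: "xs \<in> pr (sharp_struct M T r) \<phi>" "set xs \<subseteq> clo_fun M T r"
    have "length xs = ?N" "\<And>\<alpha>. \<alpha> \<in> set (prem \<phi>) \<Longrightarrow> holds (sharp_struct M T r) xs \<alpha>"
      using xs(1) by (auto simp: pr_def defined_rel_def tuples_def)
    from natural_prem_complete[OF S hc p order_refl n xs(2) this]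
    obtain ws where ws: "set ws \<subseteq> clo_fun M T r" "length (xs @ ws) = k"
     "\<And>zs \<alpha>. zs \<in> r \<Longrightarrow> \<alpha> \<in> set \<alpha>s \<Longrightarrow> holds (self_struct M) (map (\<lambda>x. x zs) (xs @ ws)) \<alpha>"
      by blast
    have "map (\<lambda>x. x zs) (xs @ ws) \<in> tuples (carrier M) k" if zs: "zs \<in> r" for zs
    proof -
      have "x zs \<in> carrier M" if "x \<in> clo_fun M T r" for x
        using PiE_mem[OF subsetD[OF clo_fun_subset that] zs] .
      then show ?thesis using xs(2) ws(1,2) by (auto simp: tuples_def)
    qed
    then show "\<exists>ws. set ws \<subseteq> clo_fun M T r \<and> length (xs @ ws) = k \<and>
         (\<forall>zs\<in>r. map (\<lambda>x. x zs) (xs @ ws) \<in> new_domain M S0 en \<beta> \<phi>)"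
      using ws unfolding D by (intro exI[of _ ws]) (simp add: defined_rel_def del: map_append)
  qed
qed

section \<open>Truth of the basis in the structure of clone functions\<close>

lemma pr_sharp_pointwise:
  assumes S: "is_alter_ego M S" and \<phi>: "uH_sentence S \<phi>" and xs: "xs \<in> pr (sharp_struct M T r) \<phi>"
    and zs: "zs \<in> r"
  shows "map (\<lambda>x. x zs) xs \<in> pr (self_struct M) \<phi>"
proof -
  let ?e = "\<lambda>x\<in>clo_fun M T r. x zs"
  have xX: "set xs \<subseteq> clo_fun M T r" and len: "length xs = nvars \<phi>"
    and h: "\<And>\<alpha>. \<alpha> \<in> set (prem \<phi>) \<Longrightarrow> holds (sharp_struct M T r) xs \<alpha>"
    using xs by (auto simp: pr_def defined_rel_def tuples_def)
  have me: "map ?e xs = map (\<lambda>x. x zs) xs" using xX by auto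
  have "holds (self_struct M) (map (\<lambda>x. x zs) xs) \<alpha>" if \<alpha>: "\<alpha> \<in> set (prem \<phi>)" for \<alpha>
  proof -
    have "wf_atom (length xs) \<alpha>" "in_lang S \<alpha>"
      using \<phi> \<alpha> len by (auto simp: uH_sentence_def ca_formula_def)
    from preserves_holds[OF str_hom_preserves[OF sharp_eval[OF S zs]] this h[OF \<alpha>]]
    show ?thesis unfolding me .
  qed
  moreover have "x zs \<in> carrier M" if "x \<in> clo_fun M T r" for x
    using PiE_mem[OF subsetD[OF clo_fun_subset that] zs] .
  then have "map (\<lambda>x. x zs) xs \<in> tuples (carrier M) (nvars \<phi>)"
    using xX len by (auto simp: tuples_def)
  ultimately show ?thesis by (simp add: pr_def defined_rel_def)
qed

text \<open>Evaluations carry the premise to \<open>M\<close>, where the sentence yields its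
  conclusion in every coordinate. Richness makes the symbols of \<open>S0\<close> pointwise, so the
  conclusion lifts back.\<close>

lemma sharp_models_if_concl_in_lang:
  assumes S0: "is_alter_ego M S0" and S: "is_alter_ego M S" and T: "is_alter_ego M T"
    and r: "compat_rel M r"
    and rich: "\<And>h. compat_op M h \<Longrightarrow> dom h \<in> rels S0 \<union> dom ` ops S0 \<Longrightarrow> has_extension M T h"
    and \<phi>: "uH_sentence S \<phi>" "models (self_struct M) \<phi>" "concl_in_lang S0 \<phi>"
  shows "models (sharp_struct M T r) \<phi>"
  unfolding models_def
proof
  fix xs assume xs: "xs \<in> pr (sharp_struct M T r) \<phi>"
  have xX: "set xs \<subseteq> clo_fun M T r" and len: "length xs = nvars \<phi>"
    using xs by (auto simp: pr_def defined_rel_def tuples_def)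
  have pw: "case concl \<phi> of None \<Rightarrow> False | Some \<gamma> \<Rightarrow> holds (self_struct M) (map (\<lambda>x. x zs) xs) \<gamma>"
    if "zs \<in> r" for zs
    using pr_sharp_pointwise[OF S \<phi>(1) xs that] \<phi>(2) unfolding models_def by blast
  \<comment> \<open>For the conclusion \<open>None\<close> one coordinate gives the contradiction:
    the premise would be satisfied in \<open>M\<close>.\<close>
  obtain zs0 where zs0: "zs0 \<in> r" using compat_relD(1)[OF r] by blast
  show "case concl \<phi> of None \<Rightarrow> False | Some \<gamma> \<Rightarrow> holds (sharp_struct M T r) xs \<gamma>"
  proof (cases "concl \<phi>")
    case None
    then show ?thesis using pw[OF zs0] by simp
  next
    case (Some \<gamma>)
    have "holds (sharp_struct M T r) xs \<gamma>"
    proof (rule full_on_holds[OF full_on_sharp[OF T S0 r rich]])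
      show "set xs \<subseteq> univ (sharp_struct M T r)" using xX by simp
      show "wf_atom (length xs) \<gamma>" using \<phi>(1) Some len by (simp add: uH_sentence_def)
      show "in_lang S0 \<gamma>" using \<phi>(3) Some by (simp add: concl_in_lang_def)
      show "holds (self_struct M) (map (\<lambda>x. x i) xs) \<gamma>" if "i \<in> r" for i
        using pw[OF that] Some by simp
    qed
    then show ?thesis using Some by simp
  qed
qed

text \<open>The new operations enter here. Pointwise truth of the conclusion comes from
  \<open>M\<close>; in addition every homomorphism \<open>f\<close> from the concluding relation
  must take the arguments to a clone function. Pulled back to the new domain, \<open>f\<close>
  becomes a compatible operation with that domain, hence extends to the clone, and is applied to
  \<open>xs @ ws\<close>.\<close>

lemma sharp_models_pure:
  assumes S0: "is_alter_ego M S0" and S: "is_alter_ego M S" and T: "is_alter_ego M T"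
    and r: "compat_rel M r" and hc: "hat_choice M S0 en \<beta>"
    and rich: "\<And>h. compat_op M h \<Longrightarrow> dom h = new_domain M S0 en \<beta> \<phi> \<Longrightarrow> has_extension M T h"
    and \<phi>: "uH_sentence S \<phi>" "pure \<phi>" "models (self_struct M) \<phi>" "\<not> concl_in_lang S0 \<phi>"
  shows "models (sharp_struct M T r) \<phi>"
  unfolding models_def
proof
  fix xs assume xs: "xs \<in> pr (sharp_struct M T r) \<phi>"
  let ?N = "nvars \<phi>" and ?X = "clo_fun M T r"
  have xX: "set xs \<subseteq> ?X" and len: "length xs = ?N"
    using xs by (auto simp: pr_def defined_rel_def tuples_def)
  obtain zs0 where zs0: "zs0 \<in> r" using compat_relD(1)[OF r] by blast
  define D where "D = new_domain M S0 en \<beta> \<phi>"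
  obtain k \<alpha>s where k: "?N \<le> k" "ca_formula S0 k \<alpha>s" "D = defined_rel (self_struct M) k \<alpha>s"
    "\<And>zs. zs \<in> D \<Longrightarrow> take ?N zs \<in> pr (self_struct M) \<phi>"
    "\<exists>ws. set ws \<subseteq> ?X \<and> length (xs @ ws) = k \<and> (\<forall>zs\<in>r. map (\<lambda>x. x zs) (xs @ ws) \<in> D)"
    using new_domain_formula[OF S0 S hc \<phi>(1,2)] xs xX pr_sharp_pointwise[OF S \<phi>(1) xs]
    unfolding D_def by metis
  then obtain ws where ws: "set ws \<subseteq> ?X" "length (xs @ ws) = k"
    "\<And>zs. zs \<in> r \<Longrightarrow> map (\<lambda>x. x zs) (xs @ ws) \<in> D"
    by blast
  \<comment> \<open>No operation has an empty domain. This case does not arise once the premise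
    holds at \<open>xs\<close>, since \<open>r\<close> is nonempty.\<close>
  have Dne: "D \<noteq> {}" using ws(3)[OF zs0] by blast
  then have "D \<in> Rel_ca M S0" using k(2,3) unfolding Rel_ca_def by blast
  then have Dc: "compat_rel M D" by (rule Rel_ca_compat[OF S0])
  have Dar: "rel_arity D = k" using ws(3)[OF zs0] defined_rel_arity unfolding k(3) by blast
  have key: "map (\<lambda>i. xs ! i) is \<in> sharp M T r s"
    if s: "compat_rel M s" and l: "length is = rel_arity s" "\<forall>i\<in>set is. i < ?N"
      and tr: "\<And>zs. zs \<in> pr (self_struct M) \<phi> \<Longrightarrow> map (\<lambda>i. zs ! i) is \<in> s" for s "is"
  proof -
    let ?ys = "map (\<lambda>i. xs ! i) is"
    have row: "map (\<lambda>x. x zs) ?ys = map (\<lambda>i. map (\<lambda>x. x zs) (xs @ ws) ! i) is" for zs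
      using l(2) len by (auto simp: nth_append)
    have sub: "map (\<lambda>i. zs ! i) is \<in> s" if zs: "zs \<in> D" for zs
    proof -
      have "map (\<lambda>i. take ?N zs ! i) is = map (\<lambda>i. zs ! i) is" using l(2) by simp
      then show ?thesis using tr[OF k(4)[OF zs]] by (simp only:)
    qed
    have "on_rel r f ?ys \<in> ?X" if f: "f \<in> rel_homs M s" for f
    proof -
      define g where "g = op_of D (\<lambda>zs\<in>D. f (map (\<lambda>i. zs ! i) is))"
      have "(\<lambda>zs\<in>D. f (map (\<lambda>i. zs ! i) is)) \<in> rel_homs M D"
        using l(2) Dar k(1) by (intro rel_hom_pullback[OF Dc f l(1) _ sub]) auto
      then have "compat_op M g" unfolding g_def by (rule compat_op_op_of[OF Dc])
      moreover have dg: "dom g = D" by (simp add: g_def)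
      ultimately have "has_extension M T g" by (intro rich) (simp_all add: D_def)
      then have "on_rel r (\<lambda>zs. the (g zs)) (xs @ ws) \<in> ?X"
        using ws xX Dar dg Dc by (intro clo_fun_has_extension[OF T r]) (simp_all add: tuples_def)
      moreover have "on_rel r (\<lambda>zs. the (g zs)) (xs @ ws) = on_rel r f ?ys"
      proof (rule on_rel_cong)
        fix zs assume "zs \<in> r"
        then show "the (g (map (\<lambda>x. x zs) (xs @ ws))) = f (map (\<lambda>x. x zs) ?ys)"
          using ws(3) unfolding row by (simp add: g_def op_of_def del: map_append)
      qed
      ultimately show ?thesis by simp
    qed
    moreover have "map (\<lambda>x. x zs) ?ys \<in> s" if "zs \<in> r" for zs
      unfolding row by (rule sub[OF ws(3)[OF that]])
    moreover have "?ys \<in> tuples ?X (rel_arity s)"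
    proof -
      have "xs ! i \<in> ?X" if "i \<in> set is" for i
        using that l(2) len by (intro subsetD[OF xX] nth_mem) simp
      then show ?thesis using l(1) by (auto simp: tuples_def)
    qed
    ultimately show ?thesis unfolding sharp_def by blast
  qed
  obtain \<gamma> where \<gamma>: "concl \<phi> = Some \<gamma>" "\<not> in_lang S0 \<gamma>"
    using \<phi>(4) by (auto simp: concl_in_lang_def)
  have wf: "wf_atom ?N \<gamma>" "in_lang S \<gamma>" using \<phi>(1) \<gamma>(1) by (auto simp: uH_sentence_def)
  have tr: "holds (self_struct M) zs \<gamma>" if "zs \<in> pr (self_struct M) \<phi>" for zs
    using \<phi>(3) that \<gamma>(1) unfolding models_def by fastforce
  \<comment> \<open>An equation between variables contains no symbols and so lies in the language of
    \<open>S0\<close>; falsity was excluded in the same way when \<open>\<gamma>\<close> was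
    obtained.\<close>
  have "\<not> (\<exists>i j. \<gamma> = Eq (Var i) (Var j))" using \<gamma>(2) by (auto simp: in_lang_def)
  then consider s "is" where "\<gamma> = Rel s (map Var is)"
    | h "is" where "\<gamma> = Eq (App h (map Var is)) (App h (map Var is))"
    using \<phi>(2) \<gamma>(1) unfolding pure_def pure_concl_def by auto
  then have "holds (sharp_struct M T r) xs \<gamma>"
  proof cases
    case 1
    have s: "s \<in> rels S" using wf(2) 1 by (auto simp: in_lang_def)
    have "map (\<lambda>i. xs ! i) is \<in> sharp M T r s"
    proof (rule key[OF is_alter_egoD(1)[OF S s]])
      show "length is = rel_arity s" "\<forall>i\<in>set is. i < ?N" using wf(1) 1 by (auto simp: list_all_iff)
      show "map (\<lambda>i. zs ! i) is \<in> s" if "zs \<in> pr (self_struct M) \<phi>" for zs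
        using tr[OF that] unfolding 1 holds_pure_simps by simp
    qed
    then show ?thesis unfolding 1 holds_pure_simps by simp
  next
    case 2
    have h: "h \<in> ops S" using wf(2) 2 by (auto simp: in_lang_def)
    have "map (\<lambda>i. xs ! i) is \<in> sharp M T r (dom h)"
    proof (rule key[OF is_alter_egoD(3)[OF S h]])
      show "length is = op_arity h" "\<forall>i\<in>set is. i < ?N" using wf(1) 2 by (auto simp: list_all_iff)
      show "map (\<lambda>i. zs ! i) is \<in> dom h" if "zs \<in> pr (self_struct M) \<phi>" for zs
        using tr[OF that] unfolding 2 holds_pure_simps by simp
    qed
    then show ?thesis unfolding 2 holds_pure_simps by (simp add: domIff)
  qed
  then show "case concl \<phi> of None \<Rightarrow> False | Some \<gamma> \<Rightarrow> holds (sharp_struct M T r) xs \<gamma>"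
    using \<gamma>(1) by simp
qed

section \<open>From truth of the basis to separation by morphisms\<close>

text \<open>\<open>uH_implies\<close> and \<open>uH_equivalent\<close> quantify over structures on
  natural numbers without a topology; \<open>copy_struct\<close> followed by \<open>truncate\<close>
  leads there, and \<open>models_if_retract\<close> compares the sentences.\<close>

lemma nat_copy_models:
  fixes X :: "('x, 'a) tstruct"
  assumes X: "is_struct S X" and finX: "finite (univ X)"
  obtains Y :: "(nat, 'a) struct" where "is_struct S Y"
    "\<And>\<phi>. uH_sentence S \<phi> \<Longrightarrow> models Y \<phi> \<longleftrightarrow> models X \<phi>"
proof -
  obtain b :: "'x \<Rightarrow> nat" where inj: "inj_on b (univ X)"
    using finite_imp_inj_to_nat_seg[OF finX] by blast
  let ?C = "copy_struct b X"
  let ?c = "inv_into (univ X) b"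
  let ?Y = "struct.truncate ?C"
  note C = copy_struct[OF X inj]
  have uY: "univ ?Y = b ` univ X" and oY: "opI ?Y = opI ?C" and rY: "relI ?Y = relI ?C"
    by (simp_all add: struct.truncate_def)
  show thesis
  proof (rule that[of ?Y])
    show "is_struct S ?Y" using C(1) unfolding is_struct_def uY oY rY by simp
    have p: "preserves S X ?Y b" "preserves S ?Y X ?c"
      using C(5,6) unfolding preserves_def oY rY by simp_all
    fix \<phi> assume \<phi>: "uH_sentence S \<phi>"
    show "models ?Y \<phi> \<longleftrightarrow> models X \<phi>"
    proof
      assume "models ?Y \<phi>"
      then show "models X \<phi>"
        using inj by (intro models_if_retract[OF p _ _ \<phi>]) (simp_all add: uY)
    next
      assume "models X \<phi>"
      then show "models ?Y \<phi>"
        using inj by (intro models_if_retract[OF p(2,1) _ _ \<phi>]) (auto simp: uY f_inv_into_f)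
    qed
  qed
qed

lemma is_struct_self:
  assumes S: "is_alter_ego M S"
  shows "is_struct S (self_struct M)"
  unfolding is_struct_def self_struct_simps
proof (intro conjI ballI)
  fix h assume h: "h \<in> ops S"
  show "dom h \<subseteq> tuples (carrier M) (op_arity h)"
    by (rule compat_relD(2)[OF is_alter_egoD(3)[OF S h]])
  show "ran h \<subseteq> carrier M"
    using compat_op_ran[OF is_alter_egoD(2)[OF S h]] by (auto simp: ran_def)
qed (rule compat_relD(2)[OF is_alter_egoD(1)[OF S]])

text \<open>If an atomic formula fails in \<open>Z\<close> at an enumeration of \<open>Z\<close>, then the sentence \<open>diagram \<longrightarrow> formula\<close>
  fails in \<open>Z\<close>, hence in \<open>M\<close>, and a tuple of \<open>M\<close> witnessing this is a morphism \<open>Z \<rightarrow> M\<close>.\<close>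

lemma separated_if_models:
  assumes Z1: "is_struct S Z" and d: "topo Z = discrete_topology (univ Z)"
    and finZ: "finite (univ Z)" and ne: "morphs M S Z \<noteq> {}"
    and pts: "\<And>x y. x \<in> univ Z \<Longrightarrow> y \<in> univ Z \<Longrightarrow>
      (\<And>u. u \<in> morphs M S Z \<Longrightarrow> u x = u y) \<Longrightarrow> x = y"
    and th: "\<And>\<sigma>. uH_sentence S \<sigma> \<Longrightarrow> models (self_struct M) \<sigma> \<Longrightarrow> models Z \<sigma>"
  shows "separated M S Z"
proof -
  let ?H = "morphs M S Z"
  obtain xs where xs: "set xs = univ Z" "distinct xs" using finite_distinct_list[OF finZ] by blast
  define n where "n = length xs"
  define ix where "ix x = (SOME i. i < n \<and> xs ! i = x)" for x
  have ix: "ix x < n" "xs ! ix x = x" if "x \<in> univ Z" for x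
  proof -
    have "\<exists>i<n. xs ! i = x" using that xs(1) by (metis in_set_conv_nth n_def)
    then have "ix x < n \<and> xs ! ix x = x" unfolding ix_def by (rule someI_ex)
    then show "ix x < n" "xs ! ix x = x" by auto
  qed
  have nthx: "map (\<lambda>i. xs ! i) (map ix ys) = ys" if "set ys \<subseteq> univ Z" for ys
    using that ix(2) by (auto intro!: map_idI)
  have key: "\<exists>u\<in>?H. \<not> holds (self_struct M) (map u xs) \<alpha>"
    if \<alpha>: "wf_atom n \<alpha>" "in_lang S \<alpha>" "\<not> holds Z xs \<alpha>" for \<alpha>
  proof -
    \<comment> \<open>The positive diagram of \<open>Z\<close> at the enumeration. Finitely many of
      its formulas have the same solutions in \<open>M\<close> and form the premise of
      \<open>\<sigma>\<close>.\<close>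
    define \<Delta> where "\<Delta> = {\<gamma>. wf_atom n \<gamma> \<and> in_lang S \<gamma> \<and> holds Z xs \<gamma>}"
    obtain \<Delta>' where \<Delta>': "\<Delta>' \<subseteq> \<Delta>" "finite \<Delta>'"
      "{a \<in> tuples (carrier M) n. \<forall>\<gamma>\<in>\<Delta>'. holds (self_struct M) a \<gamma>}
        = {a \<in> tuples (carrier M) n. \<forall>\<gamma>\<in>\<Delta>. holds (self_struct M) a \<gamma>}"
      using finite_subset_same_filter[OF finite_tuples[OF fin, of n], of \<Delta>
        "\<lambda>a \<alpha>. holds (self_struct M) a \<alpha>"]
      by metis
    obtain \<gamma>s where \<gamma>s: "set \<gamma>s = \<Delta>'" using finite_list[OF \<Delta>'(2)] by blast
    define \<sigma> where "\<sigma> = Sentence n \<gamma>s (Some \<alpha>)"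
    have "uH_sentence S \<sigma>"
      using \<Delta>'(1) \<gamma>s \<alpha> by (auto simp: uH_sentence_def ca_formula_def \<sigma>_def \<Delta>_def)
    moreover have "xs \<in> pr Z \<sigma>"
      using \<Delta>'(1) \<gamma>s xs(1) by (auto simp: pr_def defined_rel_def tuples_def \<sigma>_def n_def \<Delta>_def)
    then have "\<not> models Z \<sigma>" using \<alpha>(3) by (auto simp: models_def \<sigma>_def)
    ultimately have "\<not> models (self_struct M) \<sigma>" using th by blast
    then obtain a where a: "a \<in> tuples (carrier M) n" "\<forall>\<gamma>\<in>\<Delta>'. holds (self_struct M) a \<gamma>"
      "\<not> holds (self_struct M) a \<alpha>"
      using \<gamma>s by (auto simp: models_def pr_def defined_rel_def \<sigma>_def)
    have a\<Delta>: "holds (self_struct M) a \<gamma>" if "wf_atom n \<gamma>" "in_lang S \<gamma>" "holds Z xs \<gamma>" for \<gamma>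
    proof -
      have "a \<in> {a \<in> tuples (carrier M) n. \<forall>\<gamma>\<in>\<Delta>. holds (self_struct M) a \<gamma>}"
        unfolding \<Delta>'(3)[symmetric] using a(1,2) by blast
      then show ?thesis using that by (simp add: \<Delta>_def)
    qed
    define u where "u = (\<lambda>x\<in>univ Z. a ! ix x)"
    have mu: "map u ys = map (\<lambda>i. a ! i) (map ix ys)" if "set ys \<subseteq> univ Z" for ys
      using that by (auto simp: u_def)
    have wfV: "list_all (wf_term n) (map Var (map ix ys))" if "set ys \<subseteq> univ Z" for ys
      using that ix(1) by (auto simp: list_all_iff)
    have "u \<in> ?H"
      unfolding str_hom_self_iff[OF d]
    proof (intro conjI ballI allI impI)
      show "u \<in> univ Z \<rightarrow>\<^sub>E carrier M" using a(1) ix(1) by (auto simp: u_def tuples_def)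
      fix s ys assume s: "s \<in> rels S" and ys: "ys \<in> relI Z s"
      have yt: "set ys \<subseteq> univ Z" "length ys = rel_arity s"
        using is_structD(1)[OF Z1 s ys] by (auto simp: tuples_def)
      have "holds (self_struct M) a (Rel s (map Var (map ix ys)))"
      proof (rule a\<Delta>)
        show "wf_atom n (Rel s (map Var (map ix ys)))" using yt(2) wfV[OF yt(1)] by simp
        show "in_lang S (Rel s (map Var (map ix ys)))" using s by (auto simp: in_lang_def)
        show "holds Z xs (Rel s (map Var (map ix ys)))"
          unfolding holds_pure_simps nthx[OF yt(1)] by (rule ys)
      qed
      then show "map u ys \<in> s" unfolding holds_pure_simps mu[OF yt(1)] by simp
    next
      fix h ys y assume h: "h \<in> ops S" and ys: "opI Z h ys = Some y"
      have yt: "set ys \<subseteq> univ Z" "length ys = op_arity h" and y: "y \<in> univ Z"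
        using is_structD(2,3)[OF Z1 h ys] by (auto simp: tuples_def)
      have "holds (self_struct M) a (Eq (App h (map Var (map ix ys))) (Var (ix y)))"
      proof (rule a\<Delta>)
        show "wf_atom n (Eq (App h (map Var (map ix ys))) (Var (ix y)))"
          using yt(2) wfV[OF yt(1)] ix(1)[OF y] by simp
        show "in_lang S (Eq (App h (map Var (map ix ys))) (Var (ix y)))"
          using h by (auto simp: in_lang_def)
        show "holds Z xs (Eq (App h (map Var (map ix ys))) (Var (ix y)))"
          unfolding holds_pure_simps nthx[OF yt(1)] ix(2)[OF y] by (rule ys)
      qed
      then show "h (map u ys) = Some (u y)"
        unfolding holds_pure_simps mu[OF yt(1)] using y by (simp add: u_def)
    qed
    \<comment> \<open>The enumeration has no repetitions, so the index chosen for
      \<open>xs ! i\<close> is \<open>i\<close>.\<close>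
    moreover have "map u xs = a"
    proof (rule nth_equalityI)
      show "length (map u xs) = length a" using a(1) by (simp add: tuples_def n_def)
      fix i assume "i < length (map u xs)"
      then have i: "i < length xs" by simp
      then have xi: "xs ! i \<in> univ Z" using xs(1) nth_mem by blast
      then have "ix (xs ! i) = i"
        using ix[OF xi] i nth_eq_iff_index_eq[OF xs(2)] by (simp add: n_def)
      then show "map u xs ! i = a ! i" using i xi by (simp add: u_def)
    qed
    ultimately show ?thesis using a(3) by (intro bexI[of _ u]) simp_all
  qed
  have mx: "map (\<lambda>i. map u xs ! i) (map ix ys) = map u ys" if "set ys \<subseteq> univ Z" for u :: "'b \<Rightarrow> 'a" and ys
    using that ix by (auto simp: n_def)
  have wfV: "list_all (wf_term n) (map Var (map ix ys))" if "set ys \<subseteq> univ Z" for ys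
    using that ix(1) by (auto simp: list_all_iff)
  show ?thesis
    unfolding separated_def
  proof (intro conjI ballI impI)
    show "is_struct S Z" "topo Z = discrete_topology (univ Z)" "?H \<noteq> {}" by (fact Z1, fact d, fact ne)
    show "x = y" if "x \<in> univ Z" "y \<in> univ Z" "\<forall>u\<in>?H. u x = u y" for x y
      using pts that by blast
  next
    fix s ys assume s: "s \<in> rels S" and ys: "ys \<in> tuples (univ Z) (rel_arity s)"
      and m: "\<forall>u\<in>?H. map u ys \<in> s"
    have yX: "set ys \<subseteq> univ Z" "length ys = rel_arity s" using ys by (auto simp: tuples_def)
    let ?\<alpha> = "Rel s (map Var (map ix ys))"
    have "wf_atom n ?\<alpha>" using yX(2) wfV[OF yX(1)] by simp
    moreover have "in_lang S ?\<alpha>" using s by (auto simp: in_lang_def)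
    moreover have "holds (self_struct M) (map u xs) ?\<alpha>" if "u \<in> ?H" for u
      unfolding holds_pure_simps mx[OF yX(1)] using m that by simp
    ultimately have "holds Z xs ?\<alpha>" using key by blast
    then show "ys \<in> relI Z s" unfolding holds_pure_simps nthx[OF yX(1)] .
  next
    fix h ys assume h: "h \<in> ops S" and ys: "ys \<in> tuples (univ Z) (op_arity h)"
      and m: "\<forall>u\<in>?H. map u ys \<in> dom h"
    have yX: "set ys \<subseteq> univ Z" "length ys = op_arity h" using ys by (auto simp: tuples_def)
    \<comment> \<open>Definedness as an equation of a term with itself makes reflection of domains
      another instance of \<open>key\<close>.\<close>
    let ?\<alpha> = "Eq (App h (map Var (map ix ys))) (App h (map Var (map ix ys)))"
    have "wf_atom n ?\<alpha>" using yX(2) wfV[OF yX(1)] by simp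
    moreover have "in_lang S ?\<alpha>" using h by (auto simp: in_lang_def)
    moreover have "holds (self_struct M) (map u xs) ?\<alpha>" if "u \<in> ?H" for u
      unfolding holds_pure_simps mx[OF yX(1)] using m that by simp
    ultimately have "holds Z xs ?\<alpha>" using key by blast
    then show "ys \<in> dom (opI Z h)" unfolding holds_pure_simps nthx[OF yX(1)] .
  qed
qed

text \<open>Relations and domains are reflected because truth of the basis gives truth of the whole
  universal Horn theory; points are separated by the evaluations.\<close>

lemma sharp_separated:
  assumes S: "is_alter_ego M S" and r: "compat_rel M r" and basis: "uH_basis M S \<Sigma>"
    and models: "\<And>\<psi>. \<psi> \<in> \<Sigma> \<Longrightarrow> models (sharp_struct M T r) \<psi>"
  shows "separated M S (sharp_struct M T r)"
proof (rule separated_if_models)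
  let ?Z = "sharp_struct M T r"
  have finZ: "finite (univ ?Z)" using finite_clo_fun[OF r] by simp
  show Z1: "is_struct S ?Z" by (rule is_struct_sharp[OF S])
  show "topo ?Z = discrete_topology (univ ?Z)" by simp
  show "finite (univ ?Z)" by (rule finZ)
  obtain zs0 where "zs0 \<in> r" using compat_relD(1)[OF r] by blast
  then show "morphs M S ?Z \<noteq> {}" using sharp_eval[OF S] by blast
  show "x = y" if x: "x \<in> univ ?Z" and y: "y \<in> univ ?Z"
    and eq: "\<And>u. u \<in> morphs M S ?Z \<Longrightarrow> u x = u y" for x y
  proof (rule clo_fun_eqI)
    show "x \<in> clo_fun M T r" "y \<in> r \<rightarrow>\<^sub>E carrier M" using x y subsetD[OF clo_fun_subset] by simp_all
    show "x zs = y zs" if "zs \<in> r" for zs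
      using eq[OF sharp_eval[OF S that]] x y by simp
  qed
  fix \<sigma> assume \<sigma>: "uH_sentence S \<sigma>" "models (self_struct M) \<sigma>"
  obtain Y :: "(nat, 'a) struct" where Y: "is_struct S Y"
    "\<And>\<phi>. uH_sentence S \<phi> \<Longrightarrow> models Y \<phi> \<longleftrightarrow> models ?Z \<phi>"
    using nat_copy_models[OF Z1 finZ] by blast
  have "uH_implies S \<Sigma> \<sigma>" using basis \<sigma> unfolding uH_basis_def by blast
  moreover have "\<forall>\<psi>\<in>\<Sigma>. models Y \<psi>" using Y(2) basis models unfolding uH_basis_def by blast
  ultimately have "models Y \<sigma>" using Y(1) unfolding uH_implies_def by blast
  then show "models ?Z \<sigma>" using Y(2)[OF \<sigma>(1)] by simp
qed

end

section \<open>Structural equivalence with \<open>M_alpha\<close>\<close>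

theorem mainTheorem6:
  fixes M :: "('a, 'f) algebra"
    and M0 M1 M2 :: "'a alter_ego"
    and \<Sigma>1 :: "'a uH set"
    and en :: "'a frel \<Rightarrow> ('a list \<Rightarrow> 'a) list"
    and \<beta> :: "'a frel \<Rightarrow> 'a atm list"
    and conv :: "'a uH \<Rightarrow> 'a uH set"
  assumes "is_algebra M" and "finite (carrier M)"
    and "is_alter_ego M M0"
    and "dualises_fin M M0"
    and "\<forall>r \<in> rels M0 \<union> dom ` ops M0. operationally_rich M M0 r"
    and "reduct M0 (M_alpha M)"
    and "is_alter_ego M M1"
    and "fully_dualises_fin M M1"
    and "finite \<Sigma>1" and "uH_basis M M1 \<Sigma>1"
    and "hat_choice M M0 en \<beta>"
    and "pure_conversion M0 M1 \<Sigma>1 conv"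
    and "M2 = M_two M M0 en \<beta> conv \<Sigma>1"
  shows "is_alter_ego M M2 \<and> structurally_equivalent M M2 (M_alpha M) \<and>
    is_alter_ego M (M_alpha M) \<and> fully_dualises_fin M (M_alpha M) \<and>
    (\<forall>S. is_alter_ego M S \<and> fully_dualises_fin M S \<longrightarrow> structural_reduct M (M_alpha M) S)"
proof -
  interpret fin_alg M by unfold_locales (fact assms(1), fact assms(2))
  note S0 = assms(3) and S1 = assms(7) and full1 = assms(8) and hc = assms(11)
  have ops0: "ops M0 \<subseteq> ops M2" and rels2: "rels M2 = rels M0"
    using assms(13) by (auto simp: M_two_def)
  have S2: "is_alter_ego M M2"
    using S0 unfolding assms(13) by (auto simp: is_alter_ego_def M_two_def)
  have opsA: "ops M0 \<subseteq> ops (M_alpha M)" and relsA: "rels M0 \<subseteq> R_alpha M"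
    using assms(6) by (auto simp: reduct_def)
  have R_alpha_ca: "R_alpha M \<subseteq> Rel_ca M (M_alpha M)"
    using R_alpha_compat by (auto intro: rels_subset_Rel_ca)
  have conv: "uH_sentence M1 \<phi>" "pure \<phi>" if "\<psi> \<in> \<Sigma>1" "\<not> concl_in_lang M0 \<psi>" "\<phi> \<in> conv \<psi>" for \<psi> \<phi>
    using assms(12) that unfolding pure_conversion_def by blast+
  have M2_ops: "h \<in> ops M0 \<or> (\<exists>\<psi>\<in>\<Sigma>1. \<not> concl_in_lang M0 \<psi> \<and>
      (\<exists>\<phi>\<in>conv \<psi>. dom h = new_domain M M0 en \<beta> \<phi>))" if "h \<in> ops M2" for h
    using that unfolding assms(13) by (auto simp: M_two_def)
  \<comment> \<open>Each added domain is defined by a formula over \<open>M0\<close>, hence over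
    \<open>M_alpha\<close>; as \<open>M_alpha\<close> fully dualises, it is rich at every relation
    that it defines.\<close>
  have "has_extension M (M_alpha M) h \<and> dom h \<in> Rel_ca M (M_alpha M)" if h: "h \<in> ops M2" for h
  proof -
    have c: "compat_op M h" by (rule is_alter_egoD(2)[OF S2 h])
    have "dom h \<in> Rel_ca M (M_alpha M)"
      using M2_ops[OF h]
    proof (elim disjE bexE conjE)
      assume "h \<in> ops M0"
      then show ?thesis using opsA R_alpha_ca by auto
    next
      fix \<psi> \<phi> assume \<phi>: "\<psi> \<in> \<Sigma>1" "\<not> concl_in_lang M0 \<psi>" "\<phi> \<in> conv \<psi>"
        and dh: "dom h = new_domain M M0 en \<beta> \<phi>"
      obtain k \<alpha>s where "ca_formula M0 k \<alpha>s" "dom h = defined_rel (self_struct M) k \<alpha>s"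
        unfolding dh by (rule new_domain_formula[OF S0 S1 hc conv[OF \<phi>]])
      moreover have "dom h \<noteq> {}" using c compat_relD(1) unfolding compat_op_iff by blast
      ultimately have "dom h \<in> Rel_ca M M0" unfolding Rel_ca_def by blast
      then show ?thesis using Rel_ca_mono[of M0 "M_alpha M"] opsA relsA by auto
    qed
    then show ?thesis
      using fully_dualises_rich[OF is_alter_ego_M_alpha fully_dualises_fin_M_alpha c] by blast
  qed
  then have "structural_reduct M M2 (M_alpha M)"
    using rels2 relsA R_alpha_ca unfolding structural_reduct_def by auto
  moreover have "structural_reduct M (M_alpha M) M2"
  proof -
    have "R_alpha M \<subseteq> Rel_ca M M0"
      by (rule R_alpha_subset_Rel_ca[OF hom_minimal_Rel_ca[OF S0 assms(4)]])
    then have sub: "R_alpha M \<subseteq> Rel_ca M M2"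
      using Rel_ca_mono[OF ops0] rels2 by blast
    have rich0: "has_extension M M2 h" if "compat_op M h" "dom h \<in> rels M0 \<union> dom ` ops M0" for h
      using has_extension_mono[OF ops0] assms(5) that unfolding operationally_rich_def by blast
    have "has_extension M M2 h" if h: "h \<in> ops (M_alpha M)" for h
    proof -
      define r where "r = dom h"
      have rR: "r \<in> R_alpha M" and c: "compat_op M h" using h by (auto simp: r_def)
      note rc = R_alpha_compat[OF rR]
      let ?Z = "sharp_struct M M2 r"
      have Z1: "is_struct M1 ?Z" by (rule is_struct_sharp[OF S1])
      have finZ: "finite (univ ?Z)" using finite_clo_fun[OF rc] by simp
      have "models ?Z \<psi>" if \<psi>: "\<psi> \<in> \<Sigma>1" for \<psi>
      proof -
        have u: "uH_sentence M1 \<psi>" "models (self_struct M) \<psi>"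
          using assms(10) \<psi> unfolding uH_basis_def by blast+
        show ?thesis
        proof (cases "concl_in_lang M0 \<psi>")
          case True
          show ?thesis by (rule sharp_models_if_concl_in_lang[OF S0 S1 S2 rc rich0 u True])
        next
          case False
          have eq: "uH_equivalent M1 \<psi> (conv \<psi>)"
            using assms(12) \<psi> False unfolding pure_conversion_def by blast
          \<comment> \<open>\<open>uH_equivalent\<close> compares structures on natural numbers, so
            \<open>M\<close> is copied to conclude that the pure sentences are true in it.\<close>
          have fm: "finite (univ (self_struct M))" using fin by simp
          obtain Y :: "(nat, 'a) struct" where Y: "is_struct M1 Y"
            "\<And>\<phi>. uH_sentence M1 \<phi> \<Longrightarrow> models Y \<phi> \<longleftrightarrow> models (self_struct M) \<phi>"
            using nat_copy_models[OF is_struct_self[OF S1] fm] by blast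
          have sm: "models (self_struct M) \<phi>" if "\<phi> \<in> conv \<psi>" for \<phi>
            using eq Y u conv(1)[OF \<psi> False that] that unfolding uH_equivalent_def by blast
          have "models ?Z \<phi>" if \<phi>: "\<phi> \<in> conv \<psi>" for \<phi>
          proof (cases "concl_in_lang M0 \<phi>")
            case True
            show ?thesis
              by (rule sharp_models_if_concl_in_lang[OF S0 S1 S2 rc rich0 conv(1)[OF \<psi> False \<phi>] sm[OF \<phi>] True])
          next
            case not_lang: False
            \<comment> \<open>Any such \<open>g\<close> was added to \<open>M2\<close>, so it is its
              own extension.\<close>
            have new: "has_extension M M2 g"
              if "compat_op M g" "dom g = new_domain M M0 en \<beta> \<phi>" for g
            proof -
              have "g \<in> ops M2"
                using that \<psi> False \<phi> not_lang unfolding assms(13) by (auto simp: M_two_def)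
              then show ?thesis
                unfolding has_extension_def by (intro bexI[of _ g] Clo_ep.base) auto
            qed
            show ?thesis
              by (rule sharp_models_pure[OF S0 S1 S2 rc hc new conv[OF \<psi> False \<phi>] sm[OF \<phi>] not_lang])
          qed
          \<comment> \<open>Returning from the pure sentences to \<open>\<psi>\<close> again uses
            \<open>uH_equivalent\<close>, so the structure of clone functions is copied too.\<close>
          moreover obtain Y' :: "(nat, 'a) struct" where Y': "is_struct M1 Y'"
            "\<And>\<phi>. uH_sentence M1 \<phi> \<Longrightarrow> models Y' \<phi> \<longleftrightarrow> models ?Z \<phi>"
            using nat_copy_models[OF Z1 finZ] by blast
          ultimately have "\<forall>\<phi>\<in>conv \<psi>. models Y' \<phi>" using conv(1)[OF \<psi> False] by blast
          then have "models Y' \<psi>" using eq Y'(1) unfolding uH_equivalent_def by blast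
          then show ?thesis using Y'(2)[OF u(1)] by simp
        qed
      qed
      then have sep: "separated M M1 ?Z" by (rule sharp_separated[OF S1 rc assms(10)])
      have dual1: "dualises_fin M M1" using full1 by (simp add: fully_dualises_fin_def)
      show ?thesis
      proof (rule has_extension_if_fully_dual[OF S1 full1 sep _ c])
        show "univ ?Z = clo_fun M M2 r" "dom h = r" by (simp_all add: r_def)
        show "(\<lambda>x\<in>univ ?Z. x zs) \<in> morphs M M1 ?Z" if "zs \<in> r" for zs
          using sharp_eval[OF S1 that] by simp
        show "map u (projs r) \<in> r" if "u \<in> morphs M M1 ?Z" for u
          by (rule sharp_hom_projs[OF S1 dual1 rR that])
      qed
    qed
    then show ?thesis using sub unfolding structural_reduct_def by auto
  qed
  ultimately have "structurally_equivalent M M2 (M_alpha M)" by (simp add: structurally_equivalent_def)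
  then show ?thesis
    using S2 is_alter_ego_M_alpha fully_dualises_fin_M_alpha M_alpha_smallest by blast
qed

end
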